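(* Let $u,v\in\mathbb{R}$. For each $N\in\mathbb{N}$ consider the open TASEP on $\{1,\dots,N\}$ with parameters $\alpha=\alpha(N)=\frac{1}{1+a_N}$, $\beta=\beta(N)=\frac{1}{1+b_N}$, where $$a_N=e^{-u/\sqrt N},\qquad b_N=e^{-v/\sqrt N},$$ and let $H_N$ be its steady state height function. Then, as $N\to\infty$, $$\left\{\frac{1}{\sqrt N}\bigl(2H_N(\lfloor xN\rfloor)-\lfloor Nx\rfloor\bigr)\right\}_{x\in[0,1]}\Rightarrow \{B_x+X_x\}_{x\in[0,1]},$$ where the convergence is weak convergence in Skorokhod's space $D[0,1]$ of càdlàg functions, $B$ and $X$ are independent processes on $[0,1]$ with continuous trajectories, $B$ is a Brownian motion of variance $1/2$, and the law $\mathbb{P}_X$ of $X$ on $C[0,1]$ is given by $$\frac{d\mathbb{P}_X}{d\mathbb{P}_B}(\omega)=\frac{1}{\mathfrak K(u,v)}\exp\Bigl((u+v)\min_{0\le x\le1}\omega(x)-v\,\omega(1)\Bigr),\qquad \omega\in C[0,1],$$ with $\mathbb{P}_B$ the law of $B$ on $C[0,1]$ and $\mathfrak K(u,v)$ the normalization constant.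
   Context: Open TASEP: for $\alpha,\beta\in(0,1)$, the totally asymmetric simple exclusion process with open boundaries on $\{1,\dots,N\}$ is the continuous-time Markov chain on $\{0,1\}^N$ (with $\tau_j=1$ iff site $j$ is occupied) with the following transitions: a particle at site $j$ ($1\le j\le N-1$) jumps to site $j+1$ at rate $1$ if site $j+1$ is empty; if site $1$ is empty, a particle is inserted there at rate $\alpha$; if site $N$ is occupied, its particle is removed at rate $\beta$. It has a unique stationary distribution. The steady state height function is $H_N(k)=\tau_1+\dots+\tau_k$, $k=0,1,\dots,N$, where $(\tau_1,\dots,\tau_N)$ is distributed according to the stationary distribution. "Brownian motion of variance $1/2$" means a centered Brownian motion started at $0$ with $\mathrm{Var}(B_x)=x/2$. *)

theory Defs
  imports "HOL-Probability.Probability"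
begin

section \<open>Open TASEP\<close>

definition tasep_configs :: "nat \<Rightarrow> (nat \<Rightarrow> nat) set" where
  "tasep_configs N = {1..N} \<rightarrow>\<^sub>E {0, 1}"

text \<open>The generator, acting on observables \<open>f\<close>: the sum over all admissible transitions
  \<open>\<tau> \<rightarrow> \<tau>'\<close> of rate times \<open>f \<tau>' - f \<tau>\<close>.\<close>

definition tasep_generator ::
  "nat \<Rightarrow> real \<Rightarrow> real \<Rightarrow> ((nat \<Rightarrow> nat) \<Rightarrow> real) \<Rightarrow> (nat \<Rightarrow> nat) \<Rightarrow> real" where
  "tasep_generator N \<alpha> \<beta> f \<tau> =
     (if \<tau> 1 = 0 then \<alpha> * (f (\<tau>(1 := 1)) - f \<tau>) else 0)
   + (\<Sum>j\<in>{1..<N}. if \<tau> j = 1 \<and> \<tau> (j + 1) = 0 then f (\<tau>(j := 0, j + 1 := 1)) - f \<tau> else 0)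
   + (if \<tau> N = 1 then \<beta> * (f (\<tau>(N := 0)) - f \<tau>) else 0)"

text \<open>The transition semigroup \<open>e\<^sup>t\<^sup>L\<close> of the continuous-time chain with generator \<open>L\<close>:
  \<open>tasep_semigroup N \<alpha> \<beta> t f \<tau>\<close> is the expectation of \<open>f\<close> at time \<open>t\<close> for the chain started
  at \<open>\<tau>\<close>.  On the finite set of configurations the exponential series always converges.\<close>

definition tasep_semigroup ::
  "nat \<Rightarrow> real \<Rightarrow> real \<Rightarrow> real \<Rightarrow> ((nat \<Rightarrow> nat) \<Rightarrow> real) \<Rightarrow> (nat \<Rightarrow> nat) \<Rightarrow> real" where
  "tasep_semigroup N \<alpha> \<beta> t f \<tau> = (\<Sum>n. t ^ n / fact n * (tasep_generator N \<alpha> \<beta> ^^ n) f \<tau>)"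

definition tasep_stationary :: "nat \<Rightarrow> real \<Rightarrow> real \<Rightarrow> (nat \<Rightarrow> nat) pmf \<Rightarrow> bool" where
  "tasep_stationary N \<alpha> \<beta> p \<longleftrightarrow>
     set_pmf p \<subseteq> tasep_configs N \<and>
     (\<forall>t\<ge>0. \<forall>f. measure_pmf.expectation p (tasep_semigroup N \<alpha> \<beta> t f)
                = measure_pmf.expectation p f)"

definition tasep_height :: "(nat \<Rightarrow> nat) \<Rightarrow> nat \<Rightarrow> nat" where
  "tasep_height \<tau> k = (\<Sum>j=1..k. \<tau> j)"


section \<open>The path spaces C[0,1] and D[0,1]\<close>

text \<open>Paths are functions on the real line that are \<open>undefined\<close> outside the unit interval.\<close>

definition C01 :: "(real \<Rightarrow> real) metric" where
  "C01 = cfunspace (top_of_set {0..1}) euclidean_metric"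

lemma mspace_C01: "mspace C01 = {f \<in> extensional {0..1}. continuous_on {0..1} f}"
proof -
  have "bounded (f ` {0..1})" if "continuous_on {0..1} f" for f :: "real \<Rightarrow> real"
    using that by (intro compact_imp_bounded compact_continuous_image) auto
  then show ?thesis
    by (auto simp: C01_def)
qed

definition cadlag01 :: "(real \<Rightarrow> real) set" where
  "cadlag01 = {f \<in> extensional {0..1}.
     (\<forall>t. 0 \<le> t \<and> t < 1 \<longrightarrow> (f \<longlongrightarrow> f t) (at_right t)) \<and>
     (\<forall>t. 0 < t \<and> t \<le> 1 \<longrightarrow> (\<exists>l. (f \<longlongrightarrow> l) (at_left t)))}"

definition time_change :: "(real \<Rightarrow> real) \<Rightarrow> bool" where
  "time_change \<theta> \<longleftrightarrow>
     strict_mono_on {0..1} \<theta> \<and> continuous_on {0..1} \<theta> \<and> \<theta> ` {0..1} = {0..1}"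

definition skorokhod_close :: "(real \<Rightarrow> real) \<Rightarrow> (real \<Rightarrow> real) \<Rightarrow> real set" where
  "skorokhod_close f g = {e. \<exists>\<theta>. time_change \<theta> \<and>
     (\<forall>t\<in>{0..1}. \<bar>\<theta> t - t\<bar> \<le> e) \<and> (\<forall>t\<in>{0..1}. \<bar>f t - g (\<theta> t)\<bar> \<le> e)}"

text \<open>The value 0 off the space is required by \<^locale>\<open>Metric_space\<close>, whose distance function
  is nonnegative and symmetric everywhere.\<close>

definition skorokhod_dist :: "(real \<Rightarrow> real) \<Rightarrow> (real \<Rightarrow> real) \<Rightarrow> real" where
  "skorokhod_dist f g =
     (if f \<in> cadlag01 \<and> g \<in> cadlag01 then Inf (skorokhod_close f g) else 0)"

definition D01 :: "(real \<Rightarrow> real) metric" where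
  "D01 = metric (cadlag01, skorokhod_dist)"

lemma time_change_id: "time_change (\<lambda>t. t)"
  by (auto simp: time_change_def strict_mono_on_def)

lemma time_change_in: "time_change \<theta> \<Longrightarrow> t \<in> {0..1} \<Longrightarrow> \<theta> t \<in> {0..1}"
  by (auto simp: time_change_def)

lemma time_change_mono:
  assumes "time_change \<theta>" "s \<in> {0..1}" "t \<in> {0..1}" "s \<le> t"
  shows "\<theta> s \<le> \<theta> t"
proof -
  have "mono_on {0..1} \<theta>"
    using assms(1) strict_mono_on_imp_mono_on unfolding time_change_def by blast
  then show ?thesis
    using assms(2-4) by (rule monotone_onD)
qed

lemma time_change_0:
  assumes "time_change \<theta>" shows "\<theta> 0 = 0"
proof -
  have "0 \<in> \<theta> ` {0..1}"
    using assms by (simp add: time_change_def)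
  then obtain s where s: "s \<in> {0..1}" "\<theta> s = 0"
    by (metis imageE)
  have "\<theta> 0 \<le> \<theta> s"
    using time_change_mono[OF assms, of 0 s] s by simp
  then show ?thesis
    using s time_change_in[OF assms, of 0] by auto
qed

lemma time_change_1:
  assumes "time_change \<theta>" shows "\<theta> 1 = 1"
proof -
  have "1 \<in> \<theta> ` {0..1}"
    using assms by (simp add: time_change_def)
  then obtain s where s: "s \<in> {0..1}" "\<theta> s = 1"
    by (metis imageE)
  have "\<theta> s \<le> \<theta> 1"
    using time_change_mono[OF assms, of s 1] s by simp
  then show ?thesis
    using s time_change_in[OF assms, of 1] by auto
qed

lemma time_change_comp:
  assumes "time_change \<theta>" "time_change \<phi>" shows "time_change (\<lambda>t. \<phi> (\<theta> t))"
  unfolding time_change_def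
proof (intro conjI)
  show "strict_mono_on {0..1} (\<lambda>t. \<phi> (\<theta> t))"
    using assms time_change_in[OF assms(1)] unfolding time_change_def strict_mono_on_def by blast
  show "continuous_on {0..1} (\<lambda>t. \<phi> (\<theta> t))"
    using assms unfolding time_change_def
    by (intro continuous_on_compose2[of "{0..1}" \<phi> "{0..1}" \<theta>]) auto
  show "(\<lambda>t. \<phi> (\<theta> t)) ` {0..1} = {0..1}"
    using assms unfolding time_change_def by (metis image_image)
qed

lemma time_change_inverse:
  assumes "time_change \<theta>"
  obtains \<phi> where "time_change \<phi>" "\<And>t. t \<in> {0..1} \<Longrightarrow> \<phi> t \<in> {0..1} \<and> \<theta> (\<phi> t) = t"
proof
  let ?\<phi> = "the_inv_into {0..1} \<theta>"
  have inj: "inj_on \<theta> {0..1}" and im: "\<theta> ` {0..1} = {0..1}" and cont: "continuous_on {0..1} \<theta>"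
    using assms strict_mono_on_imp_inj_on unfolding time_change_def by blast+
  show *: "?\<phi> t \<in> {0..1} \<and> \<theta> (?\<phi> t) = t" if "t \<in> {0..1}" for t
    using that im inj by (metis f_the_inv_into_f order_refl the_inv_into_into)
  show "time_change ?\<phi>"
    unfolding time_change_def
  proof (intro conjI)
    show "continuous_on {0..1} ?\<phi>"
      using continuous_on_inv_into[OF cont compact_Icc inj] im by simp
    show "?\<phi> ` {0..1} = {0..1}"
      using inj im by (metis the_inv_into_onto)
    show "strict_mono_on {0..1} ?\<phi>"
    proof (rule strict_mono_onI)
      fix r s :: real assume rs: "r \<in> {0..1}" "s \<in> {0..1}" "r < s"
      show "?\<phi> r < ?\<phi> s"
      proof (rule ccontr)
        assume "\<not> ?\<phi> r < ?\<phi> s"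
        then have "\<theta> (?\<phi> s) \<le> \<theta> (?\<phi> r)"
          using time_change_mono[OF assms, of "?\<phi> s" "?\<phi> r"] *[OF rs(1)] *[OF rs(2)] by linarith
        with *[OF rs(1)] *[OF rs(2)] rs(3) show False by auto
      qed
    qed
  qed
qed

lemma cadlag01_bounded:
  assumes "f \<in> cadlag01" shows "\<exists>K. \<forall>t\<in>{0..1}. \<bar>f t\<bar> \<le> K"
proof -
  define P where "P a b \<longleftrightarrow> (\<exists>K. \<forall>t\<in>{a..b} \<inter> {0..1}. \<bar>f t\<bar> \<le> K)" for a b
  have "P 0 1"
  proof (rule Bolzano)
    fix a b c assume "P a b" "P b c" "a \<le> b" "b \<le> c"
    then obtain K L where K: "\<forall>t\<in>{a..b} \<inter> {0..1}. \<bar>f t\<bar> \<le> K"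
      and L: "\<forall>t\<in>{b..c} \<inter> {0..1}. \<bar>f t\<bar> \<le> L" unfolding P_def by blast
    have "\<bar>f t\<bar> \<le> max K L" if "t \<in> {a..c} \<inter> {0..1}" for t
      using that K L by (cases "t \<le> b") (force simp: le_max_iff_disj)+
    then show "P a c" unfolding P_def by blast
  next
    fix x :: real assume x: "0 \<le> x" "x \<le> 1"
    have "\<exists>d>0. \<exists>K. \<forall>t. x < t \<and> t < x + d \<and> t \<le> 1 \<longrightarrow> \<bar>f t\<bar> \<le> K"
    proof (cases "x = 1")
      case True then show ?thesis by (intro exI[of _ 1]) auto
    next
      case False
      with assms x have "(f \<longlongrightarrow> f x) (at_right x)" unfolding cadlag01_def by auto
      then have "eventually (\<lambda>t. dist (f t) (f x) < 1) (at_right x)"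
        by (rule tendstoD) simp
      then obtain b where b: "b > x" "\<And>t. x < t \<Longrightarrow> t < b \<Longrightarrow> dist (f t) (f x) < 1"
        unfolding eventually_at_right_field by blast
      have "\<forall>t. x < t \<and> t < x + (b - x) \<and> t \<le> 1 \<longrightarrow> \<bar>f t\<bar> \<le> \<bar>f x\<bar> + 1"
        using b(2) by (force simp: dist_real_def)
      moreover have "0 < b - x" using b(1) by simp
      ultimately show ?thesis by blast
    qed
    then obtain d K where d: "d > 0" "\<And>t. x < t \<Longrightarrow> t < x + d \<Longrightarrow> t \<le> 1 \<Longrightarrow> \<bar>f t\<bar> \<le> K" by blast
    have "\<exists>e>0. \<exists>L. \<forall>t. x - e < t \<and> t < x \<and> 0 \<le> t \<longrightarrow> \<bar>f t\<bar> \<le> L"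
    proof (cases "x = 0")
      case True then show ?thesis by (intro exI[of _ 1]) auto
    next
      case False
      with assms x obtain l where "(f \<longlongrightarrow> l) (at_left x)" unfolding cadlag01_def by fastforce
      then have "eventually (\<lambda>t. dist (f t) l < 1) (at_left x)"
        by (rule tendstoD) simp
      then obtain b where b: "b < x" "\<And>t. b < t \<Longrightarrow> t < x \<Longrightarrow> dist (f t) l < 1"
        unfolding eventually_at_left_field by blast
      have "\<forall>t. x - (x - b) < t \<and> t < x \<and> 0 \<le> t \<longrightarrow> \<bar>f t\<bar> \<le> \<bar>l\<bar> + 1"
        using b(2) by (force simp: dist_real_def)
      moreover have "0 < x - b" using b(1) by simp
      ultimately show ?thesis by blast
    qed
    then obtain e L where e: "e > 0" "\<And>t. x - e < t \<Longrightarrow> t < x \<Longrightarrow> 0 \<le> t \<Longrightarrow> \<bar>f t\<bar> \<le> L" by blast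
    show "\<exists>d>0. \<forall>a b. a \<le> x \<and> x \<le> b \<and> b - a < d \<longrightarrow> P a b"
    proof (intro exI[of _ "min d e"] conjI allI impI)
      show "0 < min d e" using d e by simp
      fix a b assume ab: "a \<le> x \<and> x \<le> b \<and> b - a < min d e"
      have "\<bar>f t\<bar> \<le> max \<bar>f x\<bar> (max K L)" if "t \<in> {a..b} \<inter> {0..1}" for t
      proof -
        consider "t < x" | "t = x" | "x < t" by linarith
        then show ?thesis
        proof cases
          case 1 then show ?thesis using e(2)[of t] ab that by auto
        next
          case 2 then show ?thesis by simp
        next
          case 3 then show ?thesis using d(2)[of t] ab that by auto
        qed
      qed
      then show "P a b" unfolding P_def by blast
    qed
  qed simp
  then show ?thesis unfolding P_def by auto
qed

lemma skorokhod_close_nonneg: "e \<in> skorokhod_close f g \<Longrightarrow> 0 \<le> e"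
proof -
  assume "e \<in> skorokhod_close f g"
  then obtain \<theta> where "\<forall>t\<in>{0..1}. \<bar>\<theta> t - t\<bar> \<le> e" unfolding skorokhod_close_def by blast
  then have "\<bar>\<theta> 0 - 0\<bar> \<le> e" by (rule bspec) simp
  then show "0 \<le> e" by linarith
qed

lemma skorokhod_close_bdd: "bdd_below (skorokhod_close f g)"
  using skorokhod_close_nonneg by (meson bdd_below.I)

lemma skorokhod_close_nonempty:
  assumes "f \<in> cadlag01" "g \<in> cadlag01" shows "skorokhod_close f g \<noteq> {}"
proof -
  obtain K L where K: "\<forall>t\<in>{0..1}. \<bar>f t\<bar> \<le> K" and L: "\<forall>t\<in>{0..1}. \<bar>g t\<bar> \<le> L"
    using assms[THEN cadlag01_bounded] by blast
  have "\<bar>f t - g t\<bar> \<le> K + L" if "t \<in> {0..1}" for t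
    using K L that by (smt (verit) abs_triangle_ineq4)
  moreover from this[of 0] have "0 \<le> K + L" by simp
  ultimately have "K + L \<in> skorokhod_close f g"
    unfolding skorokhod_close_def using time_change_id by auto
  then show ?thesis by blast
qed

lemma skorokhod_close_sym: "skorokhod_close f g \<subseteq> skorokhod_close g f"
proof
  fix e assume "e \<in> skorokhod_close f g"
  then obtain \<theta> where \<theta>: "time_change \<theta>" "\<forall>t\<in>{0..1}. \<bar>\<theta> t - t\<bar> \<le> e"
    "\<forall>t\<in>{0..1}. \<bar>f t - g (\<theta> t)\<bar> \<le> e" unfolding skorokhod_close_def by blast
  obtain \<phi> where \<phi>: "time_change \<phi>" "\<And>t. t \<in> {0..1} \<Longrightarrow> \<phi> t \<in> {0..1} \<and> \<theta> (\<phi> t) = t"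
    using time_change_inverse[OF \<theta>(1)] by blast
  have "\<bar>\<phi> t - t\<bar> \<le> e" "\<bar>g t - f (\<phi> t)\<bar> \<le> e" if "t \<in> {0..1}" for t
    using \<phi>(2)[OF that] \<theta>(2,3) by (metis abs_minus_commute)+
  with \<phi>(1) show "e \<in> skorokhod_close g f" unfolding skorokhod_close_def by blast
qed

lemma skorokhod_close_triangle:
  assumes "d \<in> skorokhod_close f g" "e \<in> skorokhod_close g h"
  shows "d + e \<in> skorokhod_close f h"
proof -
  obtain \<theta> where \<theta>: "time_change \<theta>" "\<forall>t\<in>{0..1}. \<bar>\<theta> t - t\<bar> \<le> d"
    "\<forall>t\<in>{0..1}. \<bar>f t - g (\<theta> t)\<bar> \<le> d" using assms unfolding skorokhod_close_def by blast
  obtain \<phi> where \<phi>: "time_change \<phi>" "\<forall>t\<in>{0..1}. \<bar>\<phi> t - t\<bar> \<le> e"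
    "\<forall>t\<in>{0..1}. \<bar>g t - h (\<phi> t)\<bar> \<le> e" using assms unfolding skorokhod_close_def by blast
  have "\<bar>\<phi> (\<theta> t) - t\<bar> \<le> d + e" "\<bar>f t - h (\<phi> (\<theta> t))\<bar> \<le> d + e" if "t \<in> {0..1}" for t
    using \<theta>(2,3) \<phi>(2,3) that time_change_in[OF \<theta>(1) that] by (smt (verit))+
  then show ?thesis
    unfolding skorokhod_close_def using time_change_comp[OF \<theta>(1) \<phi>(1)] by blast
qed

lemma skorokhod_close_eq:
  assumes f: "f \<in> cadlag01" and g: "g \<in> cadlag01"
    and close: "\<And>e. e > 0 \<Longrightarrow> \<exists>d\<in>skorokhod_close f g. d < e"
  shows "f = g"
proof -
  have one: "f t = g t" if t: "t = 0 \<or> t = 1" for t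
  proof (rule ccontr)
    assume "f t \<noteq> g t"
    then obtain d where d: "d \<in> skorokhod_close f g" "d < \<bar>f t - g t\<bar>"
      using close[of "\<bar>f t - g t\<bar>"] by auto
    then obtain \<theta> where "time_change \<theta>" "\<forall>t\<in>{0..1}. \<bar>f t - g (\<theta> t)\<bar> \<le> d"
      unfolding skorokhod_close_def by blast
    then have "\<bar>f t - g t\<bar> \<le> d"
      using t time_change_0 time_change_1 by (metis atLeastAtMost_iff order_refl zero_le_one)
    with d show False by simp
  qed
  text \<open>At every time the value of \<open>f\<close> is the value or the left limit of \<open>g\<close>.\<close>
  have dich: "f t = g t \<or> f t = l" if t: "0 < t" "t < 1" and l: "(g \<longlongrightarrow> l) (at_left t)" for t l
  proof (rule ccontr)
    assume neq: "\<not> (f t = g t \<or> f t = l)"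
    define e where "e = min \<bar>f t - g t\<bar> \<bar>f t - l\<bar> / 2"
    have e: "e > 0" "2 * e \<le> \<bar>f t - g t\<bar>" "2 * e \<le> \<bar>f t - l\<bar>"
      using neq unfolding e_def by auto
    have "(g \<longlongrightarrow> g t) (at_right t)" using g t unfolding cadlag01_def by auto
    then have "eventually (\<lambda>s. dist (g s) (g t) < e) (at_right t)"
      using e(1) by (rule tendstoD)
    then obtain b where b: "b > t" "\<And>s. t < s \<Longrightarrow> s < b \<Longrightarrow> dist (g s) (g t) < e"
      unfolding eventually_at_right_field by blast
    have "eventually (\<lambda>s. dist (g s) l < e) (at_left t)"
      using l e(1) by (rule tendstoD)
    then obtain a where a: "a < t" "\<And>s. a < s \<Longrightarrow> s < t \<Longrightarrow> dist (g s) l < e"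
      unfolding eventually_at_left_field by blast
    obtain d where d: "d \<in> skorokhod_close f g" "d < min e (min (b - t) (t - a))"
      using close[of "min e (min (b - t) (t - a))"] a b e by auto
    then obtain \<theta> where \<theta>: "\<forall>t\<in>{0..1}. \<bar>\<theta> t - t\<bar> \<le> d" "\<forall>t\<in>{0..1}. \<bar>f t - g (\<theta> t)\<bar> \<le> d"
      unfolding skorokhod_close_def by blast
    have 1: "\<bar>\<theta> t - t\<bar> \<le> d" "\<bar>f t - g (\<theta> t)\<bar> \<le> d" using \<theta> t by auto
    consider "\<theta> t < t" | "\<theta> t = t" | "t < \<theta> t" by linarith
    then show False
    proof cases
      case 1
      then have "dist (g (\<theta> t)) l < e" using a(2)[of "\<theta> t"] d(2) \<open>\<bar>\<theta> t - t\<bar> \<le> d\<close> by linarith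
      then show False using \<open>\<bar>f t - g (\<theta> t)\<bar> \<le> d\<close> d(2) e by (auto simp: dist_real_def)
    next
      case 2
      then show False using \<open>\<bar>f t - g (\<theta> t)\<bar> \<le> d\<close> d(2) e by auto
    next
      case 3
      then have "dist (g (\<theta> t)) (g t) < e" using b(2)[of "\<theta> t"] d(2) \<open>\<bar>\<theta> t - t\<bar> \<le> d\<close> by linarith
      then show False using \<open>\<bar>f t - g (\<theta> t)\<bar> \<le> d\<close> d(2) e by (auto simp: dist_real_def)
    qed
  qed
  have mid: "f t = g t" if t: "0 < t" "t < 1" for t
  proof -
    have "(f \<longlongrightarrow> g t) (at_right t)"
    proof (rule tendstoI)
      fix e :: real assume e: "e > 0"
      have "(g \<longlongrightarrow> g t) (at_right t)" using g t unfolding cadlag01_def by auto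
      then have "eventually (\<lambda>s. dist (g s) (g t) < e / 2) (at_right t)"
        using e by (intro tendstoD) auto
      then obtain b where b: "b > t" "\<And>s. t < s \<Longrightarrow> s < b \<Longrightarrow> dist (g s) (g t) < e / 2"
        unfolding eventually_at_right_field by blast
      have "dist (f s) (g t) < e" if s: "t < s" "s < min b 1" for s
      proof -
        obtain l where l: "(g \<longlongrightarrow> l) (at_left s)"
          using g s t unfolding cadlag01_def by fastforce
        have "eventually (\<lambda>r. dist (g r) (g t) \<le> e / 2) (at_left s)"
          unfolding eventually_at_left_field
          using s b(2) by (intro exI[of _ t]) (auto intro: less_imp_le)
        then have "dist l (g t) \<le> e / 2"
          by (intro tendsto_upperbound[OF tendsto_dist[OF l tendsto_const]]) auto
        moreover have "dist (g s) (g t) < e / 2" using b(2) s by auto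
        ultimately show ?thesis using dich[OF _ _ l] s t e by auto
      qed
      then show "eventually (\<lambda>s. dist (f s) (g t) < e) (at_right t)"
        unfolding eventually_at_right_field using b t by (intro exI[of _ "min b 1"]) auto
    qed
    moreover have "(f \<longlongrightarrow> f t) (at_right t)" using f t unfolding cadlag01_def by auto
    ultimately show ?thesis
      by (meson tendsto_unique trivial_limit_at_right_real)
  qed
  show ?thesis
  proof (rule extensionalityI[of _ "{0..1}"])
    fix t :: real assume "t \<in> {0..1}"
    then show "f t = g t" using one mid by (cases "t = 0 \<or> t = 1") auto
  qed (use f g in \<open>auto simp: cadlag01_def\<close>)
qed

lemma Metric_space_skorokhod: "Metric_space cadlag01 skorokhod_dist"
proof
  fix f g h
  show "0 \<le> skorokhod_dist f g"
    unfolding skorokhod_dist_def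
    using skorokhod_close_nonempty skorokhod_close_nonneg by (auto intro: cInf_greatest)
  show "skorokhod_dist f g = skorokhod_dist g f"
    unfolding skorokhod_dist_def using skorokhod_close_sym by (metis subset_antisym)
  show "skorokhod_dist f g = 0 \<longleftrightarrow> f = g" if fg: "f \<in> cadlag01" "g \<in> cadlag01"
  proof
    assume "skorokhod_dist f g = 0"
    then have "Inf (skorokhod_close f g) = 0" using fg by (simp add: skorokhod_dist_def)
    then have "\<exists>d\<in>skorokhod_close f g. d < e" if "e > 0" for e
      using that cInf_lessD[OF skorokhod_close_nonempty[OF fg]] by auto
    then show "f = g" using skorokhod_close_eq[OF fg] by blast
  next
    assume "f = g"
    then have "0 \<in> skorokhod_close f g"
      unfolding skorokhod_close_def using time_change_id by auto
    then have "Inf (skorokhod_close f g) \<le> 0" by (rule cInf_lower[OF _ skorokhod_close_bdd])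
    moreover have "0 \<le> Inf (skorokhod_close f g)"
      using skorokhod_close_nonempty[OF fg] skorokhod_close_nonneg by (auto intro: cInf_greatest)
    ultimately show "skorokhod_dist f g = 0" using fg by (simp add: skorokhod_dist_def)
  qed
  show "skorokhod_dist f h \<le> skorokhod_dist f g + skorokhod_dist g h"
    if fgh: "f \<in> cadlag01" "g \<in> cadlag01" "h \<in> cadlag01"
  proof (rule field_le_epsilon)
    fix e :: real assume e: "e > 0"
    obtain a where a: "a \<in> skorokhod_close f g" "a < Inf (skorokhod_close f g) + e / 2"
      using cInf_lessD[OF skorokhod_close_nonempty[OF fgh(1,2)], of "Inf (skorokhod_close f g) + e / 2"] e
      by auto
    obtain b where b: "b \<in> skorokhod_close g h" "b < Inf (skorokhod_close g h) + e / 2"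
      using cInf_lessD[OF skorokhod_close_nonempty[OF fgh(2,3)], of "Inf (skorokhod_close g h) + e / 2"] e
      by auto
    have "Inf (skorokhod_close f h) \<le> a + b"
      by (rule cInf_lower[OF skorokhod_close_triangle[OF a(1) b(1)] skorokhod_close_bdd])
    then show "skorokhod_dist f h \<le> skorokhod_dist f g + skorokhod_dist g h + e"
      using a b fgh by (simp add: skorokhod_dist_def)
  qed
qed

lemma mspace_D01 [simp]: "mspace D01 = cadlag01"
  and mdist_D01 [simp]: "mdist D01 = skorokhod_dist"
  by (simp_all add: D01_def Metric_space.mspace_metric[OF Metric_space_skorokhod]
      Metric_space.mdist_metric[OF Metric_space_skorokhod])


section \<open>Laws of processes and weak convergence\<close>

definition borel_of :: "'a topology \<Rightarrow> 'a measure" where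
  "borel_of T = sigma (topspace T) {U. openin T U}"

definition converges_weakly :: "'a topology \<Rightarrow> (nat \<Rightarrow> 'a measure) \<Rightarrow> 'a measure \<Rightarrow> bool" where
  "converges_weakly T \<mu>s \<mu> \<longleftrightarrow>
     (\<forall>n. prob_space (\<mu>s n) \<and> sets (\<mu>s n) = sets (borel_of T)) \<and>
     prob_space \<mu> \<and> sets \<mu> = sets (borel_of T) \<and>
     (\<forall>F. continuous_map T euclideanreal F \<and> bounded (F ` topspace T) \<longrightarrow>
        (\<lambda>n. integral\<^sup>L (\<mu>s n) F) \<longlonglongrightarrow> integral\<^sup>L \<mu> F)"

text \<open>A real-valued process is a function of time and of the sample point.\<close>

definition trajectory :: "(real \<Rightarrow> 'a \<Rightarrow> real) \<Rightarrow> 'a \<Rightarrow> (real \<Rightarrow> real)" where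
  "trajectory Y \<omega> = (\<lambda>x\<in>{0..1}. Y x \<omega>)"

definition continuous_process :: "'a measure \<Rightarrow> (real \<Rightarrow> 'a \<Rightarrow> real) \<Rightarrow> bool" where
  "continuous_process M Y \<longleftrightarrow>
     (\<forall>x\<in>{0..1}. Y x \<in> borel_measurable M) \<and>
     (\<forall>\<omega>\<in>space M. continuous_on {0..1} (\<lambda>x. Y x \<omega>))"

definition law_on :: "(real \<Rightarrow> real) metric \<Rightarrow> 'a measure \<Rightarrow> (real \<Rightarrow> 'a \<Rightarrow> real) \<Rightarrow>
    (real \<Rightarrow> real) measure" where
  "law_on S M Y = distr M (borel_of (mtopology_of S)) (trajectory Y)"

text \<open>Brownian motion on the unit interval, started at 0, with \<open>Var (B\<^sub>x) = \<sigma>2 * x\<close>.\<close>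

definition brownian_motion :: "'a measure \<Rightarrow> real \<Rightarrow> (real \<Rightarrow> 'a \<Rightarrow> real) \<Rightarrow> bool" where
  "brownian_motion M \<sigma>2 B \<longleftrightarrow>
     continuous_process M B \<and>
     (AE \<omega> in M. B 0 \<omega> = 0) \<and>
     (\<forall>s t. 0 \<le> s \<and> s < t \<and> t \<le> 1 \<longrightarrow>
        distributed M lborel (\<lambda>\<omega>. B t \<omega> - B s \<omega>) (normal_density 0 (sqrt (\<sigma>2 * (t - s))))) \<and>
     (\<forall>n (t :: nat \<Rightarrow> real). t ` {..n} \<subseteq> {0..1} \<and> mono_on {..n} t \<longrightarrow>
        prob_space.indep_vars M (\<lambda>_. borel) (\<lambda>i \<omega>. B (t (Suc i)) \<omega> - B (t i) \<omega>) {..<n})"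

text \<open>The unnormalized density; the infimum is attained for continuous \<open>w\<close>.\<close>

definition tilt :: "real \<Rightarrow> real \<Rightarrow> (real \<Rightarrow> real) \<Rightarrow> real" where
  "tilt u v w = exp ((u + v) * (INF x\<in>{0..1}. w x) - v * w 1)"

end

(* The stationary weight of a configuration \<tau> is a sum over a second, auxiliary configuration \<xi> of
   exp ((p + q) min D - q D_N), where D is the difference of the two height functions, a = exp (- p) and
   b = exp (- q): these two-layer weights satisfy the recursions of the matrix product ansatz, and the
   stationary law is unique because the chain is irreducible.  Hence the stationary expectation of F is
   the ratio E[F(T) tilt(X)] / E[tilt(X)] for two independent fair coin walks, T being the rescaled first
   walk and X half the difference of the two.

   It remains to prove a Donsker theorem for (T, X).  Bounded Lipschitz test functions are discretised in
   time with the help of a maximal inequality, the block increments are handled by characteristic functions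
   and Skorokhod couplings, and rotating the Gaussian pair turns the two limiting Brownian motions into
   B1 + B2 and B2.  A transfer-operator bound on the second moment of the tilt supplies the uniform
   integrability. *)

theory Submission
  imports Defs "HOL-Real_Asymp.Real_Asymp"
begin

section \<open>Test functions on the path space\<close>

text \<open>Why the limit splits as \<open>B + X\<close>: the tilt depends on the two walks only
  through half their difference \<open>X\<close>. In the Gaussian limit the half sum
  \<open>T - X\<close> and the half difference \<open>X\<close> are independent, each of variance
  1/2 per unit of time, so tilting leaves the first alone and turns the second into the process of
  the theorem.

  The obstacle is that the tilt is neither bounded nor uniformly Lipschitz. Its exponent is
  Lipschitz for the uniform distance, so cutting the tilt off at a level \<open>R\<close> restores
  both properties. The error is paid for by the second moment: squaring the tilt only doubles
  \<open>u\<close> and \<open>v\<close>, hence one bound on partition functions, valid for all real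
  parameters, is enough. On the limiting side no Gaussian estimate for the minimum is made: that
  \<open>X\<close> has a probability law with the given density already forces the tilt to be
  integrable.\<close>

definition step_path :: "nat \<Rightarrow> (nat \<Rightarrow> real) \<Rightarrow> real \<Rightarrow> real" where
  "step_path n c = (\<lambda>x\<in>{0..1}. c (nat \<lfloor>real n * x\<rfloor>))"

lemma nat_floor_le:
  assumes "x \<in> {0..1}"
  shows "nat \<lfloor>real n * x\<rfloor> \<le> n"
  using assms mult_left_mono[of x 1 "real n"] by (simp add: floor_le_iff nat_le_iff)

lemma step_path_cadlag: "step_path n c \<in> cadlag01"
proof (cases "n = 0")
  \<comment> \<open>Weak convergence as defined asks for a law on D01 at every index, so length 0
    has to give a cadlag path too.\<close>
  case True
  then have e: "step_path n c = (\<lambda>x\<in>{0..1}. c 0)" by (auto simp: step_path_def)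
  have "eventually (\<lambda>x. (\<lambda>x\<in>{0..1}. c 0) x = c 0) (at_right t)" if "0 \<le> t" "t < 1" for t :: real
    unfolding eventually_at_right_field using that by (intro exI[of _ 1]) auto
  moreover have "eventually (\<lambda>x. (\<lambda>x\<in>{0..1}. c 0) x = c 0) (at_left t)" if "0 < t" "t \<le> 1" for t :: real
    unfolding eventually_at_left_field using that by (intro exI[of _ 0]) auto
  ultimately show ?thesis
    unfolding e cadlag01_def by (auto intro!: tendsto_eventually exI[of _ "c 0"])
next
  case False
  then have n: "real n > 0" by simp
  have R: "eventually (\<lambda>x. step_path n c x = step_path n c t) (at_right t)" if "0 \<le> t" "t < 1" for t
  proof -
    let ?b = "min 1 ((of_int \<lfloor>real n * t\<rfloor> + 1) / real n)"
    have "t < ?b" using that n by (simp add: field_simps) linarith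
    moreover have "step_path n c x = step_path n c t" if x: "t < x" "x < ?b" for x
    proof -
      have "real n * t < real n * x" using n x by simp
      moreover have "real n * x < of_int \<lfloor>real n * t\<rfloor> + 1" using x n by (simp add: field_simps)
      ultimately have "\<lfloor>real n * x\<rfloor> = \<lfloor>real n * t\<rfloor>" by linarith
      then show ?thesis using that \<open>0 \<le> t\<close> x unfolding step_path_def by auto
    qed
    ultimately show ?thesis unfolding eventually_at_right_field by blast
  qed
  \<comment> \<open>Just to the left of \<open>t\<close> the integer part of \<open>n x\<close> is
    the ceiling of \<open>n t\<close> minus 1, whether or not \<open>t\<close> is a grid
    point.\<close>
  have L: "eventually (\<lambda>x. step_path n c x = c (nat (\<lceil>real n * t\<rceil> - 1))) (at_left t)"
    if "0 < t" "t \<le> 1" for t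
  proof -
    let ?b = "max 0 ((of_int \<lceil>real n * t\<rceil> - 1) / real n)"
    have "?b < t" using that n by (simp add: field_simps) linarith
    moreover have "step_path n c x = c (nat (\<lceil>real n * t\<rceil> - 1))" if x: "?b < x" "x < t" for x
    proof -
      have "real n * x < real n * t" using n x by simp
      moreover have "of_int \<lceil>real n * t\<rceil> - 1 < real n * x" using x n by (simp add: field_simps)
      ultimately have "\<lfloor>real n * x\<rfloor> = \<lceil>real n * t\<rceil> - 1" by linarith
      then show ?thesis using that \<open>t \<le> 1\<close> x unfolding step_path_def by auto
    qed
    ultimately show ?thesis unfolding eventually_at_left_field by blast
  qed
  have "step_path n c \<in> extensional {0..1}" by (simp add: step_path_def)
  then show ?thesis
    unfolding cadlag01_def using tendsto_eventually[OF R] tendsto_eventually[OF L] by blast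
qed

lemma continuous_cadlag:
  assumes "f \<in> extensional {0..1}" "continuous_on {0..1} f"
  shows "f \<in> cadlag01"
proof -
  have "(f \<longlongrightarrow> f t) (at_right t)" if "0 \<le> t" "t < 1" for t
  proof -
    have "continuous_on {t..1} f"
      by (rule continuous_on_subset[OF assms(2)]) (use that in auto)
    then show ?thesis using that(2) by (rule continuous_on_Icc_at_rightD)
  qed
  moreover have "(f \<longlongrightarrow> f t) (at_left t)" if "0 < t" "t \<le> 1" for t
  proof -
    have "continuous_on {0..t} f"
      by (rule continuous_on_subset[OF assms(2)]) (use that in auto)
    then show ?thesis using that by (intro continuous_on_Icc_at_leftD) auto
  qed
  ultimately show ?thesis using assms(1) unfolding cadlag01_def by blast
qed

text \<open>Joint Lipschitz continuity for the uniform distance, phrased with an arbitrary common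
  bound \<open>e\<close> instead of a supremum. The first slot will hold the height path, the second
  the path that enters the tilt.\<close>

definition unif_lip2 :: "real \<Rightarrow> ((real \<Rightarrow> real) \<Rightarrow> (real \<Rightarrow> real) \<Rightarrow> real) \<Rightarrow> bool" where
  "unif_lip2 L h \<longleftrightarrow> (\<forall>f\<in>cadlag01. \<forall>f'\<in>cadlag01. \<forall>g\<in>cadlag01. \<forall>g'\<in>cadlag01. \<forall>e.
     (\<forall>x\<in>{0..1}. \<bar>f x - f' x\<bar> \<le> e) \<and> (\<forall>x\<in>{0..1}. \<bar>g x - g' x\<bar> \<le> e) \<longrightarrow> \<bar>h f g - h f' g'\<bar> \<le> L * e)"

lemma unif_lip2D:
  assumes "unif_lip2 L h" "f \<in> cadlag01" "f' \<in> cadlag01" "g \<in> cadlag01" "g' \<in> cadlag01"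
    "\<And>x. x \<in> {0..1} \<Longrightarrow> \<bar>f x - f' x\<bar> \<le> e" "\<And>x. x \<in> {0..1} \<Longrightarrow> \<bar>g x - g' x\<bar> \<le> e"
  shows "\<bar>h f g - h f' g'\<bar> \<le> L * e"
  using assms unfolding unif_lip2_def by blast

text \<open>A step path has finitely many values; the sum of their deviations dominates the uniform
  distance and tends to 0 in the product topology. This continuity is what lets weak convergence of
  block increments act on path functionals.\<close>

lemma step_functional_continuous:
  fixes A B :: "nat \<Rightarrow> ('i \<Rightarrow> real) \<Rightarrow> real"
  assumes h: "unif_lip2 L h"
    and A: "\<And>i. i \<le> n \<Longrightarrow> continuous_on UNIV (A i)" and B: "\<And>i. i \<le> n \<Longrightarrow> continuous_on UNIV (B i)"
  shows "continuous_on UNIV (\<lambda>v. h (step_path n (\<lambda>i. A i v)) (step_path n (\<lambda>i. B i v)))"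
    (is "continuous_on UNIV ?H")
  unfolding continuous_on_def
proof
  fix v :: "'i \<Rightarrow> real"
  define e where "e w = (\<Sum>i\<le>n. \<bar>A i w - A i v\<bar> + \<bar>B i w - B i v\<bar>)" for w
  have lim: "((\<lambda>w. L * e w) \<longlongrightarrow> L * (\<Sum>i\<le>n. \<bar>A i v - A i v\<bar> + \<bar>B i v - B i v\<bar>)) (at v)"
    unfolding e_def using A B
    by (intro tendsto_intros) (auto simp: continuous_on_def)
  have le: "\<bar>?H w - ?H v\<bar> \<le> L * e w" for w
  proof (rule unif_lip2D[OF h])
    fix x :: real assume x: "x \<in> {0..1}"
    have i: "nat \<lfloor>real n * x\<rfloor> \<le> n" using x by (rule nat_floor_le)
    have "\<bar>A i w - A i v\<bar> + \<bar>B i w - B i v\<bar> \<le> e w" if "i \<le> n" for i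
      unfolding e_def using that by (intro member_le_sum) auto
    from this[OF i] show "\<bar>step_path n (\<lambda>i. A i w) x - step_path n (\<lambda>i. A i v) x\<bar> \<le> e w"
      "\<bar>step_path n (\<lambda>i. B i w) x - step_path n (\<lambda>i. B i v) x\<bar> \<le> e w"
      using x unfolding step_path_def by auto
  qed (rule step_path_cadlag)+
  have "((\<lambda>w. ?H w - ?H v) \<longlongrightarrow> 0) (at v)"
    by (rule Lim_null_comparison[OF always_eventually]) (use le lim in auto)
  then show "(?H \<longlongrightarrow> ?H v) (at v within UNIV)"
    by (simp add: LIM_zero_iff)
qed

definition disc :: "nat \<Rightarrow> (real \<Rightarrow> real) \<Rightarrow> real \<Rightarrow> real" where
  "disc m f = step_path m (\<lambda>i. f (real i / real m))"

lemma disc_cadlag: "disc m f \<in> cadlag01"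
  unfolding disc_def by (rule step_path_cadlag)

lemma disc_approx:
  assumes f: "continuous_on {0..1} f" and e: "e > 0"
  shows "eventually (\<lambda>m. \<forall>x\<in>{0..1}. \<bar>f x - disc m f x\<bar> \<le> e) sequentially"
proof -
  have "uniformly_continuous_on {0..1} f"
    using f by (intro compact_uniformly_continuous) auto
  then obtain d where d: "d > 0" "\<And>x y. x \<in> {0..1} \<Longrightarrow> y \<in> {0..1} \<Longrightarrow> dist y x < d \<Longrightarrow> dist (f y) (f x) < e"
    unfolding uniformly_continuous_on_def using e by metis
  obtain m0 where m0: "1 / real (Suc m0) < d" using d(1) nat_approx_posE by blast
  have "\<forall>x\<in>{0..1}. \<bar>f x - disc m f x\<bar> \<le> e" if m: "Suc m0 \<le> m" for m
  proof
    fix x :: real assume x: "x \<in> {0..1}"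
    have mp: "0 < real m" using m by simp
    define i where "i = nat \<lfloor>real m * x\<rfloor>"
    have i: "real i \<le> real m * x" "real m * x < real i + 1"
      unfolding i_def using x mp by (auto simp: of_nat_nat)
    have "real m * x \<le> real m * 1" using x by (intro mult_left_mono) auto
    then have "real i \<le> real m" using i by linarith
    then have y: "real i / real m \<in> {0..1}" using mp by simp
    have "1 / real m \<le> 1 / real (Suc m0)" using m by (intro divide_left_mono) auto
    moreover have "\<bar>real i / real m - x\<bar> \<le> 1 / real m"
    proof -
      have "real i / real m - x = (real i - real m * x) / real m" using mp by (simp add: field_simps)
      moreover have "\<bar>real i - real m * x\<bar> \<le> 1" using i by linarith
      ultimately show ?thesis using mp by (simp add: abs_divide divide_right_mono)
    qed
    ultimately have "dist (real i / real m) x < d" using m0 by (simp add: dist_real_def)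
    from d(2)[OF x y this] show "\<bar>f x - disc m f x\<bar> \<le> e"
      using x by (simp add: disc_def step_path_def i_def dist_real_def abs_minus_commute)
  qed
  then show ?thesis unfolding eventually_sequentially by blast
qed

lemma trajectory_ext: "trajectory Y \<omega> \<in> extensional {0..1}"
  by (simp add: trajectory_def)

lemma trajectory_cont:
  assumes "continuous_process M Y" "\<omega> \<in> space M"
  shows "continuous_on {0..1} (trajectory Y \<omega>)"
proof -
  have "continuous_on {0..1} (\<lambda>x. Y x \<omega>)" using assms unfolding continuous_process_def by blast
  then show ?thesis by (rule continuous_on_eq) (simp add: trajectory_def)
qed

lemma trajectory_cadlag:
  assumes "continuous_process M Y" "\<omega> \<in> space M"
  shows "trajectory Y \<omega> \<in> cadlag01"
  using continuous_cadlag[OF trajectory_ext trajectory_cont[OF assms]] .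

lemma disc_functional_tendsto:
  assumes h: "unif_lip2 L h" and f: "f \<in> extensional {0..1}" "continuous_on {0..1} f"
    and g: "g \<in> extensional {0..1}" "continuous_on {0..1} g"
  shows "(\<lambda>m. h (disc m f) (disc m g)) \<longlonglongrightarrow> h f g"
proof (rule tendstoI)
  fix e :: real assume e: "e > 0"
  define d where "d = e / (2 * (\<bar>L\<bar> + 1))"
  have dp: "d > 0" unfolding d_def using e by simp
  have "2 * (\<bar>L\<bar> + 1) * d = e" unfolding d_def by simp
  then have "2 * (\<bar>L\<bar> * d) + 2 * d = e" by (simp add: algebra_simps)
  moreover have "0 \<le> \<bar>L\<bar> * d" using dp by simp
  ultimately have d: "d > 0" "\<bar>L\<bar> * d < e" using dp by linarith+
  show "eventually (\<lambda>m. dist (h (disc m f) (disc m g)) (h f g) < e) sequentially"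
    using disc_approx[OF f(2) d(1)] disc_approx[OF g(2) d(1)]
  proof eventually_elim
    case (elim m)
    have "\<bar>h f g - h (disc m f) (disc m g)\<bar> \<le> L * d"
      by (rule unif_lip2D[OF h]) (use elim continuous_cadlag f g disc_cadlag in auto)
    also have "\<dots> \<le> \<bar>L\<bar> * d" using d(1) by (intro mult_right_mono) auto
    also have "\<dots> < e" by (rule d)
    finally show ?case by (simp add: dist_real_def abs_minus_commute)
  qed
qed

text \<open>The discretised functional is a continuous function of finitely many real random
  variables. They are packed into a vector indexed by \<open>nat \<times> bool\<close>, padded with
  0 beyond \<open>m\<close>, for which coordinatewise measurability suffices.\<close>

lemma disc_functional_measurable:
  assumes h: "unif_lip2 L h" and Y: "continuous_process M Y" and Z: "continuous_process M Z"
  shows "(\<lambda>\<omega>. h (disc m (trajectory Y \<omega>)) (disc m (trajectory Z \<omega>))) \<in> borel_measurable M"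
proof -
  define V where "V \<omega> = (\<lambda>(i::nat, c). if i \<le> m then (if c then trajectory Y \<omega> (real i / real m) else trajectory Z \<omega> (real i / real m)) else 0)" for \<omega>
  have meas: "(\<lambda>\<omega>. trajectory X \<omega> (real i / real m)) \<in> borel_measurable M"
    if "i \<le> m" "continuous_process M X" for i X
  proof -
    have "real i / real m \<in> {0..1}" using that(1) by (auto simp: divide_le_eq_1)
    then show ?thesis using that(2) unfolding continuous_process_def trajectory_def by simp
  qed
  have V: "V \<in> measurable M borel"
  proof (rule measurable_coordinatewise_then_product)
    fix ic :: "nat \<times> bool"
    obtain i c where ic: "ic = (i, c)" by fastforce
    show "(\<lambda>\<omega>. V \<omega> ic) \<in> borel_measurable M"
      using meas[OF _ Y, of i] meas[OF _ Z, of i] unfolding V_def ic by (cases c; cases "i \<le> m") auto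
  qed
  have "continuous_on UNIV (\<lambda>v :: nat \<times> bool \<Rightarrow> real. h (step_path m (\<lambda>i. v (i, True))) (step_path m (\<lambda>i. v (i, False))))"
    by (rule step_functional_continuous[OF h]) auto
  from measurable_compose[OF V borel_measurable_continuous_onI[OF this]]
  have "(\<lambda>\<omega>. h (step_path m (\<lambda>i. V \<omega> (i, True))) (step_path m (\<lambda>i. V \<omega> (i, False)))) \<in> borel_measurable M" .
  moreover have "step_path m (\<lambda>i. V \<omega> (i, True)) = disc m (trajectory Y \<omega>)"
    "step_path m (\<lambda>i. V \<omega> (i, False)) = disc m (trajectory Z \<omega>)" for \<omega>
  proof -
    have i: "nat \<lfloor>real m * x\<rfloor> \<le> m" if "x \<in> {0..1}" for x using that by (rule nat_floor_le)
    show "step_path m (\<lambda>i. V \<omega> (i, True)) = disc m (trajectory Y \<omega>)"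
      "step_path m (\<lambda>i. V \<omega> (i, False)) = disc m (trajectory Z \<omega>)"
      unfolding disc_def step_path_def V_def using i by (auto simp: fun_eq_iff)
  qed
  ultimately show ?thesis by simp
qed

text \<open>No knowledge of a sigma-algebra on paths enters: since the trajectories are continuous,
  the functional is the pointwise limit of its discretised versions.\<close>

lemma functional_measurable:
  assumes h: "unif_lip2 L h" and Y: "continuous_process M Y" and Z: "continuous_process M Z"
  shows "(\<lambda>\<omega>. h (trajectory Y \<omega>) (trajectory Z \<omega>)) \<in> borel_measurable M"
proof (rule borel_measurable_LIMSEQ_real)
  show "(\<lambda>m. h (disc m (trajectory Y \<omega>)) (disc m (trajectory Z \<omega>))) \<longlonglongrightarrow> h (trajectory Y \<omega>) (trajectory Z \<omega>)"
    if "\<omega> \<in> space M" for \<omega>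
    using disc_functional_tendsto[OF h trajectory_ext trajectory_cont[OF Y that] trajectory_ext trajectory_cont[OF Z that]] .
qed (rule disc_functional_measurable[OF h Y Z])

section \<open>Lipschitz test functions for the Skorokhod metric\<close>

lemma skorokhod_dist_le:
  assumes "f \<in> cadlag01" "g \<in> cadlag01" "\<And>x. x \<in> {0..1} \<Longrightarrow> \<bar>f x - g x\<bar> \<le> e"
  shows "skorokhod_dist f g \<le> e"
proof -
  have "0 \<le> e" using assms(3)[of 0] by simp
  then have "e \<in> skorokhod_close f g"
    unfolding skorokhod_close_def using assms(3) time_change_id by auto
  then show ?thesis
    using assms cInf_lower[OF _ skorokhod_close_bdd] by (simp add: skorokhod_dist_def)
qed

interpretation sk: Metric_space cadlag01 skorokhod_dist
  by (rule Metric_space_skorokhod)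

lemma mtopology_of_D01: "mtopology_of D01 = sk.mtopology"
  unfolding D01_def by simp

lemma space_borel_of [simp]: "space (borel_of T) = topspace T"
  unfolding borel_of_def using openin_subset by (intro space_measure_of) blast

lemma sets_borel_of: "sets (borel_of T) = sigma_sets (topspace T) {U. openin T U}"
  unfolding borel_of_def using openin_subset by (intro sets_measure_of) blast

lemma continuous_map_borel_of:
  fixes f :: "'a \<Rightarrow> 'b :: topological_space"
  assumes "continuous_map T euclidean f"
  shows "f \<in> borel_measurable (borel_of T)"
proof (rule borel_measurableI)
  fix S :: "'b set" assume "open S"
  then have "openin T {x \<in> topspace T. f x \<in> S}"
    using assms by (auto simp: continuous_map_def)
  moreover have "f -` S \<inter> space (borel_of T) = {x \<in> topspace T. f x \<in> S}" by auto
  ultimately show "f -` S \<inter> space (borel_of T) \<in> sets (borel_of T)"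
    unfolding sets_borel_of by auto
qed

abbreviation borel_D01 :: "(real \<Rightarrow> real) measure" where
  "borel_D01 \<equiv> borel_of (mtopology_of D01)"

abbreviation sk_continuous :: "((real \<Rightarrow> real) \<Rightarrow> real) \<Rightarrow> bool" where
  "sk_continuous \<equiv> continuous_map (mtopology_of D01) euclideanreal"

definition sk_lip :: "real \<Rightarrow> ((real \<Rightarrow> real) \<Rightarrow> real) \<Rightarrow> bool" where
  "sk_lip k h \<longleftrightarrow> 0 \<le> k \<and> (\<forall>f\<in>cadlag01. \<forall>g\<in>cadlag01. \<bar>h f - h g\<bar> \<le> k * skorokhod_dist f g)"

text \<open>The identity time change shows that the Skorokhod distance is at most the uniform one.
  From here on time changes are out of the picture and path estimates are made uniformly.\<close>

lemma sk_lip_unif_lip2: "sk_lip k h \<Longrightarrow> unif_lip2 k (\<lambda>f g. h f)"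
  unfolding sk_lip_def unif_lip2_def using skorokhod_dist_le mult_left_mono
  by (meson order_trans)

lemma sk_lip_continuous:
  assumes "sk_lip k h" shows "sk_continuous h"
  unfolding mtopology_of_D01 continuous_map_def
proof (intro conjI allI impI)
  fix U :: "real set" assume "openin euclideanreal U"
  then have U: "open U" by simp
  show "openin sk.mtopology {f \<in> topspace sk.mtopology. h f \<in> U}"
    unfolding sk.openin_mtopology
  proof (intro conjI allI impI)
    fix f assume "f \<in> {f \<in> topspace sk.mtopology. h f \<in> U}"
    then have f: "f \<in> cadlag01" "h f \<in> U" by auto
    obtain e where e: "e > 0" "\<And>y. dist y (h f) < e \<Longrightarrow> y \<in> U" using U f(2) open_dist by metis
    have k: "0 \<le> k" using assms unfolding sk_lip_def by blast
    have "h g \<in> U" if g: "g \<in> sk.mball f (e / (k + 1))" for g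
    proof (rule e(2))
      have g': "g \<in> cadlag01" "skorokhod_dist f g < e / (k + 1)" using g by auto
      have "\<bar>h f - h g\<bar> \<le> k * skorokhod_dist f g" using assms f g' unfolding sk_lip_def by blast
      also have "\<dots> \<le> k * (e / (k + 1))" using g'(2) k by (intro mult_left_mono) auto
      also have "\<dots> < e" using e k by (simp add: field_simps)
      finally show "dist (h g) (h f) < e" by (simp add: dist_real_def abs_minus_commute)
    qed
    then show "\<exists>r>0. sk.mball f r \<subseteq> {f \<in> topspace sk.mtopology. h f \<in> U}"
      using e(1) k by (intro exI[of _ "e / (k + 1)"]) auto
  qed auto
qed auto

text \<open>The Pasch-Hausdorff (McShane) regularisation. With \<open>S\<close> the whole space it
  gives Lipschitz minorants of \<open>F\<close>; with \<open>F = 0\<close> and \<open>k = 1\<close>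
  it is the distance to \<open>S\<close>.\<close>

definition inf_conv :: "(real \<Rightarrow> real) set \<Rightarrow> ((real \<Rightarrow> real) \<Rightarrow> real) \<Rightarrow> real \<Rightarrow> (real \<Rightarrow> real) \<Rightarrow> real" where
  "inf_conv S F k f = (INF g\<in>S. F g + k * skorokhod_dist f g)"

lemma inf_conv_bdd:
  assumes "\<And>g. g \<in> S \<Longrightarrow> - C \<le> F g" "0 \<le> k"
  shows "bdd_below ((\<lambda>g. F g + k * skorokhod_dist f g) ` S)"
proof (rule bdd_belowI2)
  fix g assume "g \<in> S"
  from assms(1)[OF this] mult_nonneg_nonneg[OF assms(2) sk.nonneg[of f g]]
  show "- C \<le> F g + k * skorokhod_dist f g" by linarith
qed

lemma inf_conv_lip:
  assumes S: "S \<subseteq> cadlag01" "S \<noteq> {}" and F: "\<And>g. g \<in> S \<Longrightarrow> - C \<le> F g" and k: "0 \<le> k"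
  shows "sk_lip k (inf_conv S F k)"
proof -
  have "inf_conv S F k f \<le> inf_conv S F k f' + k * skorokhod_dist f f'"
    if f: "f \<in> cadlag01" "f' \<in> cadlag01" for f f'
  proof -
    have "inf_conv S F k f - k * skorokhod_dist f f' \<le> inf_conv S F k f'"
      unfolding inf_conv_def[of S F k f']
    proof (rule cINF_greatest[OF S(2)])
      fix g assume g: "g \<in> S"
      have "inf_conv S F k f \<le> F g + k * skorokhod_dist f g"
        unfolding inf_conv_def by (rule cINF_lower[OF inf_conv_bdd[of S C, OF F k] g])
      also have "\<dots> \<le> F g + k * (skorokhod_dist f f' + skorokhod_dist f' g)"
        using k f g S by (intro add_left_mono mult_left_mono sk.triangle) auto
      finally show "inf_conv S F k f - k * skorokhod_dist f f' \<le> F g + k * skorokhod_dist f' g"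
        by (simp add: algebra_simps)
    qed
    then show ?thesis by simp
  qed
  then show ?thesis
    unfolding sk_lip_def using k sk.commute by (force simp: abs_le_iff algebra_simps)
qed

text \<open>An open set is where the distance to its complement is positive, and that distance is a
  Lipschitz functional, hence measurable along a continuous process. No description of the Borel
  sets of D01 by coordinates is required.\<close>

lemma trajectory_measurable_D01:
  assumes Y: "continuous_process M Y"
  shows "trajectory Y \<in> measurable M borel_D01"
  unfolding borel_of_def
proof (rule measurable_measure_of)
  show "{U. openin (mtopology_of D01) U} \<subseteq> Pow (topspace (mtopology_of D01))"
    using openin_subset by blast
  show "trajectory Y \<in> space M \<rightarrow> topspace (mtopology_of D01)"
    using trajectory_cadlag[OF Y] by auto
  fix U assume "U \<in> {U. openin (mtopology_of D01) U}"
  then have U: "openin sk.mtopology U" by (simp add: mtopology_of_D01)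
  show "trajectory Y -` U \<inter> space M \<in> sets M"
  proof (cases "cadlag01 - U = {}")
    case True
    then have "trajectory Y -` U \<inter> space M = space M" using trajectory_cadlag[OF Y] by auto
    then show ?thesis by simp
  next
    case False
    define h where "h = inf_conv (cadlag01 - U) (\<lambda>_. 0) 1"
    have lip: "sk_lip 1 h"
      unfolding h_def by (rule inf_conv_lip[where C=0]) (use False in auto)
    have "trajectory Y \<omega> \<in> U \<longleftrightarrow> 0 < h (trajectory Y \<omega>)" if \<omega>: "\<omega> \<in> space M" for \<omega>
    proof
      let ?w = "trajectory Y \<omega>"
      assume "?w \<in> U"
      then obtain r where r: "r > 0" "sk.mball ?w r \<subseteq> U" using U sk.openin_mtopology by blast
      have "r \<le> h ?w"
        unfolding h_def inf_conv_def
        by (rule cINF_greatest[OF False]) (use r trajectory_cadlag[OF Y \<omega>] in \<open>force simp: not_le[symmetric]\<close>)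
      with r show "0 < h ?w" by simp
    next
      let ?w = "trajectory Y \<omega>"
      assume pos: "0 < h ?w"
      show "?w \<in> U"
      proof (rule ccontr)
        assume "?w \<notin> U"
        then have "h ?w \<le> 0 + 1 * skorokhod_dist ?w ?w"
          unfolding h_def inf_conv_def
          by (intro cINF_lower inf_conv_bdd[where C=0]) (use trajectory_cadlag[OF Y \<omega>] in auto)
        with pos trajectory_cadlag[OF Y \<omega>] show False by simp
      qed
    qed
    then have "trajectory Y -` U \<inter> space M = {\<omega> \<in> space M. 0 < h (trajectory Y \<omega>)}" by auto
    moreover have "(\<lambda>\<omega>. h (trajectory Y \<omega>)) \<in> borel_measurable M"
      using functional_measurable[OF sk_lip_unif_lip2[OF lip] Y Y] .
    ultimately show ?thesis by simp
  qed
qed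

text \<open>Inf-convolution approximates a bounded continuous function from below by Lipschitz functions,
  so that Lipschitz test functions determine weak convergence without any tightness argument.\<close>

lemma inf_conv_tendsto:
  assumes cont: "sk_continuous F"
    and F: "\<And>g. g \<in> cadlag01 \<Longrightarrow> \<bar>F g\<bar> \<le> C" and f: "f \<in> cadlag01"
  shows "(\<lambda>k. inf_conv cadlag01 F (real k) f) \<longlonglongrightarrow> F f"
proof (rule tendstoI)
  fix e :: real assume e: "e > 0"
  have "openin sk.mtopology {g \<in> topspace sk.mtopology. F g \<in> U}" if "open U" for U
    using cont that unfolding mtopology_of_D01 continuous_map_def by simp
  from this[OF open_ball] have "openin sk.mtopology {g \<in> topspace sk.mtopology. F g \<in> ball (F f) (e / 2)}" .
  moreover have "f \<in> {g \<in> topspace sk.mtopology. F g \<in> ball (F f) (e / 2)}"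
    using f e by simp
  ultimately obtain r where r: "r > 0" "sk.mball f r \<subseteq> {g \<in> topspace sk.mtopology. F g \<in> ball (F f) (e / 2)}"
    unfolding sk.openin_mtopology by blast
  \<comment> \<open>For \<open>g\<close> at distance at least \<open>r\<close> from \<open>f\<close>
    the penalty then reaches \<open>2 * C\<close>, the largest possible drop of \<open>F\<close>, so
    only \<open>g\<close> near \<open>f\<close> can compete.\<close>
  obtain k0 where k0: "real k0 > 2 * C / r" using reals_Archimedean2 by blast
  have lb: "- C \<le> F g" if "g \<in> cadlag01" for g using F[OF that] by simp
  have "\<bar>inf_conv cadlag01 F (real k) f - F f\<bar> < e" if k: "k0 \<le> k" for k
  proof -
    have "inf_conv cadlag01 F (real k) f \<le> F f + real k * skorokhod_dist f f"
      unfolding inf_conv_def by (rule cINF_lower[OF inf_conv_bdd[where C=C] f]) (use lb in auto)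
    then have "inf_conv cadlag01 F (real k) f \<le> F f" using f by simp
    moreover have "F f - e / 2 \<le> inf_conv cadlag01 F (real k) f"
      unfolding inf_conv_def
    proof (rule cINF_greatest)
      show "cadlag01 \<noteq> {}" using f by blast
      fix g assume g: "g \<in> cadlag01"
      show "F f - e / 2 \<le> F g + real k * skorokhod_dist f g"
      proof (cases "skorokhod_dist f g < r")
        case True
        then have "g \<in> sk.mball f r" using f g by simp
        then have "\<bar>F f - F g\<bar> < e / 2" using r(2) by (auto simp: dist_real_def)
        moreover have "0 \<le> real k * skorokhod_dist f g" by simp
        ultimately show ?thesis by linarith
      next
        case False
        have "2 * C / r \<le> real k" using k0 k by (meson less_eq_real_def of_nat_le_iff order_trans)
        then have "2 * C \<le> real k * r" using r(1) by (simp add: field_simps)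
        also have "\<dots> \<le> real k * skorokhod_dist f g" using False by (intro mult_left_mono) auto
        finally show ?thesis using F[OF f] F[OF g] e by linarith
      qed
    qed
    ultimately show ?thesis using e by linarith
  qed
  then show "eventually (\<lambda>k. dist (inf_conv cadlag01 F (real k) f) (F f) < e) sequentially"
    unfolding eventually_sequentially dist_real_def by blast
qed

text \<open>Inf-convolutions lie below \<open>F\<close>, so convergence for one of them that is
  close to \<open>F\<close> in mean under the limit bounds the integrals of \<open>F\<close> from
  below only. Using the bound for \<open>F\<close> and for \<open>- F\<close> gives
  convergence.\<close>

lemma liminf_bound_lipschitz:
  assumes ps: "\<And>n. prob_space (\<mu>s n)" "\<And>n. sets (\<mu>s n) = sets borel_D01"
    and p: "prob_space \<mu>" "sets \<mu> = sets borel_D01"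
    and lip: "\<And>k h C. sk_lip k h \<Longrightarrow> (\<And>f. f \<in> cadlag01 \<Longrightarrow> \<bar>h f\<bar> \<le> C) \<Longrightarrow> (\<lambda>n. integral\<^sup>L (\<mu>s n) h) \<longlonglongrightarrow> integral\<^sup>L \<mu> h"
    and cont: "sk_continuous F"
    and F: "\<And>g. g \<in> cadlag01 \<Longrightarrow> \<bar>F g\<bar> \<le> C" and e: "e > 0"
  shows "eventually (\<lambda>n. integral\<^sup>L \<mu> F - e < integral\<^sup>L (\<mu>s n) F) sequentially"
proof -
  let ?h = "\<lambda>k. inf_conv cadlag01 F (real k)"
  have lb: "- C \<le> F g" if "g \<in> cadlag01" for g using F[OF that] by simp
  have ne: "cadlag01 \<noteq> {}" using step_path_cadlag by blast
  have hl: "sk_lip (real k) (?h k)" for k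
    by (rule inf_conv_lip[where C=C]) (use lb ne in auto)
  have hF: "?h k f \<le> F f" if f: "f \<in> cadlag01" for k f
  proof -
    have "inf_conv cadlag01 F (real k) f \<le> F f + real k * skorokhod_dist f f"
      unfolding inf_conv_def by (rule cINF_lower[OF inf_conv_bdd[where C=C] f]) (use lb in auto)
    then show ?thesis using f by simp
  qed
  have hC: "- C \<le> ?h k f" if f: "f \<in> cadlag01" for k f
    unfolding inf_conv_def
  proof (rule cINF_greatest[OF ne])
    fix g assume "g \<in> cadlag01"
    from lb[OF this] show "- C \<le> F g + real k * skorokhod_dist f g"
      by (smt (verit) mult_nonneg_nonneg of_nat_0_le_iff sk.nonneg)
  qed
  have hb: "\<bar>?h k f\<bar> \<le> C" if f: "f \<in> cadlag01" for k f
    using hF[OF f, of k] hC[OF f, of k] F[OF f] by linarith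
  have sp: "space \<nu> = cadlag01" if "sets \<nu> = sets borel_D01" for \<nu>
    using sets_eq_imp_space_eq[OF that] by simp
  have m: "G \<in> borel_measurable \<nu>" if "sk_continuous G"
    "sets \<nu> = sets borel_D01" for G \<nu>
    using continuous_map_borel_of[OF that(1)] measurable_cong_sets[OF that(2) refl] by blast
  have "(\<lambda>k. integral\<^sup>L \<mu> (?h k)) \<longlonglongrightarrow> integral\<^sup>L \<mu> F"
  proof (rule integral_dominated_convergence[where w="\<lambda>_. C"])
    interpret prob_space \<mu> by (rule p)
    show "integrable \<mu> (\<lambda>_. C)" by simp
    show "F \<in> borel_measurable \<mu>" "?h k \<in> borel_measurable \<mu>" for k
      using m[OF cont p(2)] m[OF sk_lip_continuous[OF hl] p(2)] by auto
    show "AE x in \<mu>. (\<lambda>k. ?h k x) \<longlonglongrightarrow> F x"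
      by (rule AE_I2) (use inf_conv_tendsto[OF cont F] sp[OF p(2)] in auto)
    show "AE x in \<mu>. norm (?h k x) \<le> C" for k
      by (rule AE_I2) (use hb sp[OF p(2)] in auto)
  qed
  then have "eventually (\<lambda>k. integral\<^sup>L \<mu> F - e / 2 < integral\<^sup>L \<mu> (?h k)) sequentially"
    using e by (intro order_tendstoD(1)) auto
  then obtain k where k: "integral\<^sup>L \<mu> F - e / 2 < integral\<^sup>L \<mu> (?h k)"
    using eventually_happens'[OF sequentially_bot] by blast
  have "eventually (\<lambda>n. integral\<^sup>L \<mu> (?h k) - e / 2 < integral\<^sup>L (\<mu>s n) (?h k)) sequentially"
    using lip[OF hl[of k] hb] e by (intro order_tendstoD(1)) auto
  then show ?thesis
  proof eventually_elim
    case (elim n)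
    interpret prob_space "\<mu>s n" by (rule ps)
    have int: "integrable (\<mu>s n) G" if "sk_continuous G"
      "\<And>f. f \<in> cadlag01 \<Longrightarrow> \<bar>G f\<bar> \<le> C" for G
      by (rule integrable_const_bound[of _ C]) (use that m[OF that(1) ps(2)] sp[OF ps(2)[of n]] in auto)
    have "integral\<^sup>L (\<mu>s n) (?h k) \<le> integral\<^sup>L (\<mu>s n) F"
      by (rule integral_mono[OF int[OF sk_lip_continuous[OF hl] hb] int[OF cont F]])
        (use hF sp[OF ps(2)] in auto)
    with elim k show ?case by linarith
  qed
qed

lemma converges_weakly_lipschitz:
  assumes ps: "\<And>n. prob_space (\<mu>s n)" "\<And>n. sets (\<mu>s n) = sets borel_D01"
    and p: "prob_space \<mu>" "sets \<mu> = sets borel_D01"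
    and lip: "\<And>k h C. sk_lip k h \<Longrightarrow> (\<And>f. f \<in> cadlag01 \<Longrightarrow> \<bar>h f\<bar> \<le> C) \<Longrightarrow> (\<lambda>n. integral\<^sup>L (\<mu>s n) h) \<longlonglongrightarrow> integral\<^sup>L \<mu> h"
  shows "converges_weakly (mtopology_of D01) \<mu>s \<mu>"
  unfolding converges_weakly_def
proof (intro conjI allI impI)
  fix F assume F: "sk_continuous F \<and> bounded (F ` topspace (mtopology_of D01))"
  then obtain C where C: "\<And>f. f \<in> cadlag01 \<Longrightarrow> \<bar>F f\<bar> \<le> C"
    unfolding bounded_iff by auto
  have cont: "sk_continuous F"
    and cont': "sk_continuous (\<lambda>x. - F x)"
    using F continuous_map_minus by auto
  show "(\<lambda>n. integral\<^sup>L (\<mu>s n) F) \<longlonglongrightarrow> integral\<^sup>L \<mu> F"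
  proof (rule tendstoI)
    fix e :: real assume e: "e > 0"
    have ev: "eventually (\<lambda>n. integral\<^sup>L \<mu> G - e < integral\<^sup>L (\<mu>s n) G) sequentially"
      if "sk_continuous G" "\<And>f. f \<in> cadlag01 \<Longrightarrow> \<bar>G f\<bar> \<le> C" for G
      by (rule liminf_bound_lipschitz[where C=C, OF ps p lip that e])
    from ev[OF cont C] ev[OF cont'] C have "eventually (\<lambda>n. integral\<^sup>L \<mu> F - e < integral\<^sup>L (\<mu>s n) F) sequentially"
      "eventually (\<lambda>n. integral\<^sup>L \<mu> (\<lambda>x. - F x) - e < integral\<^sup>L (\<mu>s n) (\<lambda>x. - F x)) sequentially"
      by auto
    then show "eventually (\<lambda>n. dist (integral\<^sup>L (\<mu>s n) F) (integral\<^sup>L \<mu> F) < e) sequentially"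
      by eventually_elim (auto simp: dist_real_def)
  qed
qed (use ps p in auto)

lemma C01_eval_measurable:
  assumes x: "x \<in> {0..1}"
  shows "(\<lambda>w. w x) \<in> borel_measurable (borel_of (mtopology_of C01))"
proof (rule continuous_map_borel_of)
  let ?M = "mspace C01" and ?d = "mdist C01"
  interpret C: Metric_space ?M ?d by simp
  show "continuous_map (mtopology_of C01) euclideanreal (\<lambda>w. w x)"
    unfolding mtopology_of_def continuous_map_def
  proof (intro conjI allI impI)
    fix U :: "real set" assume "openin euclideanreal U"
    then have U: "open U" by simp
    show "openin C.mtopology {f \<in> topspace C.mtopology. f x \<in> U}"
      unfolding C.openin_mtopology
    proof (intro conjI allI impI)
      fix f assume "f \<in> {f \<in> topspace C.mtopology. f x \<in> U}"
      then have f: "f \<in> ?M" "f x \<in> U" by auto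
      obtain e where e: "e > 0" "\<And>y. dist y (f x) < e \<Longrightarrow> y \<in> U" using U f(2) open_dist by metis
      \<comment> \<open>Half the radius, because the distance of the function space yields only a
        weak inequality for the values.\<close>
      have "g x \<in> U" if g: "g \<in> C.mball f (e / 2)" for g
      proof (rule e(2))
        have g': "g \<in> ?M" "?d f g < e / 2" using g by auto
        have "mdist euclidean_metric (f x) (g x) \<le> e / 2"
          using mdist_cfunspace_imp_mdist_le[of f "top_of_set {0..1}" euclidean_metric g "e / 2" x] f g' x unfolding C01_def by auto
        then show "dist (g x) (f x) < e" using e(1) by (simp add: dist_commute)
      qed
      then show "\<exists>r>0. C.mball f r \<subseteq> {f \<in> topspace C.mtopology. f x \<in> U}"
        using e(1) by (intro exI[of _ "e / 2"]) auto
    qed auto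
  qed auto
qed

lemma C01_eval_cont: "w \<in> mspace C01 \<Longrightarrow> continuous_on {0..1} w"
  by (simp add: mspace_C01)

section \<open>The stationary distribution of open TASEP\<close>

text \<open>A concrete representation of the matrix product ansatz on functions of \<open>s\<close>.
  A particle acts as \<open>(D f) s = b * f (s + 1) + f s\<close>, a hole as
  \<open>(E f) s = f s + f (s - 1) / b\<close>, where at \<open>s = 0\<close> the missing term is
  replaced by \<open>a * f 0\<close>. The right vector \<open>V\<close> is the constant 1, and the
  left vector \<open>W\<close> is evaluation at 0.\<close>

fun lweight :: "real \<Rightarrow> real \<Rightarrow> nat \<Rightarrow> nat list \<Rightarrow> real" where
  "lweight a b s [] = 1"
| "lweight a b s (x # xs) =
     (if x = 0 then lweight a b s xs + (if s = 0 then a * lweight a b 0 xs else lweight a b (s - 1) xs / b)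
      else b * lweight a b (Suc s) xs + lweight a b s xs)"

lemma lweight_pos:
  assumes "a > 0" "b > 0"
  shows "0 < lweight a b s xs"
  using assms by (induction xs arbitrary: s) (auto intro!: add_pos_pos mult_pos_pos divide_pos_pos)

text \<open>With \<open>alpha = 1 / (1 + a)\<close> this is the relation
  \<open>alpha W E = W\<close>; the boundary value in \<open>E\<close> is chosen for it.\<close>

lemma lweight_left: "lweight a b 0 (0 # xs) = (1 + a) * lweight a b 0 xs"
  by (simp add: algebra_simps)

text \<open>With \<open>beta = 1 / (1 + b)\<close> this is \<open>beta D V = V\<close>: the constant
  1 is an eigenfunction of \<open>D\<close>, which does not see the wall, so any prefix and any
  \<open>s\<close> are allowed.\<close>

lemma lweight_right: "lweight a b s (xs @ [Suc 0]) = (1 + b) * lweight a b s xs"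
  by (induction xs arbitrary: s) (simp_all add: algebra_simps add_divide_distrib)

text \<open>The relation \<open>D E = D + E\<close>: the raised part of \<open>D\<close> hands
  \<open>E\<close> the state \<open>s + 1\<close>, away from the wall, and
  \<open>b * (E f) (s + 1)\<close> is \<open>(D f) s\<close>.\<close>

lemma lweight_bulk:
  assumes "b \<noteq> 0"
  shows "lweight a b s (xs @ Suc 0 # 0 # ys) = lweight a b s (xs @ Suc 0 # ys) + lweight a b s (xs @ 0 # ys)"
  using assms by (induction xs arbitrary: s) (simp_all add: algebra_simps add_divide_distrib)

section \<open>Invariance of the weights under the generator\<close>

lemma finite_tasep_configs: "finite (tasep_configs N)"
  unfolding tasep_configs_def by (intro finite_PiE) auto

lemma tasep_configs_upd:
  assumes "\<tau> \<in> tasep_configs N" "1 \<le> j" "j \<le> N" "x = 0 \<or> x = 1"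
  shows "\<tau>(j := x) \<in> tasep_configs N"
  using assms unfolding tasep_configs_def by (auto simp: PiE_iff extensional_def)

lemma tasep_configs_val: "\<tau> \<in> tasep_configs N \<Longrightarrow> 1 \<le> j \<Longrightarrow> j \<le> N \<Longrightarrow> \<tau> j = 0 \<or> \<tau> j = 1"
  unfolding tasep_configs_def by (auto simp: PiE_iff)

definition cweight :: "nat \<Rightarrow> real \<Rightarrow> real \<Rightarrow> (nat \<Rightarrow> nat) \<Rightarrow> real" where
  "cweight N a b \<tau> = lweight a b 0 (map \<tau> [1..<Suc N])"

text \<open>Weights of a system with one site fewer. They serve as the auxiliary terms of the
  ansatz: every local imbalance is expressed by them.\<close>

definition cweight_without :: "nat \<Rightarrow> real \<Rightarrow> real \<Rightarrow> nat \<Rightarrow> (nat \<Rightarrow> nat) \<Rightarrow> real" where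
  "cweight_without N a b j \<tau> = lweight a b 0 (map \<tau> ([1..<j] @ [Suc j..<Suc N]))"

lemma upt_split: "1 \<le> j \<Longrightarrow> j \<le> N \<Longrightarrow> [1..<Suc N] = [1..<j] @ j # [Suc j..<Suc N]"
  by (metis le_imp_less_Suc le_Suc_eq upt_add_eq_append le_add_diff_inverse upt_conv_Cons less_Suc_eq_le)

text \<open>Gain minus loss through a single bond does not vanish. By \<open>D E = D + E\<close> it
  is a difference of two site terms, counted positively at a hole and negatively at a particle, and
  cancels only after summation over the bonds.\<close>

lemma cweight_bulk:
  assumes \<tau>: "\<tau> \<in> tasep_configs N" and j: "1 \<le> j" "j < N" and b: "b \<noteq> 0"
  shows "(if \<tau> j = 0 \<and> \<tau> (j+1) = 1 then cweight N a b (\<tau>(j := 1, j+1 := 0)) else 0)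
       - (if \<tau> j = 1 \<and> \<tau> (j+1) = 0 then cweight N a b \<tau> else 0)
     = (1 - 2 * real (\<tau> j)) * cweight_without N a b j \<tau>
       - (1 - 2 * real (\<tau> (j+1))) * cweight_without N a b (j+1) \<tau>"
proof -
  define A where "A = map \<tau> [1..<j]"
  define C where "C = map \<tau> [j+2..<Suc N]"
  have s: "[1..<Suc N] = [1..<j] @ j # (j+1) # [j+2..<Suc N]"
    using j upt_split[of j N] upt_conv_Cons[of "Suc j" "Suc N"] by (simp del: upt_Suc)
  have w: "cweight N a b \<tau> = lweight a b 0 (A @ \<tau> j # \<tau> (j+1) # C)"
    unfolding cweight_def s A_def C_def by simp
  have w': "cweight N a b (\<tau>(j := 1, j+1 := 0)) = lweight a b 0 (A @ Suc 0 # 0 # C)"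
    unfolding cweight_def s A_def C_def by (auto simp: map_eq_conv intro!: arg_cong[where f="lweight a b 0"])
  have r1: "cweight_without N a b j \<tau> = lweight a b 0 (A @ \<tau> (j+1) # C)"
    unfolding cweight_without_def A_def C_def using j upt_conv_Cons[of "Suc j" "Suc N"]
    by (simp del: upt_Suc)
  have r2: "cweight_without N a b (j+1) \<tau> = lweight a b 0 (A @ \<tau> j # C)"
    unfolding cweight_without_def A_def C_def using j by (simp del: upt_Suc add: upt_Suc_append)
  have v: "\<tau> j = 0 \<or> \<tau> j = 1" "\<tau> (j+1) = 0 \<or> \<tau> (j+1) = 1"
    using tasep_configs_val[OF \<tau>] j by auto
  show ?thesis
    unfolding w w' r1 r2 using v lweight_bulk[OF b, of a 0 A C] by auto
qed

lemma cweight_left: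
  assumes \<tau>: "\<tau> \<in> tasep_configs N" and N: "1 \<le> N" and a: "1 + a \<noteq> 0"
  shows "(if \<tau> 1 = 1 then 1 / (1 + a) * cweight N a b (\<tau>(1 := 0)) else 0)
       - (if \<tau> 1 = 0 then 1 / (1 + a) * cweight N a b \<tau> else 0)
     = - ((1 - 2 * real (\<tau> 1)) * cweight_without N a b 1 \<tau>)"
proof -
  define C where "C = map \<tau> [2..<Suc N]"
  have s: "[1..<Suc N] = 1 # [2..<Suc N]"
    using N by (simp add: upt_conv_Cons numeral_2_eq_2)
  have w: "cweight N a b \<tau> = lweight a b 0 (\<tau> 1 # C)"
    unfolding cweight_def s C_def by simp
  have w': "cweight N a b (\<tau>(1 := 0)) = lweight a b 0 (0 # C)"
    unfolding cweight_def s C_def by (auto simp: map_eq_conv intro!: arg_cong[where f="lweight a b 0"])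
  have r1: "cweight_without N a b 1 \<tau> = lweight a b 0 C"
    unfolding cweight_without_def C_def by (simp add: numeral_2_eq_2)
  show ?thesis
    unfolding w w' r1 using tasep_configs_val[OF \<tau>, of 1] N a
    by (auto simp: lweight_left simp del: lweight.simps)
qed

lemma cweight_right:
  assumes \<tau>: "\<tau> \<in> tasep_configs N" and N: "1 \<le> N" and b: "1 + b \<noteq> 0"
  shows "(if \<tau> N = 0 then 1 / (1 + b) * cweight N a b (\<tau>(N := 1)) else 0)
       - (if \<tau> N = 1 then 1 / (1 + b) * cweight N a b \<tau> else 0)
     = (1 - 2 * real (\<tau> N)) * cweight_without N a b N \<tau>"
proof -
  define C where "C = map \<tau> [1..<N]"
  have s: "[1..<Suc N] = [1..<N] @ [N]"
    using N by simp
  have w: "cweight N a b \<tau> = lweight a b 0 (C @ [\<tau> N])"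
    unfolding cweight_def s C_def by simp
  have w': "cweight N a b (\<tau>(N := 1)) = lweight a b 0 (C @ [Suc 0])"
    unfolding cweight_def s C_def by (auto simp: map_eq_conv intro!: arg_cong[where f="lweight a b 0"])
  have r1: "cweight_without N a b N \<tau> = lweight a b 0 C"
    unfolding cweight_without_def C_def by simp
  show ?thesis
    unfolding w w' r1 using tasep_configs_val[OF \<tau>, of N] N b
    by (auto simp: lweight_right)
qed

text \<open>Summation by parts for one kind of jump: \<open>g\<close> performs it, \<open>h\<close>
  undoes it, and reindexing along this bijection moves the generator from the observable to the
  weight.\<close>

lemma sum_move_configs:
  fixes w f :: "(nat \<Rightarrow> nat) \<Rightarrow> real"
  assumes fw: "\<And>\<tau>. \<tau> \<in> tasep_configs N \<Longrightarrow> P \<tau> \<Longrightarrow> g \<tau> \<in> tasep_configs N \<and> Q (g \<tau>) \<and> h (g \<tau>) = \<tau>"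
    and bw: "\<And>\<tau>. \<tau> \<in> tasep_configs N \<Longrightarrow> Q \<tau> \<Longrightarrow> h \<tau> \<in> tasep_configs N \<and> P (h \<tau>) \<and> g (h \<tau>) = \<tau>"
  shows "(\<Sum>\<tau>\<in>tasep_configs N. w \<tau> * (if P \<tau> then r * (f (g \<tau>) - f \<tau>) else 0))
       = (\<Sum>\<tau>\<in>tasep_configs N. f \<tau> * ((if Q \<tau> then r * w (h \<tau>) else 0) - (if P \<tau> then r * w \<tau> else 0)))"
proof -
  let ?C = "tasep_configs N"
  have fin: "finite ?C" by (rule finite_tasep_configs)
  have "(\<Sum>\<tau>\<in>{\<tau>\<in>?C. P \<tau>}. w \<tau> * r * f (g \<tau>)) = (\<Sum>\<tau>\<in>{\<tau>\<in>?C. Q \<tau>}. w (h \<tau>) * r * f \<tau>)"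
    by (rule sum.reindex_bij_witness[of _ h g]) (use fw bw in auto)
  moreover have "(\<Sum>\<tau>\<in>?C. w \<tau> * (if P \<tau> then r * (f (g \<tau>) - f \<tau>) else 0))
      = (\<Sum>\<tau>\<in>{\<tau>\<in>?C. P \<tau>}. w \<tau> * r * f (g \<tau>)) - (\<Sum>\<tau>\<in>?C. f \<tau> * (if P \<tau> then r * w \<tau> else 0))"
    unfolding sum.inter_filter[OF fin] sum_subtractf[symmetric]
    by (intro sum.cong) (auto simp: algebra_simps)
  moreover have "(\<Sum>\<tau>\<in>?C. f \<tau> * ((if Q \<tau> then r * w (h \<tau>) else 0) - (if P \<tau> then r * w \<tau> else 0)))
      = (\<Sum>\<tau>\<in>{\<tau>\<in>?C. Q \<tau>}. w (h \<tau>) * r * f \<tau>) - (\<Sum>\<tau>\<in>?C. f \<tau> * (if P \<tau> then r * w \<tau> else 0))"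
    unfolding sum.inter_filter[OF fin] sum_subtractf[symmetric]
    by (intro sum.cong) (auto simp: algebra_simps)
  ultimately show ?thesis by simp
qed

lemma cweight_invariant:
  assumes N: "1 \<le> N" and a: "a > 0" and b: "b > 0"
  shows "(\<Sum>\<tau>\<in>tasep_configs N. cweight N a b \<tau> * tasep_generator N (1 / (1 + a)) (1 / (1 + b)) f \<tau>) = 0"
proof -
  let ?C = "tasep_configs N" and ?w = "cweight N a b"
  let ?r = "\<lambda>j \<tau>. (1 - 2 * real (\<tau> j)) * cweight_without N a b j \<tau>"
  let ?L = "\<lambda>\<tau>. if \<tau> 1 = 0 then 1 / (1 + a) * (f (\<tau>(1 := 1)) - f \<tau>) else 0"
  let ?R = "\<lambda>\<tau>. if \<tau> N = 1 then 1 / (1 + b) * (f (\<tau>(N := 0)) - f \<tau>) else 0"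
  let ?M = "\<lambda>j \<tau>. if \<tau> j = 1 \<and> \<tau> (j + 1) = 0 then f (\<tau>(j := 0, j + 1 := 1)) - f \<tau> else 0"
  have L: "(\<Sum>\<tau>\<in>?C. ?w \<tau> * ?L \<tau>)
      = (\<Sum>\<tau>\<in>?C. f \<tau> * (- ?r 1 \<tau>))"
  proof -
    have "(\<Sum>\<tau>\<in>?C. ?w \<tau> * ?L \<tau>)
      = (\<Sum>\<tau>\<in>?C. f \<tau> * ((if \<tau> 1 = 1 then 1 / (1 + a) * ?w (\<tau>(1 := 0)) else 0)
          - (if \<tau> 1 = 0 then 1 / (1 + a) * ?w \<tau> else 0)))"
      by (rule sum_move_configs; intro conjI tasep_configs_upd) (use N in auto)
    also have "\<dots> = (\<Sum>\<tau>\<in>?C. f \<tau> * (- ?r 1 \<tau>))"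
      using cweight_left[OF _ N, of _ a b] a by (intro sum.cong refl arg_cong2[where f="(*)"]) auto
    finally show ?thesis .
  qed
  have R: "(\<Sum>\<tau>\<in>?C. ?w \<tau> * ?R \<tau>)
      = (\<Sum>\<tau>\<in>?C. f \<tau> * ?r N \<tau>)"
  proof -
    have "(\<Sum>\<tau>\<in>?C. ?w \<tau> * ?R \<tau>)
      = (\<Sum>\<tau>\<in>?C. f \<tau> * ((if \<tau> N = 0 then 1 / (1 + b) * ?w (\<tau>(N := 1)) else 0)
          - (if \<tau> N = 1 then 1 / (1 + b) * ?w \<tau> else 0)))"
      by (rule sum_move_configs; intro conjI tasep_configs_upd) (use N in auto)
    also have "\<dots> = (\<Sum>\<tau>\<in>?C. f \<tau> * ?r N \<tau>)"
      using cweight_right[OF _ N, of _ b a] b by (intro sum.cong refl arg_cong2[where f="(*)"]) auto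
    finally show ?thesis .
  qed
  have M: "(\<Sum>\<tau>\<in>?C. ?w \<tau> * ?M j \<tau>)
      = (\<Sum>\<tau>\<in>?C. f \<tau> * (?r j \<tau> - ?r (j+1) \<tau>))" if j: "1 \<le> j" "j < N" for j
  proof -
    have "(\<Sum>\<tau>\<in>?C. ?w \<tau> * (if \<tau> j = 1 \<and> \<tau> (j + 1) = 0 then 1 * (f (\<tau>(j := 0, j + 1 := 1)) - f \<tau>) else 0))
      = (\<Sum>\<tau>\<in>?C. f \<tau> * ((if \<tau> j = 0 \<and> \<tau> (j+1) = 1 then 1 * ?w (\<tau>(j := 1, j+1 := 0)) else 0)
          - (if \<tau> j = 1 \<and> \<tau> (j+1) = 0 then 1 * ?w \<tau> else 0)))"
      by (rule sum_move_configs; intro conjI tasep_configs_upd) (use j in \<open>auto simp: fun_eq_iff\<close>)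
    also have "\<dots> = (\<Sum>\<tau>\<in>?C. f \<tau> * (?r j \<tau> - ?r (j+1) \<tau>))"
    proof (intro sum.cong refl arg_cong2[where f="(*)"])
      fix \<tau> assume "\<tau> \<in> ?C"
      from cweight_bulk[OF this j, of b a] b
      show "(if \<tau> j = 0 \<and> \<tau> (j+1) = 1 then 1 * ?w (\<tau>(j := 1, j+1 := 0)) else 0)
          - (if \<tau> j = 1 \<and> \<tau> (j+1) = 0 then 1 * ?w \<tau> else 0) = ?r j \<tau> - ?r (j+1) \<tau>"
        by (simp only: mult_1)
    qed
    finally show ?thesis by (simp only: mult_1)
  qed
  \<comment> \<open>The bulk leaves \<open>?r 1 - ?r N\<close>, exactly what the entrance term and
    the exit term cancel.\<close>
  have tel: "(\<Sum>j\<in>{1..<N}. ?r j \<tau> - ?r (j+1) \<tau>) = ?r 1 \<tau> - ?r N \<tau>" for \<tau>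
    using sum_Suc_diff'[OF N, of "\<lambda>j. - ?r j \<tau>"] by simp
  have bulk: "(\<Sum>\<tau>\<in>?C. \<Sum>j\<in>{1..<N}. ?w \<tau> * ?M j \<tau>)
      = (\<Sum>\<tau>\<in>?C. f \<tau> * (?r 1 \<tau> - ?r N \<tau>))"
  proof -
    have "(\<Sum>\<tau>\<in>?C. \<Sum>j\<in>{1..<N}. ?w \<tau> * ?M j \<tau>)
        = (\<Sum>j\<in>{1..<N}. \<Sum>\<tau>\<in>?C. f \<tau> * (?r j \<tau> - ?r (j+1) \<tau>))"
      by (subst sum.swap, rule sum.cong[OF refl], rule M) auto
    also have "\<dots> = (\<Sum>\<tau>\<in>?C. f \<tau> * (?r 1 \<tau> - ?r N \<tau>))"
      by (subst sum.swap) (simp only: sum_distrib_left[symmetric] tel)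
    finally show ?thesis .
  qed
  have "(\<Sum>\<tau>\<in>?C. ?w \<tau> * tasep_generator N (1 / (1 + a)) (1 / (1 + b)) f \<tau>)
      = (\<Sum>\<tau>\<in>?C. f \<tau> * (- ?r 1 \<tau>)) + (\<Sum>\<tau>\<in>?C. f \<tau> * (?r 1 \<tau> - ?r N \<tau>)) + (\<Sum>\<tau>\<in>?C. f \<tau> * ?r N \<tau>)"
    unfolding L[symmetric] R[symmetric] bulk[symmetric] tasep_generator_def
    by (simp only: sum.distrib distrib_left sum_distrib_left)
  also have "\<dots> = 0"
    unfolding sum.distrib[symmetric] by (rule sum.neutral) (simp add: algebra_simps)
  finally show ?thesis .
qed

text \<open>At most \<open>N + 1\<close> kinds of jump contribute at most \<open>2 * K\<close> each;
  the constant is rounded up. Iterated, the bound dominates the semigroup by an exponential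
  series.\<close>

lemma tasep_generator_bound:
  assumes N: "1 \<le> N" and \<alpha>: "\<bar>\<alpha>\<bar> \<le> 1" and \<beta>: "\<bar>\<beta>\<bar> \<le> 1"
    and f: "\<And>\<tau>. \<tau> \<in> tasep_configs N \<Longrightarrow> \<bar>f \<tau>\<bar> \<le> K" and \<tau>: "\<tau> \<in> tasep_configs N"
  shows "\<bar>tasep_generator N \<alpha> \<beta> f \<tau>\<bar> \<le> (2 * real N + 4) * K"
proof -
  have K: "0 \<le> K" using f[OF \<tau>] by simp
  have d: "\<bar>f \<sigma> - f \<tau>\<bar> \<le> 2 * K" if "\<sigma> \<in> tasep_configs N" for \<sigma>
    using f[OF that] f[OF \<tau>] by linarith
  have d': "\<bar>r * (f \<sigma> - f \<tau>)\<bar> \<le> 2 * K" if "\<sigma> \<in> tasep_configs N" "\<bar>r\<bar> \<le> 1" for \<sigma> r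
    using mult_mono[OF that(2) d[OF that(1)]] by (simp add: abs_mult)
  have 1: "\<bar>if \<tau> 1 = 0 then \<alpha> * (f (\<tau>(1 := 1)) - f \<tau>) else 0\<bar> \<le> 2 * K"
    using d'[OF tasep_configs_upd[OF \<tau>, of 1 1] \<alpha>] N K by auto
  have 2: "\<bar>if \<tau> N = 1 then \<beta> * (f (\<tau>(N := 0)) - f \<tau>) else 0\<bar> \<le> 2 * K"
    using d'[OF tasep_configs_upd[OF \<tau>, of N 0] \<beta>] N K by auto
  have "\<bar>\<Sum>j\<in>{1..<N}. if \<tau> j = 1 \<and> \<tau> (j + 1) = 0 then f (\<tau>(j := 0, j + 1 := 1)) - f \<tau> else 0\<bar>
      \<le> (\<Sum>j\<in>{1..<N}. 2 * K)"
    using K by (intro order_trans[OF sum_abs] sum_mono)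
      (auto intro!: d tasep_configs_upd \<tau>)
  also have "\<dots> = real (N - 1) * (2 * K)" by simp
  also have "\<dots> \<le> real N * (2 * K)" using K by (intro mult_right_mono) auto
  finally show ?thesis
    unfolding tasep_generator_def using 1 2 by (simp add: algebra_simps)
qed

lemma expectation_configs:
  assumes "set_pmf p \<subseteq> tasep_configs N"
  shows "measure_pmf.expectation p f = (\<Sum>\<tau>\<in>tasep_configs N. pmf p \<tau> * (f \<tau> :: real))"
  by (subst integral_measure_pmf[of "tasep_configs N"]) (use assms finite_tasep_configs in auto)

text \<open>Under \<open>p\<close> the expected semigroup is a power series in \<open>t\<close>
  whose linear coefficient is the sum in question. Stationarity makes it constant for
  \<open>t \<ge> 0\<close>, so this coefficient vanishes.\<close>

lemma tasep_stationary_generator: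
  assumes N: "1 \<le> N" and \<alpha>: "\<bar>\<alpha>\<bar> \<le> 1" and \<beta>: "\<bar>\<beta>\<bar> \<le> 1" and st: "tasep_stationary N \<alpha> \<beta> p"
  shows "(\<Sum>\<tau>\<in>tasep_configs N. pmf p \<tau> * tasep_generator N \<alpha> \<beta> f \<tau>) = 0"
proof -
  let ?C = "tasep_configs N" and ?L = "tasep_generator N \<alpha> \<beta>"
  define c where "c n = (\<Sum>\<tau>\<in>?C. pmf p \<tau> * (?L ^^ n) f \<tau>)" for n
  define K where "K = Max ((\<lambda>\<tau>. \<bar>f \<tau>\<bar>) ` ?C)"
  define R where "R = 2 * real N + 4"
  have bd: "\<bar>(?L ^^ n) f \<tau>\<bar> \<le> R ^ n * K" if "\<tau> \<in> ?C" for n \<tau>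
    using that
  proof (induction n arbitrary: \<tau>)
    case 0 then show ?case unfolding K_def using finite_tasep_configs by simp
  next
    case (Suc n)
    show ?case using tasep_generator_bound[OF N \<alpha> \<beta> Suc.IH Suc.prems]
      by (simp add: R_def algebra_simps)
  qed
  have summ: "summable (\<lambda>n. t ^ n / fact n * (?L ^^ n) f \<tau>)" if \<tau>: "\<tau> \<in> ?C" for t \<tau>
  proof (rule summable_comparison_test')
    show "summable (\<lambda>n. K * ((\<bar>t\<bar> * R) ^ n /\<^sub>R fact n))"
      by (intro summable_mult summable_exp_generic)
    show "norm (t ^ n / fact n * (?L ^^ n) f \<tau>) \<le> K * ((\<bar>t\<bar> * R) ^ n /\<^sub>R fact n)" for n
      using mult_left_mono[OF bd[OF \<tau>, of n], of "\<bar>t\<bar> ^ n / fact n"]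
      by (simp add: abs_mult power_abs power_mult_distrib field_simps)
  qed
  have S: "(\<lambda>n. c n / fact n * t ^ n) sums (\<Sum>\<tau>\<in>?C. pmf p \<tau> * tasep_semigroup N \<alpha> \<beta> t f \<tau>)" for t
  proof -
    have "(\<lambda>n. \<Sum>\<tau>\<in>?C. pmf p \<tau> * (t ^ n / fact n * (?L ^^ n) f \<tau>)) sums
        (\<Sum>\<tau>\<in>?C. pmf p \<tau> * tasep_semigroup N \<alpha> \<beta> t f \<tau>)"
      unfolding tasep_semigroup_def by (intro sums_sum sums_mult summable_sums summ)
    moreover have "(\<Sum>\<tau>\<in>?C. pmf p \<tau> * (t ^ n / fact n * (?L ^^ n) f \<tau>)) = c n / fact n * t ^ n" for n
      unfolding c_def sum_distrib_right sum_divide_distrib by (intro sum.cong) (auto simp: mult_ac)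
    ultimately show ?thesis by simp
  qed
  have st': "set_pmf p \<subseteq> ?C" using st unfolding tasep_stationary_def by blast
  define h where "h t = (\<Sum>n. c n / fact n * t ^ n)" for t :: real
  have h: "h t - h 0 = 0" if "t \<ge> 0" for t
  proof -
    have "h s = (\<Sum>\<tau>\<in>?C. pmf p \<tau> * f \<tau>)" if "s \<ge> 0" for s
      using st that unfolding tasep_stationary_def h_def sums_unique[OF S[of s], symmetric]
      by (simp add: expectation_configs[OF st'])
    from this[OF that] this[of 0] show ?thesis by simp
  qed
  have D: "(h has_field_derivative (\<Sum>n. diffs (\<lambda>n. c n / fact n) n * 0 ^ n)) (at 0)"
    unfolding h_def by (rule termdiffs_strong[of _ 1]) (use sums_summable[OF S[of 1]] in auto)
  have D: "(h has_field_derivative c 1) (at 0)"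
    using D unfolding powser_zero by (simp add: diffs_def)
  \<comment> \<open>Only times \<open>t \<ge> 0\<close> are controlled, so the derivative is read
    off from the right.\<close>
  then have "(h has_field_derivative c 1) (at_right 0)"
    by (rule has_field_derivative_at_within)
  then have lim: "((\<lambda>t. (h t - h 0) / (t - 0)) \<longlongrightarrow> c 1) (at_right 0)"
    by (simp only: has_field_derivative_iff)
  have ev: "eventually (\<lambda>t. (h t - h 0) / (t - 0) = 0) (at_right 0)"
  proof (rule eventually_mono[OF eventually_at_right_less])
    fix t :: real assume "0 < t"
    then have "h t - h 0 = 0" by (intro h) simp
    then show "(h t - h 0) / (t - 0) = 0" by simp
  qed
  have "((\<lambda>t. 0) \<longlongrightarrow> c 1) (at_right (0::real))"
    by (rule Lim_transform_eventually[OF lim ev])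
  from tendsto_unique[OF trivial_limit_at_right_real this tendsto_const] have "c 1 = 0" .
  then show ?thesis by (simp add: c_def)
qed

section \<open>Irreducibility and uniqueness of the stationary law\<close>

definition tasep_step :: "nat \<Rightarrow> (nat \<Rightarrow> nat) \<Rightarrow> (nat \<Rightarrow> nat) \<Rightarrow> bool" where
  "tasep_step N \<sigma> \<tau> \<longleftrightarrow> (\<sigma> 1 = 0 \<and> \<tau> = \<sigma>(1 := 1)) \<or> (\<sigma> N = 1 \<and> \<tau> = \<sigma>(N := 0)) \<or>
     (\<exists>j\<in>{1..<N}. \<sigma> j = 1 \<and> \<sigma> (j + 1) = 0 \<and> \<tau> = \<sigma>(j := 0, j + 1 := 1))"

text \<open>Applied to \<open>indicator {\<tau>}\<close> and read at \<open>\<sigma>\<close>, the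
  generator gives the entry of the rate matrix from \<open>\<sigma>\<close> to
  \<open>\<tau>\<close>; off the diagonal this is a jump rate.\<close>

lemma tasep_generator_indicator_nonneg:
  assumes "\<sigma> \<noteq> \<tau>" "0 < \<alpha>" "0 < \<beta>"
  shows "0 \<le> tasep_generator N \<alpha> \<beta> (indicator {\<tau>}) \<sigma>"
  using assms unfolding tasep_generator_def
  by (intro add_nonneg_nonneg sum_nonneg) (auto simp: indicator_def)

lemma tasep_generator_indicator_pos:
  assumes st: "tasep_step N \<sigma> \<tau>" and "0 < \<alpha>" "0 < \<beta>"
  shows "\<sigma> \<noteq> \<tau>" "0 < tasep_generator N \<alpha> \<beta> (indicator {\<tau>}) \<sigma>"
proof -
  show ne: "\<sigma> \<noteq> \<tau>"
    using st unfolding tasep_step_def by (metis fun_upd_same zero_neq_one n_not_Suc_n One_nat_def fun_upd_eqD)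
  let ?f = "indicator {\<tau>} :: _ \<Rightarrow> real"
  let ?A = "if \<sigma> 1 = 0 then \<alpha> * (?f (\<sigma>(1 := 1)) - ?f \<sigma>) else 0"
  let ?B = "\<lambda>j. if \<sigma> j = 1 \<and> \<sigma> (j + 1) = 0 then ?f (\<sigma>(j := 0, j + 1 := 1)) - ?f \<sigma> else 0"
  let ?C = "if \<sigma> N = 1 then \<beta> * (?f (\<sigma>(N := 0)) - ?f \<sigma>) else 0"
  have nn: "0 \<le> ?A" "0 \<le> ?C" "\<And>j. 0 \<le> ?B j"
    using ne assms by (auto simp: indicator_def)
  consider "0 < ?A" | "0 < ?C" | j where "j \<in> {1..<N}" "0 < ?B j"
    using st ne assms(2,3) unfolding tasep_step_def by (fastforce simp: indicator_def)
  then have "0 < ?A + (\<Sum>j\<in>{1..<N}. ?B j) + ?C"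
  proof cases
    case (3 j)
    have "0 < (\<Sum>j\<in>{1..<N}. ?B j)" by (rule sum_pos2[of _ j]) (use 3 nn(3) in simp_all)
    with nn(1,2) show ?thesis by linarith
  next
    case 1
    have "0 \<le> (\<Sum>j\<in>{1..<N}. ?B j)" by (rule sum_nonneg) (rule nn(3))
    with 1 nn(2) show ?thesis by linarith
  next
    case 2
    have "0 \<le> (\<Sum>j\<in>{1..<N}. ?B j)" by (rule sum_nonneg) (rule nn(3))
    with 2 nn(1) show ?thesis by linarith
  qed
  then show "0 < tasep_generator N \<alpha> \<beta> (indicator {\<tau>}) \<sigma>"
    unfolding tasep_generator_def .
qed

text \<open>General weights and new values, because two potentials are needed: one falls when a
  particle is pulled to the left, the other when it is pushed to the right.\<close>

lemma sum_hop_less: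
  fixes w \<tau> :: "nat \<Rightarrow> nat"
  assumes j: "1 \<le> j" "j < N" and less: "w j * x + w (j + 1) * y < w j * \<tau> j + w (j + 1) * \<tau> (j + 1)"
  shows "(\<Sum>k\<in>{1..N}. w k * (\<tau>(j := x, j + 1 := y)) k) < (\<Sum>k\<in>{1..N}. w k * \<tau> k)"
proof -
  have sp: "(\<Sum>k\<in>{1..N}. w k * \<rho> k) = w j * \<rho> j + w (j + 1) * \<rho> (j + 1) + (\<Sum>k\<in>{1..N} - {j} - {j + 1}. w k * \<rho> k)" for \<rho>
    using j by (subst sum.remove[of _ j], simp, simp, subst sum.remove[of _ "j + 1"]) auto
  show ?thesis
    unfolding sp[of "\<tau>(j := x, j + 1 := y)"] sp[of \<tau>] using less by simp
qed

text \<open>Pushing the leftmost particle back out through site 1, and the rightmost one forward out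
  through site \<open>N\<close>, connects every configuration with the empty one in both directions.\<close>

lemma predecessor_closed_configs:
  assumes N: "1 \<le> N" and S: "S \<subseteq> tasep_configs N" "\<tau>0 \<in> S"
    and closed: "\<And>\<sigma> \<tau>. \<tau> \<in> S \<Longrightarrow> \<sigma> \<in> tasep_configs N \<Longrightarrow> tasep_step N \<sigma> \<tau> \<Longrightarrow> \<sigma> \<in> S"
  shows "tasep_configs N \<subseteq> S"
proof -
  let ?C = "tasep_configs N"
  define e where "e = (\<lambda>j\<in>{1..N}. 0 :: nat)"
  have e_iff: "\<tau> = e" if "\<tau> \<in> ?C" "\<forall>j\<in>{1..N}. \<tau> j \<noteq> 1" for \<tau>
  proof (rule extensionalityI[of _ "{1..N}"])
    show "\<tau> \<in> extensional {1..N}" "e \<in> extensional {1..N}"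
      using that unfolding tasep_configs_def e_def by (auto simp: PiE_iff)
    show "\<tau> j = e j" if "j \<in> {1..N}" for j
      using that \<open>\<forall>j\<in>{1..N}. \<tau> j \<noteq> 1\<close> tasep_configs_val[OF \<open>\<tau> \<in> ?C\<close>, of j] unfolding e_def by auto
  qed
  have "e \<in> S" if "\<tau> \<in> S" for \<tau>
    using that
  \<comment> \<open>The potential is the sum of the occupied positions: removing a particle at site
    1 or moving one to the left lowers it.\<close>
  proof (induction "\<Sum>j\<in>{1..N}. j * \<tau> j" arbitrary: \<tau> rule: less_induct)
    case less
    have \<tau>: "\<tau> \<in> ?C" using S less.prems by blast
    show ?case
    proof (cases "\<exists>j. j \<in> {1..N} \<and> \<tau> j = 1")
      case False
      then show ?thesis using e_iff[OF \<tau>] less.prems by blast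
    next
      case True
      define j where "j = (LEAST j. j \<in> {1..N} \<and> \<tau> j = 1)"
      have j: "j \<in> {1..N}" "\<tau> j = 1" using LeastI_ex[OF True] unfolding j_def by auto
      have jm: "\<not> (i \<in> {1..N} \<and> \<tau> i = 1)" if "i < j" for i
        using that not_less_Least unfolding j_def by blast
      show ?thesis
      proof (cases "j = 1")
        case True
        define \<sigma> where "\<sigma> = \<tau>(1 := 0)"
        have \<sigma>: "\<sigma> \<in> ?C" unfolding \<sigma>_def using N by (intro tasep_configs_upd \<tau>) auto
        have "tasep_step N \<sigma> \<tau>" unfolding tasep_step_def \<sigma>_def using True j by auto
        then have "\<sigma> \<in> S" using closed less.prems \<sigma> by blast
        moreover have "(\<Sum>j\<in>{1..N}. j * \<sigma> j) < (\<Sum>j\<in>{1..N}. j * \<tau> j)"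
          using j True unfolding \<sigma>_def by (intro sum_strict_mono_ex1) auto
        ultimately show ?thesis using less.hyps by blast
      next
        case False
        define i where "i = j - 1"
        have ij: "j = i + 1" "1 \<le> i" "i < N" using False j unfolding i_def by auto
        have i0: "\<tau> i = 0" using jm[of i] ij tasep_configs_val[OF \<tau>, of i] by auto
        define \<sigma> where "\<sigma> = \<tau>(i := 1, i + 1 := 0)"
        have \<sigma>: "\<sigma> \<in> ?C" unfolding \<sigma>_def using ij by (intro tasep_configs_upd \<tau>) auto
        have "tasep_step N \<sigma> \<tau>" unfolding tasep_step_def \<sigma>_def
          using ij j i0 by (intro disjI2 bexI[of _ i]) (auto simp: fun_eq_iff)
        then have "\<sigma> \<in> S" using closed less.prems \<sigma> by blast
        moreover have "(\<Sum>j\<in>{1..N}. j * \<sigma> j) < (\<Sum>j\<in>{1..N}. j * \<tau> j)"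
          unfolding \<sigma>_def by (rule sum_hop_less) (use ij j i0 in simp_all)
        ultimately show ?thesis using less.hyps by blast
      qed
    qed
  qed
  then have eS: "e \<in> S" using S by blast
  have "\<sigma> \<in> S" if "\<sigma> \<in> ?C" for \<sigma>
    using that
  \<comment> \<open>The weight \<open>N + 1 - j\<close> is the number of moves that a particle at
    \<open>j\<close> needs to leave through site \<open>N\<close>, the exit included.\<close>
  proof (induction "\<Sum>j\<in>{1..N}. (N + 1 - j) * \<sigma> j" arbitrary: \<sigma> rule: less_induct)
    case less
    show ?case
    proof (cases "\<exists>j. j \<in> {1..N} \<and> \<sigma> j = 1")
      case False
      then show ?thesis using e_iff[OF less.prems] eS by blast
    next
      case True
      define j where "j = (GREATEST j. j \<in> {1..N} \<and> \<sigma> j = 1)"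
      have j: "j \<in> {1..N}" "\<sigma> j = 1"
        using GreatestI_ex_nat[OF True, of N] unfolding j_def by auto
      have jm: "\<not> (i \<in> {1..N} \<and> \<sigma> i = 1)" if "j < i" for i
      proof
        assume "i \<in> {1..N} \<and> \<sigma> i = 1"
        then have "i \<le> j" unfolding j_def by (rule Greatest_le_nat[of _ _ N]) auto
        with that show False by simp
      qed
      show ?thesis
      proof (cases "j = N")
        case True
        define \<tau> where "\<tau> = \<sigma>(N := 0)"
        have \<tau>: "\<tau> \<in> ?C" unfolding \<tau>_def using N by (intro tasep_configs_upd less.prems) auto
        have "(\<Sum>j\<in>{1..N}. (N + 1 - j) * \<tau> j) < (\<Sum>j\<in>{1..N}. (N + 1 - j) * \<sigma> j)"
          using j True unfolding \<tau>_def by (intro sum_strict_mono_ex1) auto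
        then have "\<tau> \<in> S" using less.hyps \<tau> by blast
        moreover have "tasep_step N \<sigma> \<tau>" unfolding tasep_step_def \<tau>_def using True j by auto
        ultimately show ?thesis using closed less.prems by blast
      next
        case False
        have jN: "1 \<le> j" "j < N" using False j by auto
        have i0: "\<sigma> (j+1) = 0" using jm[of "j+1"] jN tasep_configs_val[OF less.prems, of "j+1"] by auto
        define \<tau> where "\<tau> = \<sigma>(j := 0, j + 1 := 1)"
        have \<tau>: "\<tau> \<in> ?C" unfolding \<tau>_def using jN by (intro tasep_configs_upd less.prems) auto
        have "(\<Sum>j\<in>{1..N}. (N + 1 - j) * \<tau> j) < (\<Sum>j\<in>{1..N}. (N + 1 - j) * \<sigma> j)"
          unfolding \<tau>_def by (rule sum_hop_less) (use jN j i0 in simp_all)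
        then have "\<tau> \<in> S" using less.hyps \<tau> by blast
        moreover have "tasep_step N \<sigma> \<tau>" unfolding tasep_step_def \<tau>_def using jN j i0 by auto
        ultimately show ?thesis using closed less.prems by blast
      qed
    qed
  qed
  then show ?thesis by blast
qed

text \<open>A minimum principle: subtract from \<open>p\<close> the largest multiple of the weights
  that keeps it nonnegative. The remainder \<open>r\<close> is invariant, nonnegative and zero
  somewhere; its zero set is closed under predecessors, hence is everything. So \<open>p\<close> is
  a multiple of the weights, and normalisation fixes the factor.\<close>

lemma tasep_stationary_eq:
  assumes N: "1 \<le> N" and a: "a > 0" and b: "b > 0"
    and st: "tasep_stationary N (1 / (1 + a)) (1 / (1 + b)) p" and \<tau>: "\<tau> \<in> tasep_configs N"
  shows "pmf p \<tau> = cweight N a b \<tau> / (\<Sum>\<sigma>\<in>tasep_configs N. cweight N a b \<sigma>)"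
proof -
  let ?C = "tasep_configs N" and ?w = "cweight N a b" and ?L = "tasep_generator N (1 / (1 + a)) (1 / (1 + b))"
  have fin: "finite ?C" by (rule finite_tasep_configs)
  have ne: "?C \<noteq> {}" using \<tau> by blast
  have wpos: "0 < ?w \<sigma>" for \<sigma> unfolding cweight_def using a b by (rule lweight_pos)
  define c where "c = Min ((\<lambda>\<sigma>. pmf p \<sigma> / ?w \<sigma>) ` ?C)"
  define r where "r \<sigma> = pmf p \<sigma> - c * ?w \<sigma>" for \<sigma>
  have "c \<in> (\<lambda>\<sigma>. pmf p \<sigma> / ?w \<sigma>) ` ?C" unfolding c_def using fin ne by (intro Min_in) auto
  then obtain \<tau>0 where \<tau>0: "\<tau>0 \<in> ?C" "c = pmf p \<tau>0 / ?w \<tau>0" by blast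
  have r0: "r \<tau>0 = 0" unfolding r_def \<tau>0(2) using wpos[of \<tau>0] by simp
  have rnn: "0 \<le> r \<sigma>" if "\<sigma> \<in> ?C" for \<sigma>
  proof -
    have "c \<le> pmf p \<sigma> / ?w \<sigma>" unfolding c_def using fin that by (intro Min_le) auto
    then show ?thesis unfolding r_def using wpos[of \<sigma>] by (simp add: field_simps)
  qed
  have inv: "(\<Sum>\<sigma>\<in>?C. r \<sigma> * ?L f \<sigma>) = 0" for f
  proof -
    have "(\<Sum>\<sigma>\<in>?C. r \<sigma> * ?L f \<sigma>) = (\<Sum>\<sigma>\<in>?C. pmf p \<sigma> * ?L f \<sigma>) - c * (\<Sum>\<sigma>\<in>?C. ?w \<sigma> * ?L f \<sigma>)"
      unfolding r_def by (simp add: algebra_simps sum_subtractf sum_distrib_left)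
    also have "\<dots> = 0"
      unfolding cweight_invariant[OF N a b]
      using tasep_stationary_generator[OF N _ _ st, of f] a b by simp
    finally show ?thesis .
  qed
  define S where "S = {\<sigma>\<in>?C. r \<sigma> = 0}"
  have "?C \<subseteq> S"
  proof (rule predecessor_closed_configs[OF N])
    show "S \<subseteq> ?C" "\<tau>0 \<in> S" unfolding S_def using \<tau>0 r0 by auto
    fix \<sigma> \<rho> assume \<rho>: "\<rho> \<in> S" and \<sigma>: "\<sigma> \<in> ?C" and step: "tasep_step N \<sigma> \<rho>"
    have ab: "0 < 1 / (1 + a)" "0 < 1 / (1 + b)" using a b by auto
    \<comment> \<open>Invariance tested on \<open>indicator {\<rho>}\<close> is a vanishing sum. Its
      only possibly negative rate, on the diagonal, is multiplied by \<open>r \<rho> = 0\<close>, so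
      every summand is zero.\<close>
    have nn: "0 \<le> r \<kappa> * ?L (indicator {\<rho>}) \<kappa>" if "\<kappa> \<in> ?C" for \<kappa>
      using rnn[OF that] \<rho> tasep_generator_indicator_nonneg[OF _ ab, of \<kappa> \<rho> N] unfolding S_def
      by (cases "\<kappa> = \<rho>") auto
    have "r \<sigma> * ?L (indicator {\<rho>}) \<sigma> = 0"
      using inv[of "indicator {\<rho>}"] nn \<sigma> sum_nonneg_eq_0_iff[OF fin, of "\<lambda>\<kappa>. r \<kappa> * ?L (indicator {\<rho>}) \<kappa>"]
      by auto
    then show "\<sigma> \<in> S" unfolding S_def using \<sigma> tasep_generator_indicator_pos(2)[OF step ab] by auto
  qed
  then have pe: "pmf p \<sigma> = c * ?w \<sigma>" if "\<sigma> \<in> ?C" for \<sigma> using that unfolding S_def r_def by auto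
  have "set_pmf p \<subseteq> ?C" using st unfolding tasep_stationary_def by blast
  then have "(\<Sum>\<sigma>\<in>?C. pmf p \<sigma>) = 1" using fin by (intro sum_pmf_eq_1) auto
  then have "c * (\<Sum>\<sigma>\<in>?C. ?w \<sigma>) = 1" using pe by (simp add: sum_distrib_left)
  moreover have "0 < (\<Sum>\<sigma>\<in>?C. ?w \<sigma>)" using fin ne wpos by (intro sum_pos) auto
  ultimately have "c = 1 / (\<Sum>\<sigma>\<in>?C. ?w \<sigma>)" by (simp add: field_simps)
  with pe[OF \<tau>] show ?thesis by simp
qed

section \<open>Coin walks\<close>

definition coins :: "nat \<Rightarrow> (nat \<times> bool \<Rightarrow> nat) pmf" where
  "coins N = Pi_pmf ({1..N} \<times> UNIV) 0 (\<lambda>_. pmf_of_set {0, 1})"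

lemma coins_altdef: "coins N = pmf_of_set (PiE_dflt ({1..N} \<times> UNIV) 0 (\<lambda>_. {0, 1}))"
  unfolding coins_def by (intro Pi_pmf_of_set finite_cartesian_product) auto

lemma finite_coins: "finite (PiE_dflt ({1..N::nat} \<times> (UNIV :: bool set)) 0 (\<lambda>_. {0, 1 :: nat}))"
  by (intro finite_PiE_dflt finite_cartesian_product) auto

lemma coins_nonempty: "PiE_dflt ({1..N::nat} \<times> (UNIV :: bool set)) 0 (\<lambda>_. {0, 1 :: nat}) \<noteq> {}"
  by simp

lemma finite_set_coins: "finite (set_pmf (coins N))"
  using finite_coins coins_nonempty unfolding coins_altdef by (subst set_pmf_of_set)

lemma integrable_coins: "integrable (measure_pmf (coins N)) (f :: _ \<Rightarrow> real)"
  by (rule integrable_measure_pmf_finite[OF finite_set_coins])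

abbreviation coin_expectation :: "nat \<Rightarrow> ((nat \<times> bool \<Rightarrow> nat) \<Rightarrow> real) \<Rightarrow> real" where
  "coin_expectation N \<equiv> measure_pmf.expectation (coins N)"

abbreviation coin_prob :: "nat \<Rightarrow> (nat \<times> bool \<Rightarrow> nat) set \<Rightarrow> real" where
  "coin_prob N \<equiv> measure_pmf.prob (coins N)"

text \<open>Coins are 0 off the sites, configurations are \<open>undefined\<close> there; the
  restriction makes a row a configuration. Row \<open>True\<close> is the particle configuration,
  row \<open>False\<close> the auxiliary layer.\<close>

definition coin_row :: "nat \<Rightarrow> bool \<Rightarrow> (nat \<times> bool \<Rightarrow> nat) \<Rightarrow> nat \<Rightarrow> nat" where
  "coin_row N b c = (\<lambda>j\<in>{1..N}. c (j, b))"

lemma expectation_coins: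
  "measure_pmf.expectation (coins N) (\<lambda>c. g (coin_row N True c) (coin_row N False c))
   = (\<Sum>\<tau>\<in>{1..N} \<rightarrow>\<^sub>E {0, 1}. \<Sum>\<xi>\<in>{1..N} \<rightarrow>\<^sub>E {0, 1}. g \<tau> \<xi>) / (4 ^ N :: real)"
proof -
  let ?i = "\<lambda>(\<tau>, \<xi>) (j, b). if j \<in> {1..N} then (if b then \<tau> j else \<xi> j) else 0" and ?j = "\<lambda>c. (coin_row N True c, coin_row N False c)"
  let ?C = "{1..N} \<rightarrow>\<^sub>E {0, 1 :: nat}" and ?P = "PiE_dflt ({1..N} \<times> (UNIV :: bool set)) 0 (\<lambda>_. {0, 1 :: nat})"
  have card: "card ?P = 4 ^ N"
  proof -
    have "finite ({1..N} \<times> (UNIV :: bool set))" by (intro finite_cartesian_product finite finite_atLeastAtMost)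
    then have "card ?P = (\<Prod>x\<in>{1..N} \<times> (UNIV :: bool set). card {0, 1 :: nat})"
      by (rule card_PiE_dflt) simp
    also have "card {0, 1 :: nat} = 2" by simp
    also have "(\<Prod>x\<in>{1..N} \<times> (UNIV :: bool set). 2 :: nat) = 2 ^ (2 * N)"
      by (simp only: prod_constant card_cartesian_product) (simp add: mult.commute)
    finally show ?thesis by (simp add: power_mult)
  qed
  have "measure_pmf.expectation (coins N) (\<lambda>c. g (coin_row N True c) (coin_row N False c))
      = (\<Sum>c\<in>?P. g (coin_row N True c) (coin_row N False c)) / 4 ^ N"
    unfolding coins_altdef by (subst integral_pmf_of_set[OF coins_nonempty finite_coins]) (simp only: card of_nat_power of_nat_numeral)
  also have "(\<Sum>c\<in>?P. g (coin_row N True c) (coin_row N False c)) = (\<Sum>(\<tau>, \<xi>)\<in>?C \<times> ?C. g \<tau> \<xi>)"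
  proof (rule sum.reindex_bij_witness[where
        i="?i" and j="?j"])
    fix c assume c: "c \<in> ?P"
    show "?i (?j c) = c"
      using c unfolding PiE_dflt_def coin_row_def by (auto simp: fun_eq_iff)
    show "?j c \<in> ?C \<times> ?C"
      using c unfolding PiE_dflt_def coin_row_def by auto
  next
    fix tx assume "tx \<in> ?C \<times> ?C"
    then obtain \<tau> \<xi> where tx: "tx = (\<tau>, \<xi>)" "\<tau> \<in> ?C" "\<xi> \<in> ?C" by auto
    let ?c = "\<lambda>(j, b). if j \<in> {1..N} then (if b then \<tau> j else \<xi> j) else 0"
    have "coin_row N True ?c = \<tau>" "coin_row N False ?c = \<xi>"
      using tx(2,3) unfolding coin_row_def by (auto simp: fun_eq_iff PiE_def extensional_def)
    then show "?j (?i tx) = tx"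
      unfolding tx by simp
    show "?i tx \<in> ?P"
      using tx unfolding PiE_dflt_def by (auto simp: PiE_iff)
  qed auto
  also have "\<dots> = (\<Sum>\<tau>\<in>?C. \<Sum>\<xi>\<in>?C. g \<tau> \<xi>)"
    by (rule sum.cartesian_product[symmetric])
  finally show ?thesis .
qed

text \<open>\<open>m\<close> need not divide \<open>N\<close>: rounding the end points keeps the
  blocks disjoint and lets them fill \<open>{1..N}\<close>, with lengths within 1 of
  \<open>N / m\<close>.\<close>

definition block :: "nat \<Rightarrow> nat \<Rightarrow> nat \<Rightarrow> nat set" where
  "block m N l = {(l * N) div m<..(Suc l * N) div m}"

definition block_sum :: "nat \<Rightarrow> nat \<Rightarrow> nat \<times> bool \<Rightarrow> (nat \<times> bool \<Rightarrow> nat) \<Rightarrow> real" where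
  "block_sum m N lb c = (\<Sum>j\<in>block m N (fst lb). (2 * real (c (j, snd lb)) - 1) / sqrt (real N))"

lemma block_subset: "0 < m \<Longrightarrow> l < m \<Longrightarrow> block m N l \<subseteq> {1..N}"
proof -
  assume "0 < m" "l < m"
  then have "(Suc l * N) div m \<le> (m * N) div m" by (intro div_le_mono mult_right_mono) auto
  then show ?thesis using \<open>0 < m\<close> unfolding block_def by auto
qed

lemma block_disjoint:
  assumes "l < l'" shows "block m N l \<inter> block m N l' = {}"
proof -
  have "(Suc l * N) div m \<le> (l' * N) div m" using assms by (intro div_le_mono mult_right_mono) auto
  then show ?thesis unfolding block_def by auto
qed

lemma coins_indep:
  "prob_space.indep_vars (measure_pmf (coins N)) (\<lambda>_. count_space UNIV) (\<lambda>i c. c i) ({1..N} \<times> UNIV)"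
  unfolding coins_def by (rule indep_vars_Pi_pmf) (intro finite_cartesian_product finite finite_atLeastAtMost)

lemma block_sum_indep:
  assumes m: "0 < m"
  shows "prob_space.indep_vars (measure_pmf (coins N)) (\<lambda>_. borel) (block_sum m N) ({..<m} \<times> UNIV)"
proof -
  let ?K = "\<lambda>lb :: nat \<times> bool. block m N (fst lb) \<times> {snd lb}"
  note coins_indep
  then have "prob_space.indep_vars (measure_pmf (coins N)) (\<lambda>lb. PiM (?K lb) (\<lambda>_. count_space UNIV)) (\<lambda>lb c. restrict (\<lambda>i. c i) (?K lb)) ({..<m} \<times> UNIV)"
  proof (rule prob_space.indep_vars_restrict[OF measure_pmf.prob_space_axioms])
    show "?K lb \<subseteq> {1..N} \<times> UNIV" if "lb \<in> {..<m} \<times> UNIV" for lb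
      using block_subset[OF m, of "fst lb" N] that by (auto dest!: subsetD)
    show "disjoint_family_on ?K ({..<m} \<times> UNIV)"
      unfolding disjoint_family_on_def
    proof (intro ballI impI)
      fix x y :: "nat \<times> bool" assume "x \<noteq> y"
      then show "?K x \<inter> ?K y = {}"
        using block_disjoint[of "fst x" "fst y" m N] block_disjoint[of "fst y" "fst x" m N]
        by (cases "fst x = fst y") (auto simp: prod_eq_iff neq_iff)
    qed
  qed
  then have "prob_space.indep_vars (measure_pmf (coins N)) (\<lambda>_. borel) (\<lambda>lb c. block_sum m N lb (restrict (\<lambda>i. c i) (?K lb))) ({..<m} \<times> UNIV)"
  proof (rule prob_space.indep_vars_compose2[OF measure_pmf.prob_space_axioms])
    fix lb :: "nat \<times> bool"
    show "block_sum m N lb \<in> borel_measurable (PiM (?K lb) (\<lambda>_. count_space UNIV))"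
      unfolding block_sum_def
    proof (rule borel_measurable_sum)
      fix j assume j: "j \<in> block m N (fst lb)"
      have "(\<lambda>x. x (j, snd lb)) \<in> measurable (PiM (?K lb) (\<lambda>_. count_space (UNIV :: nat set))) (count_space UNIV)"
        by (rule measurable_component_singleton) (use j in auto)
      from measurable_compose[OF this, of "\<lambda>n. (2 * real n - 1) / sqrt (real N)" borel]
      show "(\<lambda>x. (2 * real (x (j, snd lb)) - 1) / sqrt (real N)) \<in> borel_measurable (PiM (?K lb) (\<lambda>_. count_space UNIV))"
        by simp
    qed
  qed
  moreover have "block_sum m N lb (restrict (\<lambda>i. c i) (?K lb)) = block_sum m N lb c" for lb c
    unfolding block_sum_def by (intro sum.cong) auto
  ultimately show ?thesis by simp
qed

lemma char_block_sum:
  assumes m: "0 < m" and l: "l < m"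
  shows "char (distr (measure_pmf (coins N)) borel (block_sum m N (l, b))) t
    = complex_of_real (cos (t / sqrt (real N)) ^ card (block m N l))"
proof -
  let ?X = "\<lambda>i c. (2 * real (c i) - 1) / sqrt (real N)"
  have sub: "block m N l \<times> {b} \<subseteq> {1..N} \<times> UNIV" using block_subset[OF m l] by auto
  have ind: "prob_space.indep_vars (measure_pmf (coins N)) (\<lambda>i. borel) ?X (block m N l \<times> {b})"
    by (rule prob_space.indep_vars_compose2[OF measure_pmf.prob_space_axioms prob_space.indep_vars_subset[OF measure_pmf.prob_space_axioms coins_indep sub], where Y="\<lambda>_ n. (2 * real n - 1) / sqrt (real N)"]) simp
  have "block_sum m N (l, b) = (\<lambda>c. \<Sum>i\<in>block m N l \<times> {b}. ?X i c)"
    unfolding block_sum_def fst_conv snd_conv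
    by (intro ext sum.reindex_bij_witness[of _ fst "\<lambda>j. (j, b)"]) auto
  then have "char (distr (measure_pmf (coins N)) borel (block_sum m N (l, b))) t
      = (\<Prod>i\<in>block m N l \<times> {b}. char (distr (measure_pmf (coins N)) borel (?X i)) t)"
    using prob_space.char_distr_sum[OF measure_pmf.prob_space_axioms ind] by simp
  also have "\<dots> = (\<Prod>i\<in>block m N l \<times> {b}. complex_of_real (cos (t / sqrt (real N))))"
  proof (rule prod.cong[OF refl])
    fix i assume i: "i \<in> block m N l \<times> {b}"
    let ?f = "\<lambda>n. iexp (t * ((2 * real n - 1) / sqrt (real N)))"
    have "char (distr (measure_pmf (coins N)) borel (?X i)) t = measure_pmf.expectation (coins N) (\<lambda>c. ?f (c i))"
      unfolding char_def by (subst integral_distr) auto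
    also have "\<dots> = measure_pmf.expectation (map_pmf (\<lambda>c. c i) (coins N)) ?f"
      by simp
    also have "map_pmf (\<lambda>c. c i) (coins N) = pmf_of_set {0, 1}"
    proof -
      have "i \<in> {1..N} \<times> UNIV" using sub i by blast
      moreover have "finite ({1..N} \<times> (UNIV :: bool set))" by (intro finite_cartesian_product finite finite_atLeastAtMost)
      ultimately show ?thesis unfolding coins_def by (simp only: Pi_pmf_component if_True)
    qed
    also have "measure_pmf.expectation (pmf_of_set {0, 1}) ?f = (?f 0 + ?f 1) / 2"
      by (subst integral_measure_pmf[of "{0, 1}"]) (simp_all add: scaleR_conv_of_real add_divide_distrib)
    also have "\<dots> = complex_of_real (cos (t / sqrt (real N)))"
      by (simp add: cos_exp_eq cos_of_real flip: cos_of_real of_real_divide)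
    finally show "char (distr (measure_pmf (coins N)) borel (?X i)) t = complex_of_real (cos (t / sqrt (real N)))" .
  qed
  also have "\<dots> = complex_of_real (cos (t / sqrt (real N)) ^ card (block m N l))"
    by (simp add: card_cartesian_product)
  finally show ?thesis .
qed

lemma card_block_limit:
  assumes m: "0 < m"
  shows "(\<lambda>N. real (card (block m N l)) / real N) \<longlonglongrightarrow> 1 / real m"
proof (rule tendsto_sandwich)
  have b: "\<bar>real (card (block m N l)) - real N / real m\<bar> \<le> 1" for N
  proof -
    have le: "(l * N) div m \<le> (Suc l * N) div m" by (intro div_le_mono) auto
    have c: "real (card (block m N l)) = real ((Suc l * N) div m) - real ((l * N) div m)"
      unfolding block_def using le by simp
    have d: "real (k div m) \<le> real k / real m" "real k / real m < real (k div m) + 1" for k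
      using floor_correct[of "real k / real m"] by (simp_all add: floor_divide_of_nat_eq)
    have "real (Suc l * N) / real m = real (l * N) / real m + real N / real m"
      by (simp add: add_divide_distrib algebra_simps)
    then show ?thesis unfolding c using d[of "Suc l * N"] d[of "l * N"] by linarith
  qed
  show "eventually (\<lambda>N. 1 / real m - 1 / real N \<le> real (card (block m N l)) / real N) sequentially"
    using eventually_gt_at_top[of 0]
  proof eventually_elim
    case (elim N)
    have "real N / real m - 1 \<le> real (card (block m N l))" using b[of N] by linarith
    then have "(real N / real m - 1) / real N \<le> real (card (block m N l)) / real N" by (intro divide_right_mono) auto
    then show ?case using elim by (simp add: diff_divide_distrib)
  qed
  show "eventually (\<lambda>N. real (card (block m N l)) / real N \<le> 1 / real m + 1 / real N) sequentially"
    using eventually_gt_at_top[of 0]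
  proof eventually_elim
    case (elim N)
    have "real (card (block m N l)) \<le> real N / real m + 1" using b[of N] by linarith
    then have "real (card (block m N l)) / real N \<le> (real N / real m + 1) / real N" by (intro divide_right_mono) auto
    then show ?case using elim by (simp add: add_divide_distrib)
  qed
  show "(\<lambda>N. 1 / real m - 1 / real N) \<longlonglongrightarrow> 1 / real m" "(\<lambda>N. 1 / real m + 1 / real N) \<longlonglongrightarrow> 1 / real m"
    by real_asymp+
qed

section \<open>Gaussian limit of a single block sum\<close>

definition centred_normal :: "real \<Rightarrow> real measure" where
  "centred_normal s = density lborel (normal_density 0 s)"

lemma centred_normal_prob: "0 < s \<Longrightarrow> prob_space (centred_normal s)"
  unfolding centred_normal_def by (rule prob_space_normal_density)

lemma real_distribution_centred_normal: "0 < s \<Longrightarrow> real_distribution (centred_normal s)"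
  unfolding real_distribution_def real_distribution_axioms_def using centred_normal_prob
  by (auto simp: centred_normal_def)

lemma char_centred_normal:
  assumes s: "0 < s"
  shows "char (centred_normal s) t = complex_of_real (exp (- (s * t)\<^sup>2 / 2))"
proof -
  interpret S: prob_space std_normal_distribution by (rule prob_space_normal_density) simp
  have "distributed std_normal_distribution lborel (\<lambda>x. x) std_normal_density"
    unfolding distributed_def by (auto simp: distr_id2)
  from S.normal_density_affine[OF this _ , of s 0] s
  have "distributed std_normal_distribution lborel (\<lambda>x. s * x) (normal_density 0 s)" by simp
  then have "distr std_normal_distribution lborel (\<lambda>x. s * x) = centred_normal s"
    unfolding distributed_def centred_normal_def by auto
  then have "centred_normal s = distr std_normal_distribution borel (\<lambda>x. s * x)"
    by (metis distr_cong sets_lborel)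
  then have "char (centred_normal s) t = char std_normal_distribution (s * t)"
    unfolding char_def by (simp add: integral_distr mult_ac)
  then show ?thesis by (simp add: char_std_normal_distribution)
qed

text \<open>The characteristic function is a power of a cosine. Its exponent, the block length, is
  about \<open>N / m\<close>, while \<open>N * ln (cos (t / sqrt N))\<close> tends to
  \<open>- t^2 / 2\<close>; together they give the Gaussian of variance
  \<open>1 / m\<close>.\<close>

lemma block_sum_weak_conv:
  assumes m: "0 < m" and l: "l < m"
  shows "weak_conv_m (\<lambda>N. distr (measure_pmf (coins N)) borel (block_sum m N (l, b)))
           (centred_normal (sqrt (1 / real m)))"
proof (rule levy_continuity)
  show "real_distribution (distr (measure_pmf (coins N)) borel (block_sum m N (l, b)))" for N
    by (rule prob_space.real_distribution_distr[OF measure_pmf.prob_space_axioms]) simp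
  show "real_distribution (centred_normal (sqrt (1 / real m)))"
    by (rule real_distribution_centred_normal) (use m in simp)
  fix t :: real
  let ?k = "\<lambda>N. real (card (block m N l))"
  have lim1: "(\<lambda>N::nat. real N * ln (cos (t / sqrt (real N)))) \<longlonglongrightarrow> - (t * t / 2)"
    by real_asymp
  have lim: "(\<lambda>N. exp (?k N / real N * (real N * ln (cos (t / sqrt (real N)))))) \<longlonglongrightarrow> exp (1 / real m * - (t * t / 2))"
    by (intro tendsto_intros card_block_limit[OF m] lim1)
  have "(\<lambda>N::nat. cos (t / sqrt (real N))) \<longlonglongrightarrow> 1" by real_asymp
  \<comment> \<open>Writing the power through a logarithm requires a positive cosine, which is
    available for large \<open>N\<close>.\<close>
  then have "eventually (\<lambda>N. 0 < cos (t / sqrt (real N))) sequentially"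
    by (rule order_tendstoD(1)) simp
  then have "eventually (\<lambda>N. exp (?k N / real N * (real N * ln (cos (t / sqrt (real N)))))
       = cos (t / sqrt (real N)) ^ card (block m N l)) sequentially"
    using eventually_gt_at_top[of 0]
  proof eventually_elim
    case (elim N)
    then have "exp (?k N / real N * (real N * ln (cos (t / sqrt (real N))))) = exp (?k N * ln (cos (t / sqrt (real N))))"
      by simp
    also have "\<dots> = exp (ln (cos (t / sqrt (real N)))) ^ card (block m N l)"
      by (rule exp_of_nat_mult)
    finally show ?case using elim by simp
  qed
  from Lim_transform_eventually[OF lim this]
  have "(\<lambda>N. cos (t / sqrt (real N)) ^ card (block m N l)) \<longlonglongrightarrow> exp (1 / real m * - (t * t / 2))" .
  moreover have "exp (1 / real m * - (t * t / 2)) = exp (- (sqrt (1 / real m) * t)\<^sup>2 / 2)"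
    using m by (simp add: power_mult_distrib) (simp add: power2_eq_square field_simps)
  ultimately show "(\<lambda>N. char (distr (measure_pmf (coins N)) borel (block_sum m N (l, b))) t)
      \<longlonglongrightarrow> char (centred_normal (sqrt (1 / real m))) t"
    unfolding char_block_sum[OF m l] using m
    by (subst char_centred_normal) (simp, simp only: tendsto_of_real)
qed

section \<open>Weak convergence of independent coordinates\<close>

lemma distr_PiM_components:
  assumes I: "finite I" and \<Omega>: "\<And>i. prob_space (\<Omega> i)"
    and Y: "\<And>i. Y i \<in> measurable (\<Omega> i) (N i)"
  shows "distr (PiM I \<Omega>) (PiM I N) (\<lambda>\<omega>. \<lambda>i\<in>I. Y i (\<omega> i)) = PiM I (\<lambda>i. distr (\<Omega> i) (N i) (Y i))"
proof -
  let ?Y = "\<lambda>\<omega>. \<lambda>i\<in>I. Y i (\<omega> i)" and ?D = "\<lambda>i. distr (\<Omega> i) (N i) (Y i)"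
  interpret \<Omega>: product_prob_space \<Omega> by (rule product_prob_spaceI) (rule \<Omega>)
  interpret D: product_prob_space ?D
    by (rule product_prob_spaceI) (rule prob_space.prob_space_distr[OF \<Omega> Y])
  have meas: "?Y \<in> measurable (PiM I \<Omega>) (PiM I N)"
    by (rule measurable_restrict, rule measurable_compose[OF _ Y], rule measurable_component_singleton)
  show ?thesis
  proof (rule D.PiM_eqI[OF I])
    show "sets (distr (PiM I \<Omega>) (PiM I N) ?Y) = sets (PiM I ?D)"
      by (simp cong: sets_PiM_cong)
    fix A assume A: "\<And>i. i \<in> I \<Longrightarrow> A i \<in> sets (?D i)"
    have "?Y -` Pi\<^sub>E I A \<inter> space (PiM I \<Omega>) = Pi\<^sub>E I (\<lambda>i. Y i -` A i \<inter> space (\<Omega> i))"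
      by (auto simp: space_PiM PiE_iff)
    then have "emeasure (distr (PiM I \<Omega>) (PiM I N) ?Y) (Pi\<^sub>E I A)
        = emeasure (PiM I \<Omega>) (Pi\<^sub>E I (\<lambda>i. Y i -` A i \<inter> space (\<Omega> i)))"
      using A by (subst emeasure_distr[OF meas]) (auto intro!: sets_PiM_I_finite I)
    also have "\<dots> = (\<Prod>i\<in>I. emeasure (\<Omega> i) (Y i -` A i \<inter> space (\<Omega> i)))"
      using A by (intro \<Omega>.emeasure_PiM I measurable_sets[OF Y]) simp
    also have "\<dots> = (\<Prod>i\<in>I. emeasure (?D i) (A i))"
      using A by (intro prod.cong refl) (simp add: emeasure_distr[OF Y])
    finally show "emeasure (distr (PiM I \<Omega>) (PiM I N) ?Y) (Pi\<^sub>E I A)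
        = (\<Prod>i\<in>I. emeasure (?D i) (A i))" .
  qed
qed

text \<open>Points of the product measure are extensional functions, whereas \<open>\<Phi>\<close>
  is continuous on the full function space. The inclusion is measurable coordinate by coordinate,
  being constant off \<open>I\<close>; countability of the index type makes this sufficient for the
  Borel sets.\<close>

lemma PiM_borel_continuous_measurable:
  fixes \<Phi> :: "('i :: countable \<Rightarrow> real) \<Rightarrow> real"
  assumes "continuous_on UNIV \<Phi>"
  shows "\<Phi> \<in> borel_measurable (PiM I (\<lambda>_. borel))"
proof -
  have "(\<lambda>x. x) \<in> measurable (PiM I (\<lambda>_. borel :: real measure)) borel"
  proof (rule measurable_coordinatewise_then_product)
    fix i
    show "(\<lambda>x. x i) \<in> borel_measurable (PiM I (\<lambda>_. borel :: real measure))"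
    proof (cases "i \<in> I")
      case False
      then have "x i = undefined" if "x \<in> space (PiM I (\<lambda>_. borel :: real measure))" for x
        using that by (auto simp: space_PiM PiE_def extensional_def)
      then show ?thesis
        by (subst measurable_cong[where g="\<lambda>_. undefined"]) auto
    qed (rule measurable_component_singleton)
  qed
  from measurable_compose[OF this borel_measurable_continuous_onI[OF assms]] show ?thesis .
qed

text \<open>One-dimensional Skorokhod couplings on a product space turn weak convergence of independent
  coordinates into pointwise convergence of vectors.\<close>

lemma indep_weak_conv:
  fixes \<Phi> :: "('i :: countable \<Rightarrow> real) \<Rightarrow> real"
  assumes I: "finite I" "I \<noteq> {}" and P: "\<And>n. prob_space (P n)"
    and V: "\<And>n. prob_space.indep_vars (P n) (\<lambda>_. borel) (V n) I"
    and conv: "\<And>i. i \<in> I \<Longrightarrow> weak_conv_m (\<lambda>n. distr (P n) borel (V n i)) \<nu>"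
    and \<nu>: "real_distribution \<nu>"
    and \<Phi>: "continuous_on UNIV \<Phi>" "\<And>v. \<bar>\<Phi> v\<bar> \<le> C"
  shows "(\<lambda>n. integral\<^sup>L (P n) (\<lambda>\<omega>. \<Phi> (\<lambda>i\<in>I. V n i \<omega>))) \<longlonglongrightarrow> integral\<^sup>L (PiM I (\<lambda>_. \<nu>)) \<Phi>"
proof -
  obtain i0 where i0: "i0 \<in> I" using I by blast
  \<comment> \<open>The coupling is chosen at every index of the type; \<open>r\<close> sends
    indices outside \<open>I\<close> to a member of \<open>I\<close>, so that a coupling exists for
    them as well.\<close>
  define r where "r i = (if i \<in> I then i else i0)" for i
  have r: "r i \<in> I" for i using i0 by (simp add: r_def)
  have rv: "V n (r i) \<in> borel_measurable (P n)" for n i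
    using V[of n] r P[of n] by (simp add: prob_space.indep_vars_def)
  define \<mu> where "\<mu> i n = distr (P n) borel (V n (r i))" for i n
  define Q where "Q i \<Omega> Y_seq Y \<longleftrightarrow> prob_space \<Omega> \<and> (\<forall>n. Y_seq n \<in> measurable \<Omega> borel) \<and>
    (\<forall>n. distr \<Omega> borel (Y_seq n) = \<mu> i n) \<and> Y \<in> measurable \<Omega> lborel \<and> distr \<Omega> borel Y = \<nu> \<and>
    (\<forall>x \<in> space \<Omega>. (\<lambda>n. Y_seq n x) \<longlonglongrightarrow> Y x)"
    for i and \<Omega> :: "real measure" and Y_seq :: "nat \<Rightarrow> real \<Rightarrow> real" and Y :: "real \<Rightarrow> real"
  have "\<exists>(\<Omega> :: real measure) Y_seq Y. prob_space \<Omega> \<and> (\<forall>n. Y_seq n \<in> measurable \<Omega> borel) \<and>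
    (\<forall>n. distr \<Omega> borel (Y_seq n) = \<mu> i n) \<and> Y \<in> measurable \<Omega> lborel \<and> distr \<Omega> borel Y = \<nu> \<and>
    (\<forall>x \<in> space \<Omega>. (\<lambda>n. Y_seq n x) \<longlonglongrightarrow> Y x)" for i
  proof (rule Skorohod)
    show "real_distribution (\<mu> i n)" for n
      unfolding \<mu>_def by (rule prob_space.real_distribution_distr[OF P rv])
    show "weak_conv_m (\<mu> i) \<nu>" using conv[OF r, of i] unfolding \<mu>_def .
  qed (rule \<nu>)
  then have "\<exists>\<Omega> Y_seq Y. Q i \<Omega> Y_seq Y" for i unfolding Q_def .
  then obtain \<Omega> Ys Y where Q: "\<And>i. Q i (\<Omega> i) (Ys i) (Y i)" by metis
  have
    \<Omega>: "\<And>i. prob_space (\<Omega> i)" and Ys: "\<And>i n. Ys i n \<in> measurable (\<Omega> i) borel"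
    and Ysd: "\<And>i n. distr (\<Omega> i) borel (Ys i n) = \<mu> i n" and Y: "\<And>i. Y i \<in> measurable (\<Omega> i) borel"
    and Yd: "\<And>i. distr (\<Omega> i) borel (Y i) = \<nu>"
    and lim: "\<And>i x. x \<in> space (\<Omega> i) \<Longrightarrow> (\<lambda>n. Ys i n x) \<longlonglongrightarrow> Y i x"
    using Q unfolding Q_def by (simp_all add: measurable_lborel2)
  interpret \<Omega>: product_prob_space \<Omega> by (rule product_prob_spaceI) (rule \<Omega>)
  let ?Ys = "\<lambda>n \<omega>. \<lambda>i\<in>I. Ys i n (\<omega> i)" and ?Y = "\<lambda>\<omega>. \<lambda>i\<in>I. Y i (\<omega> i)"
  let ?B = "PiM I (\<lambda>_. borel :: real measure)"
  have \<Phi>m: "\<Phi> \<in> borel_measurable ?B" by (rule PiM_borel_continuous_measurable[OF \<Phi>(1)])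
  have m1: "?Ys n \<in> measurable (PiM I \<Omega>) ?B" for n
    by (rule measurable_restrict, rule measurable_compose[OF _ Ys], rule measurable_component_singleton)
  have m2: "?Y \<in> measurable (PiM I \<Omega>) ?B"
    by (rule measurable_restrict, rule measurable_compose[OF _ Y], rule measurable_component_singleton)
  have m3: "(\<lambda>\<omega>. \<lambda>i\<in>I. V n i \<omega>) \<in> measurable (P n) ?B" for n
    using rv[of n] by (intro measurable_restrict) (metis r_def)
  have e1: "integral\<^sup>L (P n) (\<lambda>\<omega>. \<Phi> (\<lambda>i\<in>I. V n i \<omega>)) = integral\<^sup>L (PiM I \<Omega>) (\<lambda>\<omega>. \<Phi> (\<lambda>i\<in>I. Ys i n (\<omega> i)))" for n
  proof -
    interpret prob_space "P n" by (rule P)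
    have rv': "V n i \<in> borel_measurable (P n)" if "i \<in> I" for i
      using rv[of n i] that by (simp add: r_def)
    have "distr (P n) ?B (\<lambda>\<omega>. \<lambda>i\<in>I. V n i \<omega>) = PiM I (\<lambda>i. distr (P n) borel (V n i))"
      using V[of n] by (subst (asm) indep_vars_iff_distr_eq_PiM'[OF I(2)]) (use rv' in auto)
    also have "\<dots> = PiM I (\<lambda>i. distr (\<Omega> i) borel (Ys i n))"
      by (rule PiM_cong) (auto simp: Ysd \<mu>_def r_def)
    also have "\<dots> = distr (PiM I \<Omega>) ?B (?Ys n)"
      by (rule distr_PiM_components[symmetric, OF I(1) \<Omega> Ys])
    finally have eq: "distr (P n) ?B (\<lambda>\<omega>. \<lambda>i\<in>I. V n i \<omega>) = distr (PiM I \<Omega>) ?B (?Ys n)" .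
    show ?thesis
      using integral_distr[OF m3 \<Phi>m, of n] integral_distr[OF m1 \<Phi>m, of n] unfolding eq by simp
  qed
  have e2: "integral\<^sup>L (PiM I (\<lambda>_. \<nu>)) \<Phi> = integral\<^sup>L (PiM I \<Omega>) (\<lambda>\<omega>. \<Phi> (\<lambda>i\<in>I. Y i (\<omega> i)))"
  proof -
    have "PiM I (\<lambda>_. \<nu>) = PiM I (\<lambda>i. distr (\<Omega> i) borel (Y i))"
      by (rule PiM_cong) (auto simp: Yd)
    also have "\<dots> = distr (PiM I \<Omega>) ?B ?Y"
      by (rule distr_PiM_components[symmetric, OF I(1) \<Omega> Y])
    finally show ?thesis using integral_distr[OF m2 \<Phi>m] by simp
  qed
  show ?thesis
    unfolding e1 e2
  proof (rule integral_dominated_convergence[where w="\<lambda>_. C"])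
    show "(\<lambda>\<omega>. \<Phi> (\<lambda>i\<in>I. Y i (\<omega> i))) \<in> borel_measurable (PiM I \<Omega>)"
      by (rule measurable_compose[OF m2 \<Phi>m])
    show "(\<lambda>\<omega>. \<Phi> (\<lambda>i\<in>I. Ys i n (\<omega> i))) \<in> borel_measurable (PiM I \<Omega>)" for n
      by (rule measurable_compose[OF m1 \<Phi>m])
    show "integrable (PiM I \<Omega>) (\<lambda>_. C)"
      by (rule finite_measure.integrable_const) (rule \<Omega>.P.finite_measure_axioms)
    show "AE \<omega> in PiM I \<Omega>. norm (\<Phi> (\<lambda>i\<in>I. Ys i n (\<omega> i))) \<le> C" for n
      using \<Phi>(2) by simp
    show "AE \<omega> in PiM I \<Omega>. (\<lambda>n. \<Phi> (\<lambda>i\<in>I. Ys i n (\<omega> i))) \<longlonglongrightarrow> \<Phi> (\<lambda>i\<in>I. Y i (\<omega> i))"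
    proof (rule AE_I2)
      fix \<omega> assume \<omega>: "\<omega> \<in> space (PiM I \<Omega>)"
      have "(\<lambda>n. \<lambda>i\<in>I. Ys i n (\<omega> i)) \<longlonglongrightarrow> (\<lambda>i\<in>I. Y i (\<omega> i))"
      proof -
        have "(\<lambda>n. (\<lambda>i\<in>I. Ys i n (\<omega> i)) i) \<longlonglongrightarrow> (\<lambda>i\<in>I. Y i (\<omega> i)) i" for i
          using lim[of "\<omega> i" i] \<omega> by (cases "i \<in> I") (auto simp: space_PiM)
        then have "limitin (product_topology (\<lambda>_. euclidean) UNIV) (\<lambda>n. \<lambda>i\<in>I. Ys i n (\<omega> i)) (\<lambda>i\<in>I. Y i (\<omega> i)) sequentially"
          unfolding limitin_componentwise by auto
        then show ?thesis by (simp only: euclidean_product_topology limitin_canonical_iff)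
      qed
      then show "(\<lambda>n. \<Phi> (\<lambda>i\<in>I. Ys i n (\<omega> i))) \<longlonglongrightarrow> \<Phi> (\<lambda>i\<in>I. Y i (\<omega> i))"
        by (intro continuous_on_tendsto_compose[OF \<Phi>(1)]) auto
    qed
  qed
qed

text \<open>Flipping one coin preserves the uniform law. Averaging a function with its flipped
  version thus stands in for conditioning on all other coins, which is all that the supermartingale
  argument needs.\<close>

lemma coins_flip:
  assumes p: "p \<in> {1..N} \<times> UNIV"
  shows "coin_expectation N (\<lambda>c. g (c(p := 1 - c p))) = (coin_expectation N g :: real)"
proof -
  let ?P = "PiE_dflt ({1..N} \<times> (UNIV :: bool set)) 0 (\<lambda>_. {0, 1 :: nat})"
  have val: "c p = 0 \<or> c p = 1" if "c \<in> ?P" for c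
  proof -
    have "c p \<in> {0, 1}" using that p unfolding PiE_dflt_def mem_Collect_eq by metis
    then show ?thesis by simp
  qed
  have inv: "(c(p := 1 - c p))(p := 1 - (c(p := 1 - c p)) p) = c" if "c \<in> ?P" for c
    using val[OF that] by (auto simp: fun_eq_iff)
  have stay: "c(p := 1 - c p) \<in> ?P" if "c \<in> ?P" for c
    unfolding PiE_dflt_def mem_Collect_eq
  proof (intro allI)
    fix x
    have "(x \<in> {1..N} \<times> UNIV \<longrightarrow> c x \<in> {0, 1}) \<and> (x \<notin> {1..N} \<times> UNIV \<longrightarrow> c x = 0)"
      using that unfolding PiE_dflt_def mem_Collect_eq by (rule spec)
    then show "(x \<in> {1..N} \<times> UNIV \<longrightarrow> (c(p := 1 - c p)) x \<in> {0, 1}) \<and> (x \<notin> {1..N} \<times> UNIV \<longrightarrow> (c(p := 1 - c p)) x = 0)"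
      using p val[OF that] by (cases "x = p") auto
  qed
  have "(\<Sum>c\<in>?P. g (c(p := 1 - c p))) = (\<Sum>c\<in>?P. g c)"
  proof (rule sum.reindex_bij_witness[of _ "\<lambda>c. c(p := 1 - c p)" "\<lambda>c. c(p := 1 - c p)"])
    fix c assume c: "c \<in> ?P"
    show "(c(p := 1 - c p))(p := 1 - (c(p := 1 - c p)) p) = c" "(c(p := 1 - c p))(p := 1 - (c(p := 1 - c p)) p) = c"
      by (rule inv[OF c])+
    show "c(p := 1 - c p) \<in> ?P" "c(p := 1 - c p) \<in> ?P" by (rule stay[OF c])+
  qed (rule refl)
  then show ?thesis
    unfolding coins_altdef by (simp only: integral_pmf_of_set[OF coins_nonempty finite_coins])
qed

section \<open>Oscillation of the walks inside blocks\<close>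

definition coin_walk :: "bool \<Rightarrow> (nat \<times> bool \<Rightarrow> nat) \<Rightarrow> nat \<Rightarrow> real" where
  "coin_walk b c k = (\<Sum>j\<in>{1..k}. 2 * real (c (j, b)) - 1)"

lemma coin_walk_Suc: "coin_walk b c (Suc k) = coin_walk b c k + (2 * real (c (Suc k, b)) - 1)"
  by (simp add: coin_walk_def)

text \<open>The polynomial \<open>s\<^sup>4 + 6 r s\<^sup>2 + 3 r\<^sup>2\<close> dominates the fourth moment of a simple random walk after
  \<open>r\<close> steps from \<open>s\<close>; along the walk stopped at the first exceedance it is a supermartingale.\<close>

lemma coins_maximal:
  assumes kn: "k + n \<le> N" and x: "0 < x"
  shows "coin_prob N {c. \<exists>i\<le>n. x \<le> \<bar>coin_walk b c (k + i) - coin_walk b c k\<bar>}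
    \<le> 3 * (real n)\<^sup>2 / x ^ 4"
proof -
  define S where "S c i = coin_walk b c (k + i) - coin_walk b c k" for c i
  define A where "A i c \<longleftrightarrow> (\<exists>i'\<le>i. x \<le> \<bar>S c i'\<bar>)" for i c
  define q where "q s r = s ^ 4 + 6 * s\<^sup>2 * r + 3 * r\<^sup>2" for s r :: real
  \<comment> \<open>After an exceedance the value is frozen at 1. Before it, the value is Markov's
    fourth-moment bound for the probability that the walk ends beyond \<open>x\<close> after the
    remaining \<open>n - i\<close> steps.\<close>
  define \<Phi> where "\<Phi> i c = (if A i c then 1 else q (S c i) (real (n - i)) / x ^ 4)" for i c
  have x4: "0 < x ^ 4" using x by simp
  have q_step: "(q (s + 1) r + q (s - 1) r) / 2 \<le> q s (r + 1)" for s r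
  proof -
    have "(q (s + 1) r + q (s - 1) r) / 2 = q s (r + 1) - 2"
      unfolding q_def by (simp add: field_simps power4_eq_xxxx power2_eq_square)
    then show ?thesis by simp
  qed
  have q_nonneg: "0 \<le> q s r" if "0 \<le> r" for s r
    unfolding q_def using that by (intro add_nonneg_nonneg mult_nonneg_nonneg) auto
  have AS: "A (Suc i) c \<longleftrightarrow> A i c \<or> x \<le> \<bar>S c (Suc i)\<bar>" for i c
    unfolding A_def by (metis le_Suc_eq)
  \<comment> \<open>At the first exceedance the value jumps to 1, but then
    \<open>x \<le> \<bar>S\<bar>\<close>, so even the unfrozen expression is at least 1.\<close>
  have \<Phi>_le: "\<Phi> (Suc i) c \<le> q (S c (Suc i)) (real (n - Suc i)) / x ^ 4" if "\<not> A i c" for i c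
  proof (cases "A (Suc i) c")
    case True
    then have "x \<le> \<bar>S c (Suc i)\<bar>" using that AS by blast
    then have "x ^ 4 \<le> \<bar>S c (Suc i)\<bar> ^ 4" using x by (intro power_mono) auto
    also have "\<dots> \<le> q (S c (Suc i)) (real (n - Suc i))" unfolding q_def by (simp add: power_even_abs)
    finally show ?thesis using True x4 by (simp add: \<Phi>_def)
  qed (simp add: \<Phi>_def)
  have step: "coin_expectation N (\<Phi> (Suc i)) \<le> coin_expectation N (\<Phi> i)" if i: "i < n" for i
  proof -
    let ?p = "(Suc (k + i), b)"
    let ?f = "\<lambda>c :: nat \<times> bool \<Rightarrow> nat. c(?p := 1 - c ?p)"
    have p: "?p \<in> {1..N} \<times> UNIV" using i kn by auto
    have pt: "(\<Phi> (Suc i) c + \<Phi> (Suc i) (?f c)) / 2 \<le> \<Phi> i c" if c: "c ?p = 0 \<or> c ?p = 1" for c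
    proof -
      have same: "S (?f c) i' = S c i'" if "i' \<le> i" for i'
        unfolding S_def coin_walk_def using that by (intro arg_cong2[where f="(-)"] sum.cong) auto
      have A_same: "A i (?f c) \<longleftrightarrow> A i c" unfolding A_def using same by auto
      show ?thesis
      proof (cases "A i c")
        case True
        then show ?thesis using A_same AS by (simp add: \<Phi>_def)
      next
        case False
        have S1: "S c (Suc i) = S c i + (2 * real (c ?p) - 1)" "S (?f c) (Suc i) = S c i - (2 * real (c ?p) - 1)"
          using same[of i] c unfolding S_def by (auto simp: coin_walk_Suc)
        have r: "real (n - i) = real (n - Suc i) + 1" using i by (simp add: of_nat_diff)
        have "\<Phi> (Suc i) c + \<Phi> (Suc i) (?f c)
            \<le> q (S c (Suc i)) (real (n - Suc i)) / x ^ 4 + q (S (?f c) (Suc i)) (real (n - Suc i)) / x ^ 4"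
          using False A_same by (intro add_mono \<Phi>_le) auto
        also have "\<dots> = (q (S c i + 1) (real (n - Suc i)) + q (S c i - 1) (real (n - Suc i))) / x ^ 4"
          unfolding S1 using c by (auto simp: add_divide_distrib)
        also have "\<dots> \<le> 2 * q (S c i) (real (n - i)) / x ^ 4"
          unfolding r using q_step[of "S c i" "real (n - Suc i)"] x4 by (intro divide_right_mono) auto
        finally have "\<Phi> (Suc i) c + \<Phi> (Suc i) (?f c) \<le> 2 * q (S c i) (real (n - i)) / x ^ 4" .
        moreover have "\<Phi> i c = q (S c i) (real (n - i)) / x ^ 4" using False by (simp add: \<Phi>_def)
        ultimately show ?thesis by (simp add: mult.commute)
      qed
    qed
    have val: "c ?p = 0 \<or> c ?p = 1" if "c \<in> set_pmf (coins N)" for c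
    proof -
      have "c \<in> PiE_dflt ({1..N} \<times> UNIV) 0 (\<lambda>_. {0, 1})"
        using that unfolding coins_altdef by (subst (asm) set_pmf_of_set[OF coins_nonempty finite_coins])
      then show ?thesis using p unfolding PiE_dflt_def by blast
    qed
    have "coin_expectation N (\<lambda>c. (\<Phi> (Suc i) c + \<Phi> (Suc i) (?f c)) / 2)
        \<le> coin_expectation N (\<Phi> i)"
      by (rule integral_mono_AE[OF integrable_coins integrable_coins]) (use pt val in \<open>auto simp: AE_measure_pmf_iff\<close>)
    then show ?thesis
      using coins_flip[OF p, of "\<Phi> (Suc i)"] by (simp add: integrable_coins)
  qed
  have "coin_expectation N (\<Phi> i) \<le> coin_expectation N (\<Phi> 0)" if "i \<le> n" for i
    using that
  proof (induction i)
    case (Suc i)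
    then show ?case using step[of i] by simp
  qed simp
  note this[of n]
  moreover have "\<Phi> 0 = (\<lambda>c. 3 * (real n)\<^sup>2 / x ^ 4)"
    unfolding \<Phi>_def A_def S_def q_def using x by auto
  moreover have "coin_prob N {c. A n c} \<le> coin_expectation N (\<Phi> n)"
  proof -
    have "coin_prob N {c. A n c} = coin_expectation N (indicator {c. A n c})"
      by simp
    also have "\<dots> \<le> coin_expectation N (\<Phi> n)"
      by (rule integral_mono[OF integrable_coins integrable_coins])
        (use x4 q_nonneg in \<open>auto simp: \<Phi>_def indicator_def intro!: divide_nonneg_nonneg\<close>)
    finally show ?thesis .
  qed
  ultimately show ?thesis unfolding A_def S_def by simp
qed

text \<open>Deviations are measured from the left end of a block, the point where the discretised
  path is sampled; its right end is included.\<close>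

definition osc_event :: "nat \<Rightarrow> nat \<Rightarrow> real \<Rightarrow> bool \<Rightarrow> (nat \<times> bool \<Rightarrow> nat) set" where
  "osc_event m N e b = {c. \<exists>l<m. \<exists>i\<le>card (block m N l).
     e * sqrt (real N) \<le> \<bar>coin_walk b c ((l * N) div m + i) - coin_walk b c ((l * N) div m)\<bar>}"

lemma card_block: "(l * N) div m + card (block m N l) = (Suc l * N) div m"
  unfolding block_def by (simp add: div_le_mono)

text \<open>For \<open>m \<le> N\<close> a block has at most \<open>2 * N / m\<close> sites, so the
  maximal inequality gives \<open>3 * 2^2 / (m^2 * e^4)\<close> per block. Summed over
  \<open>m\<close> blocks this still tends to 0 as \<open>m\<close> grows; that gain is the reason
  for using fourth moments.\<close>

lemma osc_event_prob:
  assumes m: "0 < m" "m \<le> N" and e: "0 < e"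
  shows "coin_prob N (osc_event m N e b) \<le> 12 / (real m * e ^ 4)"
proof -
  let ?E = "\<lambda>l. {c. \<exists>i\<le>card (block m N l). e * sqrt (real N) \<le> \<bar>coin_walk b c ((l * N) div m + i) - coin_walk b c ((l * N) div m)\<bar>}"
  have N: "0 < N" using m by simp
  have one: "coin_prob N (?E l) \<le> 12 / ((real m)\<^sup>2 * e ^ 4)" if l: "l < m" for l
  proof -
    have "(Suc l * N) div m \<le> (m * N) div m" using l by (intro div_le_mono mult_right_mono) auto
    then have kn: "(l * N) div m + card (block m N l) \<le> N" unfolding card_block using m by simp
    have "card (block m N l) * m \<le> 2 * N"
    proof -
      have "(Suc l * N) div m * m \<le> Suc l * N" by (rule div_times_less_eq_dividend)
      then have "(l * N) div m * m + card (block m N l) * m \<le> l * N + N"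
        unfolding card_block[symmetric] by (simp add: add_mult_distrib)
      moreover have "l * N < (l * N) div m * m + m" 
        using div_mult_mod_eq[of "l * N" m] mod_less_divisor[OF m(1), of "l * N"] by linarith
      ultimately have "card (block m N l) * m < N + m"
        by linarith
      then show ?thesis using m by simp
    qed
    then have "real (card (block m N l)) * real m \<le> 2 * real N"
      by (metis of_nat_le_iff of_nat_mult of_nat_numeral)
    then have cb: "real (card (block m N l)) \<le> 2 * real N / real m"
      using m by (simp add: field_simps)
    have "coin_prob N (?E l) \<le> 3 * (real (card (block m N l)))\<^sup>2 / (e * sqrt (real N)) ^ 4"
      by (rule coins_maximal[OF kn]) (use e N in simp)
    also have "\<dots> \<le> 3 * (2 * real N / real m)\<^sup>2 / (e * sqrt (real N)) ^ 4"
      using cb e by (intro divide_right_mono mult_left_mono power_mono) auto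
    also have "(e * sqrt (real N)) ^ 4 = e ^ 4 * (real N)\<^sup>2"
    proof -
      have "sqrt (real N) ^ 4 = (real N)\<^sup>2" using power_even_eq[of "sqrt (real N)" 2] by simp
      then show ?thesis by (simp add: power_mult_distrib)
    qed
    also have "3 * (2 * real N / real m)\<^sup>2 / (e ^ 4 * (real N)\<^sup>2) = 12 / ((real m)\<^sup>2 * e ^ 4)"
      using N m e by (simp add: field_simps power_mult_distrib)
    finally show ?thesis .
  qed
  have "osc_event m N e b = (\<Union>l\<in>{..<m}. ?E l)" unfolding osc_event_def by auto
  then have "coin_prob N (osc_event m N e b) \<le> (\<Sum>l<m. coin_prob N (?E l))"
    by (simp only:) (rule measure_pmf.finite_measure_subadditive_finite, auto)
  also have "\<dots> \<le> (\<Sum>l<m. 12 / ((real m)\<^sup>2 * e ^ 4))" using one by (intro sum_mono) auto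
  also have "\<dots> = 12 / (real m * e ^ 4)" using m by (simp add: power2_eq_square)
  finally show ?thesis .
qed

definition walk_path :: "nat \<Rightarrow> bool \<Rightarrow> (nat \<times> bool \<Rightarrow> nat) \<Rightarrow> real \<Rightarrow> real" where
  "walk_path N b c = step_path N (\<lambda>k. coin_walk b c k / sqrt (real N))"

lemma sum_block_sum:
  assumes "0 < m"
  shows "(\<Sum>i<l. block_sum m N (i, b) c) = coin_walk b c ((l * N) div m) / sqrt (real N)"
proof (induction l)
  case (Suc l)
  have "(l * N) div m \<le> (Suc l * N) div m" by (intro div_le_mono) auto
  then have "{1..(Suc l * N) div m} = {1..(l * N) div m} \<union> block m N l" "{1..(l * N) div m} \<inter> block m N l = {}"
    unfolding block_def by auto
  moreover have "finite (block m N l)" by (simp add: block_def)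
  ultimately have "coin_walk b c ((Suc l * N) div m) = coin_walk b c ((l * N) div m) + (\<Sum>j\<in>block m N l. 2 * real (c (j, b)) - 1)"
    unfolding coin_walk_def by (simp add: sum.union_disjoint)
  then show ?case
    using Suc by (simp add: block_sum_def add_divide_distrib sum_divide_distrib)
qed (simp add: coin_walk_def)

lemma walk_path_approx:
  assumes m: "0 < m" "0 < N" and c: "c \<notin> osc_event m N e b" and e: "0 < e" and x: "x \<in> {0..1}"
  shows "\<bar>walk_path N b c x - step_path m (\<lambda>l. \<Sum>i<l. block_sum m N (i, b) c) x\<bar> \<le> e"
proof -
  define l where "l = nat \<lfloor>real m * x\<rfloor>"
  define k where "k = nat \<lfloor>real N * x\<rfloor>"
  have l: "real l \<le> real m * x" "real m * x < real l + 1" unfolding l_def using x by auto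
  have "real m * x \<le> real m * 1" using x by (intro mult_left_mono) auto
  then have lm: "l \<le> m" using l by linarith
  have fl: "\<lfloor>real (j * N) / real m\<rfloor> = int ((j * N) div m)" for j
    by (simp only: floor_divide_of_nat_eq)
  have kl: "(l * N) div m \<le> k"
  proof -
    have "real (l * N) / real m \<le> real N * x"
      using mult_right_mono[OF l(1), of "real N"] m by (simp add: field_simps)
    then have "\<lfloor>real (l * N) / real m\<rfloor> \<le> \<lfloor>real N * x\<rfloor>" by (rule floor_mono)
    then show ?thesis unfolding k_def fl by linarith
  qed
  have eq: "walk_path N b c x - step_path m (\<lambda>l. \<Sum>i<l. block_sum m N (i, b) c) x
      = (coin_walk b c k - coin_walk b c ((l * N) div m)) / sqrt (real N)"
    unfolding walk_path_def step_path_def sum_block_sum[OF m(1)] using x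
    by (simp add: l_def k_def diff_divide_distrib)
  show ?thesis
  proof (cases "l = m")
    \<comment> \<open>At \<open>x = 1\<close> the index is \<open>m\<close>, past the last block;
      there both paths carry the same terminal value.\<close>
    case True
    then have "real m \<le> real m * x" using l by simp
    then have "x = 1" using x m by simp
    then show ?thesis unfolding eq using True m e by (simp add: k_def)
  next
    case False
    then have lm: "l < m" using lm by simp
    have "real N * x \<le> real (Suc l * N) / real m"
      using mult_right_mono[OF less_imp_le[OF l(2)], of "real N"] m by (simp add: field_simps)
    then have "\<lfloor>real N * x\<rfloor> \<le> \<lfloor>real (Suc l * N) / real m\<rfloor>" by (rule floor_mono)
    then have "k \<le> (Suc l * N) div m" unfolding k_def fl by linarith
    then have "k - (l * N) div m \<le> card (block m N l)" using card_block[of l N m] by linarith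
    then have "\<bar>coin_walk b c k - coin_walk b c ((l * N) div m)\<bar> < e * sqrt (real N)"
      using c lm kl unfolding osc_event_def by (force simp: not_le)
    then show ?thesis unfolding eq using m by (simp add: abs_divide divide_le_eq)
  qed
qed

section \<open>Brownian increments\<close>

text \<open>With \<open>s = x + y\<close> and \<open>t = x - y\<close> one has
  \<open>x^2 + y^2 = (s^2 + t^2) / 2\<close>, so the variances double; the factor 1/2 on the left is
  the Jacobian.\<close>

lemma normal_density_rotation:
  assumes \<sigma>: "0 < \<sigma>"
  shows "normal_density 0 \<sigma> ((s + t) / 2) * normal_density 0 \<sigma> ((s - t) / 2) / 2
    = normal_density 0 (sqrt 2 * \<sigma>) s * normal_density 0 (sqrt 2 * \<sigma>) t"
proof -
  have e: "- ((s + t) / 2)\<^sup>2 / (2 * \<sigma>\<^sup>2) + - ((s - t) / 2)\<^sup>2 / (2 * \<sigma>\<^sup>2)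
      = - s\<^sup>2 / (2 * (sqrt 2 * \<sigma>)\<^sup>2) + - t\<^sup>2 / (2 * (sqrt 2 * \<sigma>)\<^sup>2)"
    using \<sigma> by (simp add: power_mult_distrib field_simps power2_eq_square)
  have "normal_density 0 \<sigma> ((s + t) / 2) * normal_density 0 \<sigma> ((s - t) / 2) / 2
      = 1 / (2 * pi * \<sigma>\<^sup>2) / 2 * exp (- ((s + t) / 2)\<^sup>2 / (2 * \<sigma>\<^sup>2) + - ((s - t) / 2)\<^sup>2 / (2 * \<sigma>\<^sup>2))"
    unfolding exp_add by (simp add: normal_density_def field_simps)
  also have "\<dots> = 1 / (2 * pi * (sqrt 2 * \<sigma>)\<^sup>2) * exp (- s\<^sup>2 / (2 * (sqrt 2 * \<sigma>)\<^sup>2) + - t\<^sup>2 / (2 * (sqrt 2 * \<sigma>)\<^sup>2))"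
    unfolding e by (simp add: power_mult_distrib)
  also have "\<dots> = normal_density 0 (sqrt 2 * \<sigma>) s * normal_density 0 (sqrt 2 * \<sigma>) t"
    unfolding exp_add by (simp add: normal_density_def field_simps)
  finally show ?thesis .
qed

text \<open>The planar change of variables is made one coordinate at a time:
  \<open>y = s - x\<close> in the inner integral, then Fubini, then \<open>x = (s + t) / 2\<close>.
  The integrand then separates into \<open>s\<close> and \<open>t\<close>.\<close>

lemma gaussian_rotation:
  assumes \<sigma>: "0 < \<sigma>" and A: "A \<in> sets borel" "A' \<in> sets borel"
  shows "(\<integral>\<^sup>+x. \<integral>\<^sup>+y. indicator A (x + y) * indicator A' (x - y) \<partial>centred_normal \<sigma> \<partial>centred_normal \<sigma>)
    = emeasure (centred_normal (sqrt 2 * \<sigma>)) A * emeasure (centred_normal (sqrt 2 * \<sigma>)) A'"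
proof -
  let ?f = "\<lambda>x. ennreal (normal_density 0 \<sigma> x)" and ?g = "\<lambda>x. ennreal (normal_density 0 (sqrt 2 * \<sigma>) x)"
  note [measurable] = A
  have "(\<integral>\<^sup>+x. \<integral>\<^sup>+y. indicator A (x + y) * indicator A' (x - y) \<partial>centred_normal \<sigma> \<partial>centred_normal \<sigma>)
      = (\<integral>\<^sup>+x. ?f x * (\<integral>\<^sup>+y. ?f y * (indicator A (x + y) * indicator A' (x - y)) \<partial>lborel) \<partial>lborel)"
    unfolding centred_normal_def by (subst nn_integral_density, simp, measurable, subst nn_integral_density) auto
  also have "\<dots> = (\<integral>\<^sup>+x. (\<integral>\<^sup>+s. ?f x * (?f (s - x) * (indicator A s * indicator A' (2 * x - s))) \<partial>lborel) \<partial>lborel)"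
  proof (rule nn_integral_cong)
    fix x :: real
    have "(\<integral>\<^sup>+y. ?f y * (indicator A (x + y) * indicator A' (x - y)) \<partial>lborel)
        = (\<integral>\<^sup>+s. ?f (s - x) * (indicator A s * indicator A' (2 * x - s)) \<partial>lborel)"
      by (subst nn_integral_real_affine[of _ 1 "- x"]) (auto simp: algebra_simps)
    then show "?f x * (\<integral>\<^sup>+y. ?f y * (indicator A (x + y) * indicator A' (x - y)) \<partial>lborel)
        = (\<integral>\<^sup>+s. ?f x * (?f (s - x) * (indicator A s * indicator A' (2 * x - s))) \<partial>lborel)"
      by (simp add: nn_integral_cmult)
  qed
  also have "\<dots> = (\<integral>\<^sup>+s. (\<integral>\<^sup>+x. ?f x * (?f (s - x) * (indicator A s * indicator A' (2 * x - s))) \<partial>lborel) \<partial>lborel)"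
    by (rule lborel_pair.Fubini'[symmetric]) measurable
  also have "\<dots> = (\<integral>\<^sup>+s. (\<integral>\<^sup>+t. (?g s * indicator A s) * (?g t * indicator A' t) \<partial>lborel) \<partial>lborel)"
  proof (rule nn_integral_cong)
    fix s :: real
    have "(\<integral>\<^sup>+x. ?f x * (?f (s - x) * (indicator A s * indicator A' (2 * x - s))) \<partial>lborel)
        = ennreal (1 / 2) * (\<integral>\<^sup>+t. ?f ((s + t) / 2) * (?f ((s - t) / 2) * (indicator A s * indicator A' t)) \<partial>lborel)"
      by (subst nn_integral_real_affine[of _ "1 / 2" "s / 2"]) (auto simp: field_simps)
    also have "\<dots> = (\<integral>\<^sup>+t. ennreal (1 / 2) * (?f ((s + t) / 2) * (?f ((s - t) / 2) * (indicator A s * indicator A' t))) \<partial>lborel)"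
      by (rule nn_integral_cmult[symmetric]) measurable
    also have "\<dots> = (\<integral>\<^sup>+t. (?g s * indicator A s) * (?g t * indicator A' t) \<partial>lborel)"
    proof (rule nn_integral_cong)
      fix t :: real
      have "ennreal (1 / 2) * (?f ((s + t) / 2) * ?f ((s - t) / 2)) = ?g s * ?g t"
      proof -
        have "ennreal (1 / 2) * (?f ((s + t) / 2) * ?f ((s - t) / 2))
            = ennreal (1 / 2 * (normal_density 0 \<sigma> ((s + t) / 2) * normal_density 0 \<sigma> ((s - t) / 2)))"
          by (subst ennreal_mult, simp, simp, subst ennreal_mult, simp_all only: normal_density_nonneg)
        also have "\<dots> = ennreal (normal_density 0 (sqrt 2 * \<sigma>) s * normal_density 0 (sqrt 2 * \<sigma>) t)"
          unfolding normal_density_rotation[OF \<sigma>, of s t, symmetric] by simp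
        also have "\<dots> = ?g s * ?g t"
          by (rule ennreal_mult) (simp_all only: normal_density_nonneg)
        finally show ?thesis .
      qed
      then show "ennreal (1 / 2) * (?f ((s + t) / 2) * (?f ((s - t) / 2) * (indicator A s * indicator A' t)))
          = (?g s * indicator A s) * (?g t * indicator A' t)"
        by (simp add: mult_ac split: split_indicator)
    qed
    finally show "(\<integral>\<^sup>+x. ?f x * (?f (s - x) * (indicator A s * indicator A' (2 * x - s))) \<partial>lborel)
        = (\<integral>\<^sup>+t. (?g s * indicator A s) * (?g t * indicator A' t) \<partial>lborel)" .
  qed
  also have "\<dots> = (\<integral>\<^sup>+s. ?g s * indicator A s \<partial>lborel) * (\<integral>\<^sup>+t. ?g t * indicator A' t \<partial>lborel)"
    by (simp add: nn_integral_cmult nn_integral_multc)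
  also have "\<dots> = emeasure (centred_normal (sqrt 2 * \<sigma>)) A * emeasure (centred_normal (sqrt 2 * \<sigma>)) A'"
    unfolding centred_normal_def by (simp add: emeasure_density)
  finally show ?thesis .
qed

text \<open>Increments of \<open>B1 + B2\<close> and \<open>B1 - B2\<close> for two independent
  copies. These are the limits of the two coin walks, and half their difference is
  \<open>B2\<close>.\<close>

definition rotated :: "(nat \<Rightarrow> 'a \<Rightarrow> real) \<Rightarrow> nat \<times> bool \<Rightarrow> 'a \<times> 'a \<Rightarrow> real" where
  "rotated \<Delta> lb z = (if snd lb then \<Delta> (fst lb) (fst z) + \<Delta> (fst lb) (snd z) else \<Delta> (fst lb) (fst z) - \<Delta> (fst lb) (snd z))"

text \<open>Boxes determine the product measure. For a box the indicator factors over the time index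
  into functions \<open>h l\<close> of one pair of increments, so independence in time reduces the
  claim to one planar rotation per index.\<close>

lemma rotated_increments:
  assumes M: "prob_space M" and \<Delta>: "\<And>l. l < m \<Longrightarrow> \<Delta> l \<in> borel_measurable M" and \<sigma>: "0 < \<sigma>"
    and law: "distr M (PiM {..<m} (\<lambda>_. borel)) (\<lambda>\<omega>. \<lambda>l\<in>{..<m}. \<Delta> l \<omega>) = PiM {..<m} (\<lambda>_. centred_normal \<sigma>)"
  shows "distr (M \<Otimes>\<^sub>M M) (PiM ({..<m} \<times> UNIV) (\<lambda>_. borel)) (\<lambda>z. \<lambda>lb\<in>{..<m} \<times> UNIV. rotated \<Delta> lb z)
    = PiM ({..<m} \<times> UNIV) (\<lambda>_. centred_normal (sqrt 2 * \<sigma>))"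
proof -
  let ?MM = "M \<Otimes>\<^sub>M M"
  let ?I = "{..<m} \<times> (UNIV :: bool set)" and ?J = "{..<m}"
  let ?N = "centred_normal \<sigma>" and ?N' = "centred_normal (sqrt 2 * \<sigma>)"
  let ?BJ = "PiM ?J (\<lambda>_. borel :: real measure)" and ?BI = "PiM ?I (\<lambda>_. borel :: real measure)"
  let ?V = "\<lambda>z. \<lambda>lb\<in>?I. rotated \<Delta> lb z"
  interpret M: prob_space M by (rule M)
  interpret MM: pair_prob_space M M ..
  have \<sigma>': "0 < sqrt 2 * \<sigma>" using \<sigma> by simp
  interpret N: product_sigma_finite "\<lambda>_::nat. ?N"
    unfolding product_sigma_finite_def using prob_space_imp_sigma_finite[OF centred_normal_prob[OF \<sigma>]] by blast
  interpret N': product_sigma_finite "\<lambda>_::nat \<times> bool. ?N'"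
    unfolding product_sigma_finite_def using prob_space_imp_sigma_finite[OF centred_normal_prob[OF \<sigma>']] by blast
  have sN [measurable_cong]: "sets (centred_normal s) = sets borel" for s by (simp add: centred_normal_def)
  have fstm: "(\<lambda>z. \<Delta> l (fst z)) \<in> borel_measurable ?MM" "(\<lambda>z. \<Delta> l (snd z)) \<in> borel_measurable ?MM" if "l < m" for l
    using measurable_compose[OF measurable_fst \<Delta>[OF that]] measurable_compose[OF measurable_snd \<Delta>[OF that]] by auto
  have Vm: "?V \<in> measurable ?MM ?BI"
    by (rule measurable_restrict) (use fstm in \<open>auto simp: rotated_def\<close>)
  have Dm: "(\<lambda>\<omega>. \<lambda>l\<in>?J. \<Delta> l \<omega>) \<in> measurable M ?BJ"
    by (rule measurable_restrict) (use \<Delta> in auto)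
  show ?thesis
  proof (rule N'.PiM_eqI)
    show "finite ?I" by (intro finite_cartesian_product) auto
    show "sets (distr ?MM ?BI ?V) = sets (PiM ?I (\<lambda>_. ?N'))"
      by (simp add: sN cong: sets_PiM_cong)
    fix A assume "\<And>i. i \<in> ?I \<Longrightarrow> A i \<in> sets ?N'"
    then have A: "A (l, b) \<in> sets borel" if "l < m" for l b using that sN by auto
    define h where "h l x y = (indicator (A (l, True)) (x + y) * indicator (A (l, False)) (x - y) :: ennreal)" for l and x y :: real
    have hm [measurable]: "case_prod (h l) \<in> borel_measurable (borel \<Otimes>\<^sub>M borel)" if "l < m" for l
    proof -
      note [measurable] = A[OF that]
      show ?thesis unfolding h_def by measurable
    qed
    let ?S = "?V -` Pi\<^sub>E ?I A \<inter> space ?MM"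
    have PA: "Pi\<^sub>E ?I A \<in> sets ?BI"
      by (rule sets_PiM_I_finite) (use A in auto)
    have S: "?S \<in> sets ?MM" using Vm PA by (rule measurable_sets)
    have ind: "indicator ?S (x, y) = (\<Prod>l\<in>?J. h l (\<Delta> l x) (\<Delta> l y))" if "x \<in> space M" "y \<in> space M" for x y
    proof (cases "(x, y) \<in> ?S")
      case True
      then have r: "rotated \<Delta> (l, b) (x, y) \<in> A (l, b)" if "l < m" for l b using that by (auto simp: PiE_iff)
      have "h l (\<Delta> l x) (\<Delta> l y) = 1" if "l < m" for l
        using r[OF that, of True] r[OF that, of False] unfolding h_def by (simp add: rotated_def)
      then show ?thesis using True by simp
    next
      case False
      then obtain l b where lb: "l < m" "rotated \<Delta> (l, b) (x, y) \<notin> A (l, b)"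
        using \<open>x \<in> space M\<close> \<open>y \<in> space M\<close> by (auto simp: PiE_iff space_pair_measure)
      then have "h l (\<Delta> l x) (\<Delta> l y) = 0"
        unfolding h_def by (cases b) (auto simp: rotated_def)
      then show ?thesis using False lb by (auto intro!: prod_zero[symmetric])
    qed
    have "emeasure (distr ?MM ?BI ?V) (Pi\<^sub>E ?I A) = emeasure ?MM ?S"
      by (rule emeasure_distr[OF Vm PA])
    also have "\<dots> = (\<integral>\<^sup>+x. \<integral>\<^sup>+y. indicator ?S (x, y) \<partial>M \<partial>M)"
      by (rule M.emeasure_pair_measure[OF S])
    also have "\<dots> = (\<integral>\<^sup>+x. \<integral>\<^sup>+y. (\<Prod>l\<in>?J. h l (\<Delta> l x) (\<Delta> l y)) \<partial>M \<partial>M)"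
      by (intro nn_integral_cong) (simp add: ind)
    also have "\<dots> = (\<integral>\<^sup>+x. (\<Prod>l\<in>?J. \<integral>\<^sup>+y. h l (\<Delta> l x) y \<partial>?N) \<partial>M)"
    proof (rule nn_integral_cong)
      fix x assume "x \<in> space M"
      have m1: "(\<lambda>w. \<Prod>l\<in>?J. h l (\<Delta> l x) (w l)) \<in> borel_measurable ?BJ"
      proof (rule borel_measurable_prod_ennreal)
        fix l assume l: "l \<in> ?J"
        then have "l < m" by simp
        note [measurable] = hm[OF this] measurable_component_singleton[OF l, of "\<lambda>_. borel :: real measure"]
        show "(\<lambda>w. h l (\<Delta> l x) (w l)) \<in> borel_measurable ?BJ" by measurable
      qed
      have "(\<integral>\<^sup>+y. (\<Prod>l\<in>?J. h l (\<Delta> l x) (\<Delta> l y)) \<partial>M) = (\<integral>\<^sup>+y. (\<Prod>l\<in>?J. h l (\<Delta> l x) ((\<lambda>l\<in>?J. \<Delta> l y) l)) \<partial>M)"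
        by (intro nn_integral_cong prod.cong) auto
      also have "\<dots> = (\<integral>\<^sup>+w. (\<Prod>l\<in>?J. h l (\<Delta> l x) (w l)) \<partial>distr M ?BJ (\<lambda>\<omega>. \<lambda>l\<in>?J. \<Delta> l \<omega>))"
        by (subst nn_integral_distr[OF Dm]) (use m1 in simp_all)
      also have "\<dots> = (\<Prod>l\<in>?J. \<integral>\<^sup>+y. h l (\<Delta> l x) y \<partial>?N)"
        unfolding law
      proof (rule N.product_nn_integral_prod)
        fix l assume "l \<in> ?J"
        then have "l < m" by simp
        note [measurable] = hm[OF this]
        show "h l (\<Delta> l x) \<in> borel_measurable ?N" by measurable
      qed simp
      finally show "(\<integral>\<^sup>+y. (\<Prod>l\<in>?J. h l (\<Delta> l x) (\<Delta> l y)) \<partial>M) = (\<Prod>l\<in>?J. \<integral>\<^sup>+y. h l (\<Delta> l x) y \<partial>?N)" .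
    qed
    also have "\<dots> = (\<integral>\<^sup>+w. (\<Prod>l\<in>?J. \<integral>\<^sup>+y. h l (w l) y \<partial>?N) \<partial>distr M ?BJ (\<lambda>\<omega>. \<lambda>l\<in>?J. \<Delta> l \<omega>))"
    proof -
      have "(\<lambda>w. \<Prod>l\<in>?J. \<integral>\<^sup>+y. h l (w l) y \<partial>?N) \<in> borel_measurable ?BJ"
      proof (rule borel_measurable_prod_ennreal)
        fix l assume l: "l \<in> ?J"
        then have "l < m" by simp
        note [measurable] = hm[OF this] measurable_component_singleton[OF l, of "\<lambda>_. borel :: real measure"]
        interpret sN: prob_space ?N by (rule centred_normal_prob[OF \<sigma>])
        show "(\<lambda>w. \<integral>\<^sup>+y. h l (w l) y \<partial>?N) \<in> borel_measurable ?BJ" by measurable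
      qed
      then show ?thesis
        by (subst nn_integral_distr[OF Dm]) (auto intro!: nn_integral_cong prod.cong)
    qed
    also have "\<dots> = (\<Prod>l\<in>?J. \<integral>\<^sup>+x. \<integral>\<^sup>+y. h l x y \<partial>?N \<partial>?N)"
      unfolding law
    proof (rule N.product_nn_integral_prod)
      fix l assume "l \<in> ?J"
      then have "l < m" by simp
      note [measurable] = hm[OF this]
      interpret sN: prob_space ?N by (rule centred_normal_prob[OF \<sigma>])
      show "(\<lambda>x. \<integral>\<^sup>+y. h l x y \<partial>?N) \<in> borel_measurable ?N" by measurable
    qed simp
    also have "\<dots> = (\<Prod>l\<in>?J. \<Prod>b\<in>UNIV. emeasure ?N' (A (l, b)))"
    proof (rule prod.cong[OF refl])
      fix l assume "l \<in> ?J"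
      then show "(\<integral>\<^sup>+x. \<integral>\<^sup>+y. h l x y \<partial>?N \<partial>?N) = (\<Prod>b\<in>UNIV. emeasure ?N' (A (l, b)))"
        unfolding h_def by (subst gaussian_rotation[OF \<sigma>]) (auto simp: A UNIV_bool mult.commute)
    qed
    also have "\<dots> = (\<Prod>lb\<in>?I. emeasure ?N' (A lb))"
      by (simp add: prod.cartesian_product case_prod_beta')
    finally show "emeasure (distr ?MM ?BI ?V) (Pi\<^sub>E ?I A) = (\<Prod>lb\<in>?I. emeasure ?N' (A lb))" .
  qed
qed

definition bm_increment :: "nat \<Rightarrow> (real \<Rightarrow> 'a \<Rightarrow> real) \<Rightarrow> nat \<Rightarrow> 'a \<Rightarrow> real" where
  "bm_increment m B l \<omega> = B (real (Suc l) / real m) \<omega> - B (real l / real m) \<omega>"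

lemma bm_increment_measurable:
  assumes "continuous_process M B" "l < m"
  shows "bm_increment m B l \<in> borel_measurable M"
proof -
  have "real (Suc l) / real m \<in> {0..1}" "real l / real m \<in> {0..1}" using assms(2) by auto
  then have "B (real (Suc l) / real m) \<in> borel_measurable M" "B (real l / real m) \<in> borel_measurable M"
    using assms(1) unfolding continuous_process_def by blast+
  then show ?thesis unfolding bm_increment_def by simp
qed

lemma bm_increments_law:
  assumes M: "prob_space M" and B: "brownian_motion M \<sigma>2 B" and m: "0 < m"
  shows "distr M (PiM {..<m} (\<lambda>_. borel)) (\<lambda>\<omega>. \<lambda>l\<in>{..<m}. bm_increment m B l \<omega>)
    = PiM {..<m} (\<lambda>_. centred_normal (sqrt (\<sigma>2 / real m)))"
proof -
  interpret prob_space M by (rule M)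
  have cp: "continuous_process M B" using B unfolding brownian_motion_def by blast
  define t where "t i = min 1 (real i / real m)" for i
  have t: "t i = real i / real m" if "i \<le> m" for i using that m by (simp add: t_def)
  have "t ` {..m} \<subseteq> {0..1}" "mono_on {..m} t"
    unfolding t_def mono_on_def by (auto simp: min_le_iff_disj divide_right_mono)
  then have "indep_vars (\<lambda>_. borel) (\<lambda>i \<omega>. B (t (Suc i)) \<omega> - B (t i) \<omega>) {..<m}"
    using B unfolding brownian_motion_def by blast
  then have "indep_vars (\<lambda>_. borel) (bm_increment m B) {..<m}"
    by (subst (asm) indep_vars_cong[OF refl _ refl, where Y="bm_increment m B"]) (auto simp: t bm_increment_def fun_eq_iff)
  then have "distr M (PiM {..<m} (\<lambda>_. borel)) (\<lambda>\<omega>. \<lambda>l\<in>{..<m}. bm_increment m B l \<omega>)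
      = PiM {..<m} (\<lambda>l. distr M borel (bm_increment m B l))"
    using m bm_increment_measurable[OF cp] by (subst (asm) indep_vars_iff_distr_eq_PiM') auto
  also have "\<dots> = PiM {..<m} (\<lambda>_. centred_normal (sqrt (\<sigma>2 / real m)))"
  proof (rule PiM_cong[OF refl])
    fix l assume "l \<in> {..<m}"
    then have l: "0 \<le> real l / real m" "real l / real m < real (Suc l) / real m" "real (Suc l) / real m \<le> 1"
      using m by (auto simp: divide_strict_right_mono)
    have "distributed M lborel (\<lambda>\<omega>. B (real (Suc l) / real m) \<omega> - B (real l / real m) \<omega>)
        (normal_density 0 (sqrt (\<sigma>2 * (real (Suc l) / real m - real l / real m))))"
      using B l unfolding brownian_motion_def by blast
    moreover have "real (Suc l) / real m - real l / real m = 1 / real m"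
      by (simp add: diff_divide_distrib[symmetric])
    ultimately have "distr M lborel (bm_increment m B l) = centred_normal (sqrt (\<sigma>2 / real m))"
      unfolding distributed_def bm_increment_def centred_normal_def by simp
    then show "distr M borel (bm_increment m B l) = centred_normal (sqrt (\<sigma>2 / real m))"
      by (metis distr_cong sets_lborel)
  qed
  finally show ?thesis .
qed

section \<open>The two-layer representation\<close>

text \<open>The minimum of all partial sums, the empty one included, in the form that recursion on
  the first step produces.\<close>

primrec walk_min :: "real list \<Rightarrow> real" where
  "walk_min [] = 0"
| "walk_min (d # ds) = min 0 (d + walk_min ds)"

lemma walk_min_le: "k \<le> length ds \<Longrightarrow> walk_min ds \<le> sum_list (take k ds)"
proof (induction ds arbitrary: k)
  case (Cons d ds)
  then show ?case by (cases k) (auto simp: min_le_iff_disj)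
qed simp

lemma walk_min_attained: "\<exists>k\<le>length ds. walk_min ds = sum_list (take k ds)"
proof (induction ds)
  case (Cons d ds)
  then obtain k where k: "k \<le> length ds" "walk_min ds = sum_list (take k ds)" by blast
  show ?case
  proof (cases "0 \<le> d + walk_min ds")
    case True
    then show ?thesis by (intro exI[of _ 0]) simp
  next
    case False
    then show ?thesis using k by (intro exI[of _ "Suc k"]) simp
  qed
qed simp

definition bin_lists :: "nat \<Rightarrow> nat list set" where
  "bin_lists n = {ys. set ys \<subseteq> {0, 1} \<and> length ys = n}"

lemma finite_bin_lists: "finite (bin_lists n)"
  unfolding bin_lists_def by (rule finite_lists_length_eq) simp

lemma sum_bin_lists_Suc:
  "(\<Sum>ys\<in>bin_lists (Suc n). f ys) = (\<Sum>ys\<in>bin_lists n. f (0 # ys)) + (\<Sum>ys\<in>bin_lists n. f (1 # ys) :: real)"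
proof -
  have e: "bin_lists (Suc n) = Cons 0 ` bin_lists n \<union> Cons 1 ` bin_lists n"
    unfolding bin_lists_def by (auto simp: length_Suc_conv)
  show ?thesis
    unfolding e using finite_bin_lists
    by (subst sum.union_disjoint) (auto simp: sum.reindex)
qed

definition list_diff :: "nat list \<Rightarrow> nat list \<Rightarrow> real list" where
  "list_diff xs ys = map2 (\<lambda>x y. real x - real y) xs ys"

text \<open>The two-layer form of the weights: the second layer is summed out, and the state \<open>s\<close> is the
  height of the difference walk above its running minimum.\<close>

lemma lweight_two_layer:
  assumes "set xs \<subseteq> {0, 1}"
  shows "lweight (exp (- p)) (exp (- q)) s xs
    = (\<Sum>ys\<in>bin_lists (length xs). exp ((p + q) * min 0 (real s + walk_min (list_diff xs ys)) - q * sum_list (list_diff xs ys)))"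
  using assms
proof (induction xs arbitrary: s)
  case Nil
  have "bin_lists 0 = {[]}" unfolding bin_lists_def by auto
  then show ?case by (simp add: list_diff_def)
next
  case (Cons x xs)
  let ?bl = "bin_lists (length xs)" and ?m = "\<lambda>ys. walk_min (list_diff xs ys)" and ?t = "\<lambda>ys. sum_list (list_diff xs ys)"
  let ?g = "\<lambda>s ys. exp ((p + q) * min 0 (real s + ?m ys) - q * ?t ys)"
  have IH: "lweight (exp (- p)) (exp (- q)) s xs = (\<Sum>ys\<in>?bl. ?g s ys)" for s
    using Cons by simp
  \<comment> \<open>Since \<open>s\<close> is nonnegative, the inner minimum with 0 is absorbed by
    the outer one.\<close>
  have z: "min 0 (real s + min 0 w) = min 0 (real s + w)" for w by auto
  have ld: "list_diff (x' # xs) (y # ys) = (real x' - real y) # list_diff xs ys" for x' y ys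
    by (simp add: list_diff_def)
  show ?case
  proof (cases "x = 0")
    case True
    \<comment> \<open>A hole above a particle is a down-step. From \<open>s = 0\<close> it lowers
      the running minimum, with factor \<open>exp (- (p + q) + q) = exp (- p)\<close>; from
      \<open>s > 0\<close> it only changes the end point, with factor \<open>exp q\<close>. These
      are \<open>a\<close> and \<open>1 / b\<close>.\<close>
    have two: "(\<Sum>ys\<in>?bl. exp ((p + q) * min 0 (real s + (- 1 + ?m ys)) - q * (- 1 + ?t ys)))
        = (if s = 0 then exp (- p) * (\<Sum>ys\<in>?bl. ?g 0 ys) else (\<Sum>ys\<in>?bl. ?g (s - 1) ys) / exp (- q))"
    proof (cases "s = 0")
      case True
      have m: "walk_min ds \<le> 0" for ds by (cases ds) auto
      have "exp ((p + q) * min 0 (real 0 + (- 1 + walk_min ds)) - q * (- 1 + t)) = exp (- p) * exp ((p + q) * min 0 (real 0 + walk_min ds) - q * t)" for ds t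
      proof -
        have "min 0 (real 0 + (- 1 + walk_min ds)) = - 1 + walk_min ds" "min 0 (real 0 + walk_min ds) = walk_min ds"
          using m[of ds] by auto
        then show ?thesis by (simp add: exp_add[symmetric] algebra_simps)
      qed
      then show ?thesis using True by (simp add: sum_distrib_left)
    next
      case False
      then have r: "real s - 1 = real (s - 1)" by (simp add: of_nat_diff)
      have "exp ((p + q) * min 0 (real s + (- 1 + w)) - q * (- 1 + t)) = exp ((p + q) * min 0 (real (s - 1) + w) - q * t) / exp (- q)" for w t
        unfolding r[symmetric] by (simp add: exp_diff[symmetric] algebra_simps)
      then show ?thesis using False by (simp add: sum_divide_distrib)
    qed
    have "(\<Sum>ys\<in>bin_lists (length (x # xs)). exp ((p + q) * min 0 (real s + walk_min (list_diff (x # xs) ys)) - q * sum_list (list_diff (x # xs) ys)))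
        = (\<Sum>ys\<in>?bl. ?g s ys) + (\<Sum>ys\<in>?bl. exp ((p + q) * min 0 (real s + (- 1 + ?m ys)) - q * (- 1 + ?t ys)))"
      using True by (simp add: sum_bin_lists_Suc ld z)
    then show ?thesis
      unfolding two using True by (simp add: IH)
  next
    case False
    then have x: "x = 1" using Cons.prems by auto
    have "exp ((p + q) * min 0 (real s + (1 + w)) - q * (1 + t)) = exp (- q) * exp ((p + q) * min 0 (real (Suc s) + w) - q * t)" for w t
      by (simp add: exp_add[symmetric] algebra_simps)
    then show ?thesis
      using x by (simp add: sum_bin_lists_Suc ld z IH sum_distrib_left)
  qed
qed

lemma map_config_subset: "\<xi> \<in> tasep_configs N \<Longrightarrow> set (map \<xi> [1..<Suc N]) \<subseteq> {0, 1}"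
  using tasep_configs_val[of \<xi> N] by (fastforce simp del: upt_Suc)

lemma sum_configs_lists:
  "(\<Sum>\<xi>\<in>tasep_configs N. f (map \<xi> [1..<Suc N])) = (\<Sum>ys\<in>bin_lists N. f ys :: real)"
proof (rule sum.reindex_bij_witness[where i="\<lambda>ys. \<lambda>j\<in>{1..N}. ys ! (j - 1)" and j="\<lambda>\<xi>. map \<xi> [1..<Suc N]"])
  fix \<xi> assume \<xi>: "\<xi> \<in> tasep_configs N"
  show "map \<xi> [1..<Suc N] \<in> bin_lists N"
    unfolding bin_lists_def using map_config_subset[OF \<xi>] by (simp del: upt_Suc)
  show "(\<lambda>j\<in>{1..N}. map \<xi> [1..<Suc N] ! (j - 1)) = \<xi>"
    using \<xi> unfolding tasep_configs_def
    by (intro extensionalityI[of _ "{1..N}"]) (auto simp: PiE_iff simp del: upt_Suc)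
next
  fix ys assume ys: "ys \<in> bin_lists N"
  show "(\<lambda>j\<in>{1..N}. ys ! (j - 1)) \<in> tasep_configs N"
    unfolding tasep_configs_def
  proof (rule PiE_I)
    fix j assume j: "j \<in> {1..N}"
    then have "ys ! (j - 1) \<in> set ys" using ys unfolding bin_lists_def by (intro nth_mem) auto
    then show "(\<lambda>j\<in>{1..N}. ys ! (j - 1)) j \<in> {0, 1}" using ys j unfolding bin_lists_def by auto
  qed auto
  show "map (\<lambda>j\<in>{1..N}. ys ! (j - 1)) [1..<Suc N] = ys"
    using ys unfolding bin_lists_def by (intro nth_equalityI) (auto simp del: upt_Suc)
qed auto

section \<open>The stationary weight as a tilt of the difference path\<close>

definition diff_path :: "nat \<Rightarrow> (nat \<Rightarrow> nat) \<Rightarrow> (nat \<Rightarrow> nat) \<Rightarrow> real \<Rightarrow> real" where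
  "diff_path N \<tau> \<xi> = step_path N (\<lambda>k. (real (tasep_height \<tau> k) - real (tasep_height \<xi> k)) / sqrt (real N))"

lemma INF_step_path:
  assumes "\<And>k. k \<le> N \<Longrightarrow> v \<le> c k" "k0 \<le> N" "c k0 = v"
  shows "(INF x\<in>{0..1}. step_path N c x) = v"
proof (rule cInf_eq_minimum)
  have le: "nat \<lfloor>real N * x\<rfloor> \<le> N" if "x \<in> {0..1}" for x using that by (rule nat_floor_le)
  show "v \<in> step_path N c ` {0..1}"
  proof (cases "N = 0")
    case True
    then show ?thesis using assms by (intro image_eqI[of _ _ 0]) (auto simp: step_path_def)
  next
    case False
    then show ?thesis using assms
      by (intro image_eqI[of _ _ "real k0 / real N"]) (auto simp: step_path_def divide_le_eq_1)
  qed
  show "v \<le> y" if "y \<in> step_path N c ` {0..1}" for y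
    using that assms(1) le by (auto simp: step_path_def)
qed

text \<open>The factor \<open>1 / sqrt N\<close> can be read in the parameters or in the path, which
  is why \<open>a\<close> and \<open>b\<close> are scaled as they are. The right-hand side keeps the
  shape of the two-layer formula at state 0.\<close>

lemma tilt_diff_path:
  assumes "\<tau> \<in> tasep_configs N" "\<xi> \<in> tasep_configs N"
  defines "ds \<equiv> list_diff (map \<tau> [1..<Suc N]) (map \<xi> [1..<Suc N])"
  shows "tilt u v (diff_path N \<tau> \<xi>)
    = exp ((u / sqrt (real N) + v / sqrt (real N)) * min 0 (real 0 + walk_min ds) - v / sqrt (real N) * sum_list ds)"
proof -
  have len: "length ds = N" unfolding ds_def list_diff_def by simp
  have ds: "ds = map (\<lambda>j. real (\<tau> j) - real (\<xi> j)) [1..<Suc N]"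
    unfolding ds_def list_diff_def by (intro nth_equalityI) (auto simp del: upt_Suc)
  have D: "sum_list (take k ds) = real (tasep_height \<tau> k) - real (tasep_height \<xi> k)" if "k \<le> N" for k
  proof -
    have "take k ds = map (\<lambda>j. real (\<tau> j) - real (\<xi> j)) [1..<Suc k]"
      unfolding ds take_map using that by (simp add: take_upt del: upt_Suc)
    then have "sum_list (take k ds) = (\<Sum>j\<in>{1..<Suc k}. real (\<tau> j) - real (\<xi> j))"
      by (simp only: sum_set_upt_conv_sum_list_nat[symmetric] set_upt)
    then show ?thesis
      unfolding tasep_height_def by (simp add: atLeastLessThanSuc_atLeastAtMost sum_subtractf)
  qed
  have m: "walk_min ds \<le> 0" by (cases ds) auto
  obtain k0 where k0: "k0 \<le> N" "walk_min ds = sum_list (take k0 ds)"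
    using walk_min_attained[of ds] len by blast
  have "(INF x\<in>{0..1}. diff_path N \<tau> \<xi> x) = walk_min ds / sqrt (real N)"
    unfolding diff_path_def
  proof (rule INF_step_path[OF _ k0(1)])
    show "walk_min ds / sqrt (real N) \<le> (real (tasep_height \<tau> k) - real (tasep_height \<xi> k)) / sqrt (real N)" if "k \<le> N" for k
      using walk_min_le[of k ds] that len by (intro divide_right_mono) (auto simp flip: D)
    show "(real (tasep_height \<tau> k0) - real (tasep_height \<xi> k0)) / sqrt (real N) = walk_min ds / sqrt (real N)"
      using k0 D by simp
  qed
  moreover have "diff_path N \<tau> \<xi> 1 = sum_list ds / sqrt (real N)"
    using D[of N] len by (simp add: diff_path_def step_path_def)
  ultimately show ?thesis
    using m by (simp add: tilt_def add_divide_distrib[symmetric] min_absorb2)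
qed

text \<open>There is no error term: for every finite system the weight is already the functional of
  the limit theorem, summed over the second layer. Only the law of the walks has to
  converge.\<close>

lemma cweight_tilt:
  assumes \<tau>: "\<tau> \<in> tasep_configs N"
  shows "cweight N (exp (- u / sqrt (real N))) (exp (- v / sqrt (real N))) \<tau>
    = (\<Sum>\<xi>\<in>tasep_configs N. tilt u v (diff_path N \<tau> \<xi>))"
proof -
  let ?xs = "map \<tau> [1..<Suc N]"
  have s: "set ?xs \<subseteq> {0, 1}" by (rule map_config_subset[OF \<tau>])
  have l: "length ?xs = N" by (simp del: upt_Suc)
  let ?F = "\<lambda>ys. exp ((u / sqrt (real N) + v / sqrt (real N)) * min 0 (real 0 + walk_min (list_diff ?xs ys)) - v / sqrt (real N) * sum_list (list_diff ?xs ys))"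
  have "cweight N (exp (- (u / sqrt (real N)))) (exp (- (v / sqrt (real N)))) \<tau> = (\<Sum>ys\<in>bin_lists N. ?F ys)"
    unfolding cweight_def lweight_two_layer[OF s] l ..
  also have "\<dots> = (\<Sum>\<xi>\<in>tasep_configs N. ?F (map \<xi> [1..<Suc N]))"
    by (rule sum_configs_lists[symmetric])
  also have "\<dots> = (\<Sum>\<xi>\<in>tasep_configs N. tilt u v (diff_path N \<tau> \<xi>))"
    by (rule sum.cong[OF refl]) (rule tilt_diff_path[OF \<tau>, symmetric])
  finally show ?thesis by simp
qed

text \<open>Multiplying by \<open>b ^ s\<close> turns the transfer operator of the weights into a discrete Laplacian with a
  Robin condition at 0, for which \<open>Y ^ s + (1 / M) ^ s\<close> is a supersolution.\<close>

lemma sum_lweight_le: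
  assumes b: "0 < b" "b \<le> Y" and X: "1 \<le> X" "a \<le> X" and Y: "1 \<le> Y" and a: "0 < a" and M: "M = Y * X\<^sup>2"
    and h: "\<And>s. h s = Y ^ s + (1 / M) ^ s"
  shows "(\<Sum>xs\<in>bin_lists n. lweight a b s xs) \<le> (2 + M + 1 / M) ^ n * (h s / b ^ s)"
proof (induction n arbitrary: s)
  case 0
  have "0 < M" using X Y M by simp
  \<comment> \<open>The induction starts from the constant function 1, which becomes
    \<open>b ^ s\<close> after the multiplication; \<open>b \<le> Y\<close> puts it below the
    supersolution.\<close>
  then have "b ^ s \<le> h s" using power_mono[of b Y s] b h[of s] by (simp add: add_increasing2)
  moreover have "bin_lists 0 = {[]}" unfolding bin_lists_def by auto
  ultimately show ?case using b by (simp add: le_divide_eq_1)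
next
  case (Suc n)
  let ?\<rho> = "2 + M + 1 / M"
  have X2: "1 \<le> X\<^sup>2" using X by simp
  have M0: "0 < M" and YM: "Y \<le> M" using X2 Y M by (auto intro!: mult_pos_pos)
  have M1: "2 \<le> M + 1 / M"
  proof -
    have "0 \<le> (M - 1)\<^sup>2 / M" using M0 by simp
    also have "(M - 1)\<^sup>2 / M = M + 1 / M - 2" using M0 by (simp add: power2_eq_square field_simps)
    finally show ?thesis by simp
  qed
  have core: "2 * h s + (if s = 0 then a * h 0 else h (s - 1)) + h (Suc s) \<le> ?\<rho> * h s" for s
  proof (cases s)
    case 0
    \<comment> \<open>The boundary row asks for \<open>Y + 2 * X - 2 \<le> M\<close>. The choice
      \<open>M = Y * X^2\<close> makes the difference factor into this product.\<close>
    have "0 \<le> (X - 1) * (Y * (X + 1) - 2)"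
      using X Y mult_mono[of 1 Y 2 "X + 1"] by (intro mult_nonneg_nonneg) auto
    then have "Y + 2 * X - 2 \<le> M" unfolding M by (simp add: algebra_simps power2_eq_square)
    then have "2 * 2 + a * 2 + (Y + 1 / M) \<le> (2 + M + 1 / M) * 2" using X M1 by (simp add: algebra_simps)
    then show ?thesis using 0 by (simp add: h)
  next
    case (Suc r)
    \<comment> \<open>Away from 0 the part \<open>Y ^ s\<close> is a supersolution because
      \<open>Y + 1 / Y \<le> M + 1 / M\<close> for \<open>1 \<le> Y \<le> M\<close>.\<close>
    have "0 \<le> (M - Y) * (M * Y - 1) / M"
    proof -
      have "1 * 1 \<le> M * Y" using YM Y by (intro mult_mono) auto
      then show ?thesis using YM M0 by (intro divide_nonneg_nonneg mult_nonneg_nonneg) auto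
    qed
    also have "(M - Y) * (M * Y - 1) / M = (M + 1 / M) * Y - (Y\<^sup>2 + 1)"
      using M0 by (simp add: field_simps power2_eq_square)
    finally have y: "Y\<^sup>2 + 1 \<le> (M + 1 / M) * Y" by simp
    \<comment> \<open>The part \<open>(1 / M) ^ s\<close> is an exact eigenfunction away from 0; it
      is added to meet the boundary row.\<close>
    have z: "(1 / M)\<^sup>2 + 1 = (M + 1 / M) * (1 / M)" using M0 by (simp add: field_simps power2_eq_square)
    have "h r + h (Suc s) = Y ^ r * (Y\<^sup>2 + 1) + (1 / M) ^ r * ((1 / M)\<^sup>2 + 1)"
      unfolding h Suc by (simp add: algebra_simps power2_eq_square)
    also have "\<dots> \<le> Y ^ r * ((M + 1 / M) * Y) + (1 / M) ^ r * ((M + 1 / M) * (1 / M))"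
      unfolding z using y Y by (intro add_right_mono mult_left_mono) auto
    also have "\<dots> = (M + 1 / M) * h s"
    proof -
      have "A * (c * Y) + B * (c * k) = c * (Y * A + k * B)" for A B c k :: real
        by (simp add: algebra_simps)
      then show ?thesis unfolding h Suc power_Suc .
    qed
    finally have "h r + h (Suc s) \<le> (M + 1 / M) * h s" .
    then show ?thesis using Suc by (simp add: algebra_simps)
  qed
  let ?Z = "\<lambda>s. (\<Sum>xs\<in>bin_lists n. lweight a b s xs)"
  have \<rho>: "0 \<le> ?\<rho> ^ n" using M0 by simp
  have "(\<Sum>xs\<in>bin_lists (Suc n). lweight a b s xs)
      = 2 * ?Z s + (if s = 0 then a * ?Z 0 else ?Z (s - 1) / b) + b * ?Z (Suc s)"
    by (simp add: sum_bin_lists_Suc sum.distrib sum_distrib_left sum_divide_distrib)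
  also have "\<dots> \<le> 2 * (?\<rho> ^ n * (h s / b ^ s)) + (if s = 0 then a * (?\<rho> ^ n * (h 0 / b ^ 0)) else ?\<rho> ^ n * (h (s - 1) / b ^ (s - 1)) / b)
      + b * (?\<rho> ^ n * (h (Suc s) / b ^ Suc s))"
  proof (intro add_mono)
    show "2 * ?Z s \<le> 2 * (?\<rho> ^ n * (h s / b ^ s))" using Suc.IH[of s] by simp
    show "(if s = 0 then a * ?Z 0 else ?Z (s - 1) / b)
        \<le> (if s = 0 then a * (?\<rho> ^ n * (h 0 / b ^ 0)) else ?\<rho> ^ n * (h (s - 1) / b ^ (s - 1)) / b)"
      using mult_left_mono[OF Suc.IH[of 0], of a] divide_right_mono[OF Suc.IH[of "s - 1"], of b] a b by simp
    show "b * ?Z (Suc s) \<le> b * (?\<rho> ^ n * (h (Suc s) / b ^ Suc s))"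
      using mult_left_mono[OF Suc.IH[of "Suc s"], of b] b by simp
  qed
  also have "\<dots> = ?\<rho> ^ n / b ^ s * (2 * h s + (if s = 0 then a * h 0 else h (s - 1)) + h (Suc s))"
    using b by (cases s) (auto simp: field_simps)
  also have "\<dots> \<le> ?\<rho> ^ n / b ^ s * (?\<rho> * h s)"
    using core[of s] b \<rho> by (intro mult_left_mono divide_nonneg_nonneg) auto
  finally show ?case by (simp add: field_simps)
qed

text \<open>The bound \<open>2 + M + 1 / M\<close> on the growth per site exceeds 4 by order
  \<open>1 / N\<close>, because \<open>M\<close> differs from 1 by order \<open>1 / sqrt N\<close>.
  Its \<open>N\<close>-th power over \<open>4 ^ N\<close> therefore stays bounded.\<close>

lemma sum_tilt_le:
  fixes u v :: real
  obtains C where "\<And>N. (\<Sum>\<tau>\<in>tasep_configs N. \<Sum>\<xi>\<in>tasep_configs N. tilt u v (diff_path N \<tau> \<xi>)) / 4 ^ N \<le> C"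
proof -
  \<comment> \<open>The exponent that matches \<open>M = Y * X^2\<close>, with \<open>X\<close> and
    \<open>Y\<close> built from the absolute values so that parameters of either sign are
    covered.\<close>
  let ?\<mu> = "\<bar>v\<bar> + 2 * \<bar>u\<bar>"
  let ?r = "\<lambda>N. real N * ((exp (?\<mu> / sqrt (real N)) + 1 / exp (?\<mu> / sqrt (real N)) - 2) / 4)"
  have "convergent ?r"
  proof (rule convergentI)
    show "?r \<longlonglongrightarrow> ?\<mu> * ?\<mu> / 4" by real_asymp
  qed
  then have "Bseq ?r" by (rule convergent_imp_Bseq)
  then obtain R where "0 < R" and R: "\<forall>N. norm (?r N) \<le> R" by (rule BseqE)
  let ?S = "\<lambda>N. \<Sum>\<tau>\<in>tasep_configs N. \<Sum>\<xi>\<in>tasep_configs N. tilt u v (diff_path N \<tau> \<xi>)"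
  have "?S N / 4 ^ N \<le> 2 * exp R" for N
  proof -
    let ?a = "exp (- u / sqrt (real N))" and ?b = "exp (- v / sqrt (real N))"
    let ?X = "exp (\<bar>u\<bar> / sqrt (real N))" and ?Y = "exp (\<bar>v\<bar> / sqrt (real N))" and ?M = "exp (?\<mu> / sqrt (real N))"
    have ub: "- w / sqrt (real N) \<le> \<bar>w\<bar> / sqrt (real N)" for w by (rule divide_right_mono) auto
    have "?S N
        = (\<Sum>\<tau>\<in>tasep_configs N. cweight N ?a ?b \<tau>)"
      by (rule sum.cong[OF refl]) (rule cweight_tilt[symmetric])
    also have "\<dots> = (\<Sum>xs\<in>bin_lists N. lweight ?a ?b 0 xs)"
      unfolding cweight_def by (rule sum_configs_lists)
    also have "\<dots> \<le> (2 + ?M + 1 / ?M) ^ N * ((?Y ^ 0 + (1 / ?M) ^ 0) / ?b ^ 0)"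
    proof (rule sum_lweight_le[where h="\<lambda>s. ?Y ^ s + (1 / ?M) ^ s" and X="?X" and Y="?Y"])
      show "?M = ?Y * ?X\<^sup>2" by (simp add: exp_add[symmetric] power2_eq_square add_divide_distrib)
    qed (use ub in auto)
    finally have "?S N / 4 ^ N
        \<le> ((2 + ?M + 1 / ?M) / 4) ^ N * 2"
      by (simp add: power_divide divide_right_mono)
    also have "\<dots> \<le> exp ((?M + 1 / ?M - 2) / 4) ^ N * 2"
    proof -
      have "(2 + k + j) / 4 = 1 + (k + j - 2) / 4" for k j :: real by (simp add: field_simps)
      then have "(2 + ?M + 1 / ?M) / 4 = 1 + (?M + 1 / ?M - 2) / 4" .
      also have "\<dots> \<le> exp ((?M + 1 / ?M - 2) / 4)" by (rule exp_ge_add_one_self)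
      finally show ?thesis
        by (intro mult_right_mono power_mono) (auto intro!: divide_nonneg_nonneg add_nonneg_nonneg)
    qed
    also have "exp ((?M + 1 / ?M - 2) / 4) ^ N = exp (?r N)"
      by (rule exp_of_nat_mult[symmetric])
    also have "exp (?r N) * 2 \<le> 2 * exp R" using R[rule_format, of N] by simp
    finally show ?thesis .
  qed
  then show ?thesis by (rule that)
qed

section \<open>The scaling limit\<close>

text \<open>Half the difference of two walks with steps of size 1 is the difference of the two
  particle counts, the path on which the tilt is evaluated.\<close>

definition walk_half :: "nat \<Rightarrow> (nat \<times> bool \<Rightarrow> nat) \<Rightarrow> real \<Rightarrow> real" where
  "walk_half N c = step_path N (\<lambda>k. (coin_walk True c k - coin_walk False c k) / 2 / sqrt (real N))"

definition block_functional :: "nat \<Rightarrow> ((real \<Rightarrow> real) \<Rightarrow> (real \<Rightarrow> real) \<Rightarrow> real) \<Rightarrow> (nat \<times> bool \<Rightarrow> real) \<Rightarrow> real" where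
  "block_functional m h v = h (step_path m (\<lambda>i. \<Sum>l<i. v (l, True))) (step_path m (\<lambda>i. \<Sum>l<i. (v (l, True) - v (l, False)) / 2))"

lemma block_functional_cont:
  assumes "unif_lip2 L h"
  shows "continuous_on UNIV (block_functional m h)"
  unfolding block_functional_def
  by (rule step_functional_continuous[OF assms]; intro continuous_intros) auto

lemma step_path_cong: "(\<And>i. i \<le> m \<Longrightarrow> c i = d i) \<Longrightarrow> step_path m c = step_path m d"
proof -
  assume a: "\<And>i. i \<le> m \<Longrightarrow> c i = d i"
  have "nat \<lfloor>real m * x\<rfloor> \<le> m" if "x \<in> {0..1}" for x using that by (rule nat_floor_le)
  then show ?thesis unfolding step_path_def using a by (intro restrict_ext) auto
qed

lemma block_functional_restrict:
  "block_functional m h (\<lambda>i\<in>{..<m} \<times> UNIV. v i) = block_functional m h v"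
  unfolding block_functional_def
  by (intro arg_cong2[where f=h] step_path_cong sum.cong) auto

lemma walk_functional_approx:
  assumes h: "unif_lip2 L h" and m: "0 < m" "0 < N" and e: "0 < e"
    and c: "c \<notin> osc_event m N e True" "c \<notin> osc_event m N e False"
  shows "\<bar>h (walk_path N True c) (walk_half N c) - block_functional m h (\<lambda>lb. block_sum m N lb c)\<bar> \<le> L * e"
  unfolding block_functional_def
proof (rule unif_lip2D[OF h])
  fix x :: real assume x: "x \<in> {0..1}"
  let ?s = "\<lambda>b. step_path m (\<lambda>l. \<Sum>i<l. block_sum m N (i, b) c) x"
  note T = walk_path_approx[OF m c(1) e x] and F = walk_path_approx[OF m c(2) e x]
  show "\<bar>walk_path N True c x - ?s True\<bar> \<le> e" by (rule T)
  have "walk_half N c x = (walk_path N True c x - walk_path N False c x) / 2"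
    using x by (simp add: walk_half_def walk_path_def step_path_def diff_divide_distrib)
  moreover have "step_path m (\<lambda>i. \<Sum>l<i. (block_sum m N (l, True) c - block_sum m N (l, False) c) / 2) x = (?s True - ?s False) / 2"
    using x by (simp add: step_path_def sum_subtractf flip: sum_divide_distrib)
  ultimately show "\<bar>walk_half N c x - step_path m (\<lambda>i. \<Sum>l<i. (block_sum m N (l, True) c - block_sum m N (l, False) c) / 2) x\<bar> \<le> e"
    using T F by (simp add: abs_le_iff)
qed (simp_all add: walk_path_def walk_half_def step_path_cadlag)

text \<open>An independent copy of \<open>B\<close> need not exist on \<open>M\<close> itself, so
  both copies are realised on the product of \<open>M\<close> with itself.\<close>

definition pair_sum_process :: "(real \<Rightarrow> 'a \<Rightarrow> real) \<Rightarrow> real \<Rightarrow> 'a \<times> 'a \<Rightarrow> real" where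
  "pair_sum_process B x z = B x (fst z) + B x (snd z)"

definition pair_snd_process :: "(real \<Rightarrow> 'a \<Rightarrow> real) \<Rightarrow> real \<Rightarrow> 'a \<times> 'a \<Rightarrow> real" where
  "pair_snd_process B x z = B x (snd z)"

lemma pair_processes_continuous:
  assumes "continuous_process M B"
  shows "continuous_process (M \<Otimes>\<^sub>M M) (pair_sum_process B)" "continuous_process (M \<Otimes>\<^sub>M M) (pair_snd_process B)"
proof -
  let ?MM = "M \<Otimes>\<^sub>M M"
  have m: "B x \<in> borel_measurable M" if "x \<in> {0..1}" for x using assms that unfolding continuous_process_def by blast
  have c: "continuous_on {0..1} (\<lambda>x. B x \<omega>)" if "\<omega> \<in> space M" for \<omega> using assms that unfolding continuous_process_def by blast
  have m': "(\<lambda>z. B x (fst z)) \<in> borel_measurable ?MM" "(\<lambda>z. B x (snd z)) \<in> borel_measurable ?MM" if "x \<in> {0..1}" for x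
    using measurable_compose[OF measurable_fst m[OF that]] measurable_compose[OF measurable_snd m[OF that]] by auto
  show "continuous_process ?MM (pair_sum_process B)" "continuous_process ?MM (pair_snd_process B)"
    unfolding continuous_process_def pair_sum_process_def pair_snd_process_def
    using m' c by (auto simp: space_pair_measure intro!: continuous_intros)
qed

lemma block_functional_limit:
  assumes M: "prob_space M" and B: "brownian_motion M (1 / 2) B" and m: "0 < m"
    and h: "unif_lip2 L h" and C: "\<And>f g. f \<in> cadlag01 \<Longrightarrow> g \<in> cadlag01 \<Longrightarrow> \<bar>h f g\<bar> \<le> C"
  shows "(\<lambda>N. coin_expectation N (\<lambda>c. block_functional m h (\<lambda>lb. block_sum m N lb c)))
    \<longlonglongrightarrow> (\<integral>z. h (disc m (trajectory (pair_sum_process B) z)) (disc m (trajectory (pair_snd_process B) z)) \<partial>(M \<Otimes>\<^sub>M M))"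
proof -
  let ?MM = "M \<Otimes>\<^sub>M M"
  let ?Y = "trajectory (pair_sum_process B)" and ?Z = "trajectory (pair_snd_process B)"
  let ?I = "{..<m} \<times> (UNIV :: bool set)"
  let ?\<nu> = "centred_normal (sqrt (1 / real m))"
  let ?\<Delta> = "bm_increment m B"
  interpret M: prob_space M by (rule M)
  interpret MM: pair_prob_space M M ..
  have cp: "continuous_process M B" and B0: "AE \<omega> in M. B 0 \<omega> = 0" using B unfolding brownian_motion_def by blast+
  have cont: "continuous_on UNIV (block_functional m h)" by (rule block_functional_cont[OF h])
  have bd: "\<bar>block_functional m h v\<bar> \<le> C" for v unfolding block_functional_def by (intro C step_path_cadlag)
  have fin: "finite ?I" by (intro finite_cartesian_product) auto
  have ne: "?I \<noteq> {}" using m by auto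
  have "(\<lambda>N. coin_expectation N (\<lambda>c. block_functional m h (\<lambda>lb\<in>?I. block_sum m N lb c)))
      \<longlonglongrightarrow> integral\<^sup>L (PiM ?I (\<lambda>_. ?\<nu>)) (block_functional m h)"
  proof (rule indep_weak_conv[OF fin ne _ _ _ _ cont bd])
    show "prob_space (measure_pmf (coins N))" for N by (rule measure_pmf.prob_space_axioms)
    show "prob_space.indep_vars (measure_pmf (coins N)) (\<lambda>_. borel) (block_sum m N) ?I" for N
      by (rule block_sum_indep[OF m])
    show "weak_conv_m (\<lambda>N. distr (measure_pmf (coins N)) borel (block_sum m N lb)) ?\<nu>" if "lb \<in> ?I" for lb
      using block_sum_weak_conv[OF m, of "fst lb" "snd lb"] that by auto
    show "real_distribution ?\<nu>" by (rule real_distribution_centred_normal) (use m in simp)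
  qed
  moreover have "integral\<^sup>L (PiM ?I (\<lambda>_. ?\<nu>)) (block_functional m h)
      = (\<integral>z. h (disc m (?Y z)) (disc m (?Z z)) \<partial>?MM)"
  proof -
    let ?V = "\<lambda>z. \<lambda>lb\<in>?I. rotated ?\<Delta> lb z"
    have s: "0 < sqrt (1 / 2 / real m)" using m by simp
    \<comment> \<open>An increment of \<open>B\<close> has variance \<open>1 / (2 * m)\<close>; sums
      and differences of two independent copies have variance \<open>1 / m\<close>, that of a block
      of fair signs.\<close>
    have "sqrt 2 * sqrt (1 / 2 / real m) = sqrt (1 / real m)" by (simp flip: real_sqrt_mult)
    with rotated_increments[OF M bm_increment_measurable[OF cp] s bm_increments_law[OF M B m]]
    have law: "distr ?MM (PiM ?I (\<lambda>_. borel)) ?V = PiM ?I (\<lambda>_. ?\<nu>)" by simp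
    have \<Delta>m: "(\<lambda>z. ?\<Delta> l (fst z)) \<in> borel_measurable ?MM" "(\<lambda>z. ?\<Delta> l (snd z)) \<in> borel_measurable ?MM" if "l < m" for l
      using measurable_compose[OF measurable_fst bm_increment_measurable[OF cp that]]
        measurable_compose[OF measurable_snd bm_increment_measurable[OF cp that]] by auto
    have Vm: "?V \<in> measurable ?MM (PiM ?I (\<lambda>_. borel))"
      by (rule measurable_restrict) (use \<Delta>m in \<open>auto simp: rotated_def\<close>)
    have bm: "block_functional m h \<in> borel_measurable (PiM ?I (\<lambda>_. borel))"
      by (rule PiM_borel_continuous_measurable[OF cont])
    have "integral\<^sup>L (PiM ?I (\<lambda>_. ?\<nu>)) (block_functional m h) = (\<integral>z. block_functional m h (?V z) \<partial>?MM)"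
      unfolding law[symmetric] by (rule integral_distr[OF Vm bm])
    also have "\<dots> = (\<integral>z. h (disc m (?Y z)) (disc m (?Z z)) \<partial>?MM)"
    proof (rule integral_cong_AE)
      show "(\<lambda>z. block_functional m h (?V z)) \<in> borel_measurable ?MM"
        by (rule measurable_compose[OF Vm bm])
      have tel: "(\<Sum>l<i. ?\<Delta> l \<omega>) = B (real i / real m) \<omega> - B 0 \<omega>" for i \<omega>
        unfolding bm_increment_def by (induction i) auto
      \<comment> \<open>\<open>B 0 = 0\<close> holds only almost surely; where it holds, summed
        increments return the values of the path.\<close>
      have dp: "disc m (?Y z) = step_path m (\<lambda>i. \<Sum>l<i. rotated ?\<Delta> (l, True) z)"
        "disc m (?Z z) = step_path m (\<lambda>i. \<Sum>l<i. (rotated ?\<Delta> (l, True) z - rotated ?\<Delta> (l, False) z) / 2)"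
        if "B 0 (fst z) = 0" "B 0 (snd z) = 0" for z
        unfolding disc_def rotated_def using that m
        by (intro step_path_cong; simp add: trajectory_def pair_sum_process_def pair_snd_process_def sum.distrib tel)+
      have B0m: "B 0 \<in> borel_measurable M" using cp unfolding continuous_process_def by simp
      note [measurable] = measurable_compose[OF measurable_fst B0m] measurable_compose[OF measurable_snd B0m]
      have "AE z in ?MM. B 0 (fst z) = 0"
        by (rule MM.AE_pair_measure) (use B0 in \<open>simp_all, measurable?\<close>)
      moreover have "AE z in ?MM. B 0 (snd z) = 0"
        by (rule MM.AE_pair_measure) (use B0 in \<open>simp_all, measurable?\<close>)
      ultimately show "AE z in ?MM. block_functional m h (?V z)
          = h (disc m (?Y z)) (disc m (?Z z))"
        by eventually_elim (simp only: block_functional_restrict, simp add: block_functional_def dp)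
      show "(\<lambda>z. h (disc m (?Y z)) (disc m (?Z z))) \<in> borel_measurable ?MM"
        by (rule disc_functional_measurable[OF h pair_processes_continuous[OF cp]])
    qed
    finally show ?thesis .
  qed
  ultimately show ?thesis unfolding block_functional_restrict by simp
qed

text \<open>The grid \<open>m\<close> is fixed before \<open>N\<close> grows. The distance from walk
  to blocks is controlled for all \<open>N \<ge> m\<close> by the maximal inequality, that from
  blocks to Brownian increments by the limit at this fixed \<open>m\<close>, and that from sampled
  to full Brownian path by continuity of trajectories.\<close>

lemma walk_functional_limit:
  assumes M: "prob_space M" and B: "brownian_motion M (1 / 2) B"
    and h: "unif_lip2 L h" and L: "0 \<le> L" and C: "\<And>f g. f \<in> cadlag01 \<Longrightarrow> g \<in> cadlag01 \<Longrightarrow> \<bar>h f g\<bar> \<le> C"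
  shows "(\<lambda>N. coin_expectation N (\<lambda>c. h (walk_path N True c) (walk_half N c)))
    \<longlonglongrightarrow> (\<integral>z. h (trajectory (pair_sum_process B) z) (trajectory (pair_snd_process B) z) \<partial>(M \<Otimes>\<^sub>M M))"
proof (rule tendstoI)
  let ?MM = "M \<Otimes>\<^sub>M M"
  let ?Y = "trajectory (pair_sum_process B)" and ?Z = "trajectory (pair_snd_process B)"
  fix r :: real assume r: "0 < r"
  let ?E = "\<lambda>N. coin_expectation N (\<lambda>c. h (walk_path N True c) (walk_half N c))"
  let ?D = "\<lambda>m N. coin_expectation N (\<lambda>c. block_functional m h (\<lambda>lb. block_sum m N lb c))"
  let ?l = "\<integral>z. h (?Y z) (?Z z) \<partial>?MM"
  let ?d = "\<lambda>m. \<integral>z. h (disc m (?Y z)) (disc m (?Z z)) \<partial>?MM"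
  interpret M: prob_space M by (rule M)
  interpret MM: pair_prob_space M M ..
  have cp: "continuous_process M B" using B unfolding brownian_motion_def by blast
  note cps = pair_processes_continuous[OF cp]
  have C0: "0 \<le> C" using C[OF step_path_cadlag step_path_cadlag] by (meson abs_ge_zero order_trans)
  have "?d \<longlonglongrightarrow> ?l"
  proof (rule integral_dominated_convergence[where w="\<lambda>_. C"])
    show "(\<lambda>z. h (?Y z) (?Z z)) \<in> borel_measurable ?MM"
      by (rule functional_measurable[OF h cps])
    show "(\<lambda>z. h (disc m (?Y z)) (disc m (?Z z))) \<in> borel_measurable ?MM" for m
      by (rule disc_functional_measurable[OF h cps])
    show "integrable ?MM (\<lambda>_. C)" by simp
    show "AE z in ?MM. norm (h (disc m (?Y z)) (disc m (?Z z))) \<le> C" for m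
      using C disc_cadlag by simp
    show "AE z in ?MM. (\<lambda>m. h (disc m (?Y z)) (disc m (?Z z)))
        \<longlonglongrightarrow> h (?Y z) (?Z z)"
      by (rule AE_I2, rule disc_functional_tendsto[OF h trajectory_ext trajectory_cont[OF cps(1)] trajectory_ext trajectory_cont[OF cps(2)]])
  qed
  then have ev1: "eventually (\<lambda>m. dist (?d m) ?l < r / 4) sequentially" using r by (intro tendstoD) auto
  define e where "e = r / (4 * (L + 1))"
  have e: "0 < e" using r L unfolding e_def by simp
  have "4 * (L + 1) * e = r" unfolding e_def using L by simp
  then have Le: "4 * (L * e) \<le> r" using e by (simp add: algebra_simps)
  \<comment> \<open>48 is \<open>2 * 2 * 12\<close>: off the good event the functional changes by at
    most \<open>2 * C\<close>, and each of the two rows contributes \<open>12 / (m * e ^ 4)\<close>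
    to the probability.\<close>
  have "(\<lambda>m. 48 * C / (real m * e ^ 4)) \<longlonglongrightarrow> 0" using e by real_asymp
  then have ev2: "eventually (\<lambda>m. 48 * C / (real m * e ^ 4) < r / 4) sequentially" using r by (intro order_tendstoD(2)) auto
  obtain m where m: "dist (?d m) ?l < r / 4" "48 * C / (real m * e ^ 4) < r / 4" "0 < m"
    using eventually_happens'[OF sequentially_bot eventually_conj[OF ev1 eventually_conj[OF ev2 eventually_gt_at_top[of 0]]]] by blast
  have approx: "\<bar>?E N - ?D m N\<bar> \<le> L * e + 48 * C / (real m * e ^ 4)" if N: "m \<le> N" for N
  proof -
    let ?O = "osc_event m N e True \<union> osc_event m N e False"
    let ?X = "\<lambda>c. h (walk_path N True c) (walk_half N c)" and ?W = "\<lambda>c. block_functional m h (\<lambda>lb. block_sum m N lb c)"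
    have pt: "\<bar>?X c - ?W c\<bar> \<le> L * e + 2 * C * indicator ?O c" for c
    proof (cases "c \<in> ?O")
      case True
      have "\<bar>?X c\<bar> \<le> C" "\<bar>?W c\<bar> \<le> C"
        unfolding block_functional_def walk_path_def walk_half_def by (intro C step_path_cadlag)+
      moreover have "0 \<le> L * e" using L e by simp
      ultimately show ?thesis using True by simp
    next
      case False
      then show ?thesis using walk_functional_approx[OF h m(3) _ e, of N c] N m(3) by auto
    qed
    have "\<bar>?E N - ?D m N\<bar> = \<bar>coin_expectation N (\<lambda>c. ?X c - ?W c)\<bar>"
      by (simp add: integrable_coins)
    also have "\<dots> \<le> coin_expectation N (\<lambda>c. \<bar>?X c - ?W c\<bar>)"
      by (rule integral_abs_bound)
    also have "\<dots> \<le> coin_expectation N (\<lambda>c. L * e + 2 * C * indicator ?O c)"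
      by (rule integral_mono[OF integrable_coins integrable_coins pt])
    also have "\<dots> = L * e + 2 * C * coin_prob N ?O"
      by (simp add: integrable_coins)
    also have "\<dots> \<le> L * e + 2 * C * (12 / (real m * e ^ 4) + 12 / (real m * e ^ 4))"
    proof -
      have "coin_prob N ?O \<le> coin_prob N (osc_event m N e True) + coin_prob N (osc_event m N e False)"
        by (rule measure_Un_le) auto
      also have "\<dots> \<le> 12 / (real m * e ^ 4) + 12 / (real m * e ^ 4)"
        by (intro add_mono osc_event_prob[OF m(3) N e])
      finally show ?thesis using C0 by (intro add_left_mono mult_left_mono) auto
    qed
    finally show ?thesis by simp
  qed
  have "eventually (\<lambda>N. dist (?D m N) (?d m) < r / 4) sequentially"
    using block_functional_limit[OF M B m(3) h C] r by (intro tendstoD) auto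
  then show "eventually (\<lambda>N. dist (?E N) ?l < r) sequentially"
    using eventually_ge_at_top[of m]
  proof eventually_elim
    case (elim N)
    then show ?case using approx[of N] m(1,2) Le unfolding dist_real_def by linarith
  qed
qed

text \<open>The exponent, unlike the tilt itself, is globally Lipschitz for the uniform
  distance.\<close>

definition log_tilt :: "real \<Rightarrow> real \<Rightarrow> (real \<Rightarrow> real) \<Rightarrow> real" where
  "log_tilt u v w = (u + v) * (INF x\<in>{0..1}. w x) - v * w 1"

lemma tilt_log_tilt: "tilt u v w = exp (log_tilt u v w)"
  by (simp add: tilt_def log_tilt_def)

lemma log_tilt_lip:
  assumes "f \<in> cadlag01" "g \<in> cadlag01" and e: "\<And>x. x \<in> {0..1} \<Longrightarrow> \<bar>f x - g x\<bar> \<le> e"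
  shows "\<bar>log_tilt u v f - log_tilt u v g\<bar> \<le> (\<bar>u + v\<bar> + \<bar>v\<bar>) * e"
proof -
  have bdd: "bdd_below (w ` {0..1})" if w: "w \<in> cadlag01" for w
  proof -
    obtain K where K: "\<forall>t\<in>{0..1}. \<bar>w t\<bar> \<le> K" using cadlag01_bounded[OF w] by blast
    show ?thesis by (rule bdd_belowI2[of _ "- K"]) (use K in \<open>fastforce simp: abs_le_iff\<close>)
  qed
  have inf: "(INF x\<in>{0..1}. f x) - e \<le> (INF x\<in>{0..1}. g x)"
    if "f \<in> cadlag01" "\<And>x. x \<in> {0..1} \<Longrightarrow> \<bar>f x - g x\<bar> \<le> e" for f g :: "real \<Rightarrow> real"
  proof (rule cINF_greatest)
    fix x :: real assume x: "x \<in> {0..1}"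
    have "(INF x\<in>{0..1}. f x) \<le> f x" by (rule cINF_lower[OF bdd[OF that(1)] x])
    then show "(INF x\<in>{0..1}. f x) - e \<le> g x" using that(2)[OF x] by linarith
  qed simp
  have i: "\<bar>(INF x\<in>{0..1}. f x) - (INF x\<in>{0..1}. g x)\<bar> \<le> e"
    using inf[OF assms(1) e] inf[of g f] assms(2) e by (auto simp: abs_le_iff abs_minus_commute)
  have "log_tilt u v f - log_tilt u v g = (u + v) * ((INF x\<in>{0..1}. f x) - (INF x\<in>{0..1}. g x)) - v * (f 1 - g 1)"
    by (simp add: log_tilt_def algebra_simps)
  also have "\<bar>\<dots>\<bar> \<le> \<bar>u + v\<bar> * \<bar>(INF x\<in>{0..1}. f x) - (INF x\<in>{0..1}. g x)\<bar> + \<bar>v\<bar> * \<bar>f 1 - g 1\<bar>"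
    unfolding abs_mult[symmetric] by linarith
  also have "\<dots> \<le> \<bar>u + v\<bar> * e + \<bar>v\<bar> * e"
    using i e[of 1] by (intro add_mono mult_left_mono) auto
  finally show ?thesis by (simp add: algebra_simps)
qed

lemma log_tilt_unif_lip2: "unif_lip2 (\<bar>u + v\<bar> + \<bar>v\<bar>) (\<lambda>f g. log_tilt u v g)"
  unfolding unif_lip2_def using log_tilt_lip by blast

text \<open>Where the truncation is inactive the slope of \<open>exp\<close> is its value, at most
  \<open>R\<close>; elsewhere the function is constant.\<close>

lemma min_exp_lip:
  assumes R: "0 < R"
  shows "\<bar>min (exp a) R - min (exp b) R\<bar> \<le> R * \<bar>a - b :: real\<bar>"
proof -
  have *: "min (exp b) R - min (exp a) R \<le> R * (b - a)" if ab: "a \<le> b" for a b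
  proof (cases "R \<le> exp a")
    case True
    then have "R \<le> exp b" using ab by (meson exp_le_cancel_iff order_trans)
    then show ?thesis using True R ab by (simp add: min_absorb2)
  next
    case False
    \<comment> \<open>The truncated function stops growing at \<open>ln R\<close>, so its increment
      up to \<open>b\<close> equals that of \<open>exp\<close> up to \<open>c\<close>, and the
      tangent at \<open>c\<close> bounds it.\<close>
    define c where "c = min b (ln R)"
    have ec: "exp c = min (exp b) R" unfolding c_def using R by (simp add: min_def exp_le_cancel_iff) (metis exp_le_cancel_iff exp_ln)
    have "a < ln R" using False R by (metis exp_less_cancel_iff exp_ln not_le)
    then have ac: "a \<le> c" unfolding c_def using ab by simp
    have "exp c * (1 + (a - c)) \<le> exp c * exp (a - c)" by (intro mult_left_mono exp_ge_add_one_self) auto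
    also have "\<dots> = exp a" by (simp add: exp_add[symmetric])
    finally have "exp c - exp a \<le> exp c * (c - a)" by (simp add: algebra_simps)
    also have "\<dots> \<le> R * (b - a)" using ac ec R unfolding c_def by (intro mult_mono) auto
    finally show ?thesis using ec False by simp
  qed
  have m: "min (exp a) R \<le> min (exp b) R" if "a \<le> b" for a b :: real
    using that by (intro min.mono) auto
  show ?thesis
    using *[of a b] *[of b a] m[of a b] m[of b a] by (cases "a \<le> b") auto
qed

text \<open>The constant is that of a product of bounded Lipschitz functions: \<open>F\<close> has
  bound \<open>C\<close> and constant \<open>k\<close>, the truncated tilt has bound
  \<open>R\<close> and constant \<open>R * (\<bar>u + v\<bar> + \<bar>v\<bar>)\<close>.\<close>

lemma truncated_functional_lip:
  assumes F: "sk_lip k F" and C: "\<And>f. f \<in> cadlag01 \<Longrightarrow> \<bar>F f\<bar> \<le> C" and R: "0 < R"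
  shows "unif_lip2 (k * R + C * (R * (\<bar>u + v\<bar> + \<bar>v\<bar>))) (\<lambda>f g. F f * min (tilt u v g) R)"
  unfolding unif_lip2_def
proof (intro ballI allI impI)
  fix f f' g g' and e :: real
  assume c: "f \<in> cadlag01" "f' \<in> cadlag01" "g \<in> cadlag01" "g' \<in> cadlag01"
    and e: "(\<forall>x\<in>{0..1}. \<bar>f x - f' x\<bar> \<le> e) \<and> (\<forall>x\<in>{0..1}. \<bar>g x - g' x\<bar> \<le> e)"
  let ?m = "\<lambda>g. min (tilt u v g) R"
  have k: "0 \<le> k" using F unfolding sk_lip_def by blast
  have "0 \<le> \<bar>F f'\<bar>" by simp
  then have C0: "0 \<le> C" using C[OF c(2)] by linarith
  have "skorokhod_dist f f' \<le> e" using skorokhod_dist_le[OF c(1,2)] e by blast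
  then have Fe: "\<bar>F f - F f'\<bar> \<le> k * e"
    using F c k mult_left_mono unfolding sk_lip_def by (meson order_trans)
  have "\<bar>?m g - ?m g'\<bar> \<le> R * \<bar>log_tilt u v g - log_tilt u v g'\<bar>"
    unfolding tilt_log_tilt by (rule min_exp_lip[OF R])
  also have "\<dots> \<le> R * ((\<bar>u + v\<bar> + \<bar>v\<bar>) * e)"
    using R log_tilt_lip[OF c(3,4)] e by (intro mult_left_mono) auto
  finally have me: "\<bar>?m g - ?m g'\<bar> \<le> R * ((\<bar>u + v\<bar> + \<bar>v\<bar>) * e)" .
  have mR: "\<bar>?m g\<bar> \<le> R" using R by (simp add: tilt_def abs_if min_def)
  have "F f * ?m g - F f' * ?m g' = (F f - F f') * ?m g + F f' * (?m g - ?m g')" by (simp add: algebra_simps)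
  also have "\<bar>\<dots>\<bar> \<le> \<bar>F f - F f'\<bar> * \<bar>?m g\<bar> + \<bar>F f'\<bar> * \<bar>?m g - ?m g'\<bar>"
    unfolding abs_mult[symmetric] by (rule abs_triangle_ineq)
  also have "\<dots> \<le> (k * e) * R + C * (R * ((\<bar>u + v\<bar> + \<bar>v\<bar>) * e))"
    using Fe mR me C[OF c(2)] C0 R by (intro add_mono mult_mono) auto
  finally show "\<bar>F f * ?m g - F f' * ?m g'\<bar> \<le> (k * R + C * (R * (\<bar>u + v\<bar> + \<bar>v\<bar>))) * e"
    by (simp add: algebra_simps)
qed

section \<open>Stationary expectations as ratios of coin expectations\<close>

definition height_path :: "nat \<Rightarrow> (nat \<Rightarrow> nat) \<Rightarrow> real \<Rightarrow> real" where
  "height_path N \<tau> = step_path N (\<lambda>k. (2 * real (tasep_height \<tau> k) - real k) / sqrt (real N))"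

lemma trajectory_height_path:
  "trajectory (\<lambda>x \<tau>. 1 / sqrt (real N) *
     (2 * real (tasep_height \<tau> (nat \<lfloor>x * real N\<rfloor>)) - real_of_int \<lfloor>real N * x\<rfloor>)) \<tau> = height_path N \<tau>"
  unfolding trajectory_def height_path_def step_path_def
  by (rule restrict_ext) (simp add: mult.commute)

lemma coin_paths:
  "height_path N (coin_row N True c) = walk_path N True c"
  "diff_path N (coin_row N True c) (coin_row N False c) = walk_half N c"
proof -
  have w: "coin_walk b c k = 2 * real (tasep_height (coin_row N b c) k) - real k" if "k \<le> N" for k b
    unfolding coin_walk_def tasep_height_def coin_row_def using that
    by (simp add: sum_subtractf sum_distrib_left)
  show "height_path N (coin_row N True c) = walk_path N True c"
    unfolding height_path_def walk_path_def by (intro step_path_cong) (simp add: w)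
  show "diff_path N (coin_row N True c) (coin_row N False c) = walk_half N c"
    unfolding diff_path_def walk_half_def
  proof (rule step_path_cong)
    fix k assume "k \<le> N"
    then have "(coin_walk True c k - coin_walk False c k) / 2
        = real (tasep_height (coin_row N True c) k) - real (tasep_height (coin_row N False c) k)"
      by (simp only: w) (simp add: field_simps)
    then show "(real (tasep_height (coin_row N True c) k) - real (tasep_height (coin_row N False c) k)) / sqrt (real N)
        = (coin_walk True c k - coin_walk False c k) / 2 / sqrt (real N)"
      by (simp only:)
  qed
qed

lemma expectation_coins_paths:
  "coin_expectation N (\<lambda>c. F (walk_path N True c) * tilt u v (walk_half N c))
    = (\<Sum>\<tau>\<in>tasep_configs N. \<Sum>\<xi>\<in>tasep_configs N. F (height_path N \<tau>) * tilt u v (diff_path N \<tau> \<xi>)) / 4 ^ N"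
  unfolding tasep_configs_def coin_paths[symmetric] by (rule expectation_coins)

lemma stationary_expectation:
  assumes N: "1 \<le> N"
    and st: "tasep_stationary N (1 / (1 + exp (- u / sqrt (real N)))) (1 / (1 + exp (- v / sqrt (real N)))) p"
  shows "measure_pmf.expectation p (\<lambda>\<tau>. F (height_path N \<tau>))
    = coin_expectation N (\<lambda>c. F (walk_path N True c) * tilt u v (walk_half N c))
      / coin_expectation N (\<lambda>c. tilt u v (walk_half N c))"
proof -
  let ?w = "cweight N (exp (- u / sqrt (real N))) (exp (- v / sqrt (real N)))" and ?C = "tasep_configs N"
  have "set_pmf p \<subseteq> ?C" using st unfolding tasep_stationary_def by blast
  then have "measure_pmf.expectation p (\<lambda>\<tau>. F (height_path N \<tau>)) = (\<Sum>\<tau>\<in>?C. pmf p \<tau> * F (height_path N \<tau>))"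
    by (rule expectation_configs)
  also have "\<dots> = (\<Sum>\<tau>\<in>?C. ?w \<tau> / (\<Sum>\<sigma>\<in>?C. ?w \<sigma>) * F (height_path N \<tau>))"
    using tasep_stationary_eq[OF N _ _ st] by (intro sum.cong) auto
  also have "\<dots> = (\<Sum>\<tau>\<in>?C. ?w \<tau> * F (height_path N \<tau>)) / (\<Sum>\<sigma>\<in>?C. ?w \<sigma>)"
    by (simp add: sum_divide_distrib)
  also have "\<dots> = (\<Sum>\<tau>\<in>?C. \<Sum>\<xi>\<in>?C. F (height_path N \<tau>) * tilt u v (diff_path N \<tau> \<xi>))
      / (\<Sum>\<tau>\<in>?C. \<Sum>\<xi>\<in>?C. tilt u v (diff_path N \<tau> \<xi>))"
  proof (intro arg_cong2[where f="(/)"] sum.cong refl)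
    fix \<tau> assume \<tau>: "\<tau> \<in> ?C"
    show "?w \<tau> = (\<Sum>\<xi>\<in>?C. tilt u v (diff_path N \<tau> \<xi>))" by (rule cweight_tilt[OF \<tau>])
    then show "?w \<tau> * F (height_path N \<tau>) = (\<Sum>\<xi>\<in>?C. F (height_path N \<tau>) * tilt u v (diff_path N \<tau> \<xi>))"
      by (simp only: sum_distrib_left[symmetric] mult.commute)
  qed
  also have "\<dots> = coin_expectation N (\<lambda>c. F (walk_path N True c) * tilt u v (walk_half N c))
      / coin_expectation N (\<lambda>c. tilt u v (walk_half N c))"
    using expectation_coins_paths[of N F u v] expectation_coins_paths[of N "\<lambda>_. 1" u v] by simp
  finally show ?thesis .
qed

text \<open>For the truncated tilt the limit is known. The truncation error along the walks is at
  most \<open>C * K / R\<close>, uniformly in \<open>N\<close>, by the second-moment bound; in the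
  limit it vanishes by dominated convergence, as the tilt is integrable.\<close>

lemma tilted_limit:
  assumes M: "prob_space M" and B: "brownian_motion M (1 / 2) B"
    and int: "integrable (M \<Otimes>\<^sub>M M) (\<lambda>z. tilt u v (trajectory (pair_snd_process B) z))"
    and F: "sk_lip k F" and C: "\<And>f. f \<in> cadlag01 \<Longrightarrow> \<bar>F f\<bar> \<le> C"
  shows "(\<lambda>N. coin_expectation N (\<lambda>c. F (walk_path N True c) * tilt u v (walk_half N c)))
    \<longlonglongrightarrow> (\<integral>z. F (trajectory (pair_sum_process B) z) * tilt u v (trajectory (pair_snd_process B) z) \<partial>(M \<Otimes>\<^sub>M M))"
    (is "?E \<longlonglongrightarrow> ?l")
proof (rule tendstoI)
  let ?MM = "M \<Otimes>\<^sub>M M"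
  let ?F = "\<lambda>z. F (trajectory (pair_sum_process B) z)" and ?t = "\<lambda>z. tilt u v (trajectory (pair_snd_process B) z)"
  fix r :: real assume r: "0 < r"
  let ?ER = "\<lambda>R N. coin_expectation N (\<lambda>c. F (walk_path N True c) * min (tilt u v (walk_half N c)) R)"
  let ?lR = "\<lambda>R. \<integral>z. ?F z * min (?t z) R \<partial>?MM"
  have k: "0 \<le> k" using F unfolding sk_lip_def by blast
  have C0: "0 \<le> C" using C[OF step_path_cadlag] by (meson abs_ge_zero order_trans)
  interpret M: prob_space M by (rule M)
  interpret MM: pair_prob_space M M ..
  have cp: "continuous_process M B" using B unfolding brownian_motion_def by blast
  note cps = pair_processes_continuous[OF cp]
  have Fm: "(\<lambda>z. ?F z) \<in> borel_measurable ?MM"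
    by (rule functional_measurable[OF sk_lip_unif_lip2[OF F] cps])
  have tm: "(\<lambda>z. ?t z) \<in> borel_measurable ?MM"
    using int by simp
  have tpos: "0 < tilt u v w" for w by (simp add: tilt_def)
  obtain K where K: "\<And>N. (\<Sum>\<tau>\<in>tasep_configs N. \<Sum>\<xi>\<in>tasep_configs N. tilt (2 * u) (2 * v) (diff_path N \<tau> \<xi>)) / 4 ^ N \<le> K"
    using sum_tilt_le[of "2 * u" "2 * v"] by blast
  have K': "coin_expectation N (\<lambda>c. (tilt u v (walk_half N c))\<^sup>2) \<le> K" for N
  proof -
    \<comment> \<open>The square of the tilt is again a tilt, so its expectation is a partition
      function at doubled parameters.\<close>
    have sq: "(tilt u v w)\<^sup>2 = tilt (2 * u) (2 * v) w" for w
      by (simp add: tilt_def power2_eq_square exp_add[symmetric] algebra_simps)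
    show ?thesis
      unfolding sq using expectation_coins_paths[of N "\<lambda>_. 1" "2 * u" "2 * v"] K[of N] by simp
  qed
  have tr: "t - min t R \<le> t\<^sup>2 / R" if "0 < t" "0 < R" for t R :: real
  proof (cases "t \<le> R")
    case False
    then have "t * R \<le> t * t" using that by (intro mult_left_mono) auto
    then have "t \<le> t\<^sup>2 / R" using that by (simp add: field_simps power2_eq_square)
    then show ?thesis using False that by simp
  qed (use that in simp)
  have pre: "\<bar>?E N - ?ER R N\<bar> \<le> C * (K / R)" if R: "0 < R" for N R
  proof -
    let ?s = "\<lambda>c. tilt u v (walk_half N c)"
    have "\<bar>?E N - ?ER R N\<bar> = \<bar>coin_expectation N (\<lambda>c. F (walk_path N True c) * (?s c - min (?s c) R))\<bar>"
      by (simp add: integrable_coins right_diff_distrib)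
    also have "\<dots> \<le> coin_expectation N (\<lambda>c. \<bar>F (walk_path N True c) * (?s c - min (?s c) R)\<bar>)"
      by (rule integral_abs_bound)
    also have "\<dots> \<le> coin_expectation N (\<lambda>c. C * ((?s c)\<^sup>2 / R))"
    proof (rule integral_mono[OF integrable_coins integrable_coins])
      fix c
      have "\<bar>F (walk_path N True c)\<bar> \<le> C" unfolding walk_path_def by (intro C step_path_cadlag)
      then show "\<bar>F (walk_path N True c) * (?s c - min (?s c) R)\<bar> \<le> C * ((?s c)\<^sup>2 / R)"
        using tr[OF tpos R, of "walk_half N c"] C0 unfolding abs_mult by (intro mult_mono) auto
    qed
    also have "\<dots> = C * (coin_expectation N (\<lambda>c. (?s c)\<^sup>2) / R)"
      by (simp add: integrable_coins)
    also have "\<dots> \<le> C * (K / R)"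
      using K'[of N] C0 R by (intro mult_left_mono divide_right_mono) auto
    finally show ?thesis .
  qed
  have "(\<lambda>n. ?lR (real n)) \<longlonglongrightarrow> ?l"
  proof (rule integral_dominated_convergence[where w="\<lambda>z. C * ?t z"])
    show "integrable ?MM (\<lambda>z. C * ?t z)" using int by simp
    show "(\<lambda>z. ?F z * ?t z) \<in> borel_measurable ?MM"
      "(\<lambda>z. ?F z * min (?t z) (real n)) \<in> borel_measurable ?MM" for n
      using Fm tm by simp_all
    show "AE z in ?MM. (\<lambda>n. ?F z * min (?t z) (real n))
        \<longlonglongrightarrow> ?F z * ?t z"
    proof (rule AE_I2)
      fix z
      have "eventually (\<lambda>n. ?t z = min (?t z) (real n)) sequentially"
        using eventually_ge_at_top[of "nat \<lceil>?t z\<rceil>"] by eventually_elim (simp add: nat_le_iff ceiling_le_iff)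
      then have "(\<lambda>n. min (?t z) (real n)) \<longlonglongrightarrow> ?t z"
        by (rule Lim_transform_eventually[OF tendsto_const])
      then show "(\<lambda>n. ?F z * min (?t z) (real n)) \<longlonglongrightarrow> ?F z * ?t z"
        by (rule tendsto_mult_left)
    qed
    show "AE z in ?MM. norm (?F z * min (?t z) (real n))
        \<le> C * ?t z" for n
    proof (rule AE_I2)
      fix z assume "z \<in> space ?MM"
      then have "\<bar>?F z\<bar> \<le> C" by (intro C trajectory_cadlag[OF cps(1)])
      then show "norm (?F z * min (?t z) (real n))
        \<le> C * ?t z"
        using tpos[of "trajectory (pair_snd_process B) z"] C0 unfolding real_norm_def abs_mult by (intro mult_mono) auto
    qed
  qed
  then have ev1: "eventually (\<lambda>n. dist (?lR (real n)) ?l < r / 3) sequentially" using r by (intro tendstoD) auto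
  have "(\<lambda>n. C * (K / real n)) \<longlonglongrightarrow> 0" by real_asymp
  then have ev2: "eventually (\<lambda>n. C * (K / real n) < r / 3) sequentially" using r by (intro order_tendstoD(2)) auto
  obtain n where n: "dist (?lR (real n)) ?l < r / 3" "C * (K / real n) < r / 3" "0 < n"
    using eventually_happens'[OF sequentially_bot eventually_conj[OF ev1 eventually_conj[OF ev2 eventually_gt_at_top[of 0]]]] by blast
  then have R: "0 < real n" by simp
  have "?ER (real n) \<longlonglongrightarrow> ?lR (real n)"
  proof (rule walk_functional_limit[OF M B truncated_functional_lip[OF F C R]])
    show "0 \<le> k * real n + C * (real n * (\<bar>u + v\<bar> + \<bar>v\<bar>))" using k C0 by simp
    fix f g assume f: "f \<in> cadlag01"
    have "\<bar>min (tilt u v g) (real n)\<bar> \<le> real n" using tpos[of g] by (simp add: abs_if)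
    then show "\<bar>F f * min (tilt u v g) (real n)\<bar> \<le> C * real n"
      using C[OF f] C0 unfolding abs_mult by (intro mult_mono) auto
  qed
  then have "eventually (\<lambda>N. dist (?ER (real n) N) (?lR (real n)) < r / 3) sequentially" using r by (intro tendstoD) auto
  then show "eventually (\<lambda>N. dist (?E N) ?l < r) sequentially"
  proof eventually_elim
    case (elim N)
    then show ?case using pre[OF R, of N] n(1,2) unfolding dist_real_def by linarith
  qed
qed

text \<open>Independence makes the joint law of \<open>B\<close> and \<open>X\<close> a product, and
  the density rewrites its second factor as a weighted copy of the law of \<open>B\<close>. The
  limit process is thus expressed by two independent copies of \<open>B\<close>, the form in which
  the walk limit arrives.\<close>

lemma trajectory_add_integral:
  fixes M :: "'a measure" and B X :: "real \<Rightarrow> 'a \<Rightarrow> real"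
  assumes M: "prob_space M" and B: "continuous_process M B" and X: "continuous_process M X"
    and indep: "prob_space.indep_var M (borel_of (mtopology_of C01)) (trajectory B)
                  (borel_of (mtopology_of C01)) (trajectory X)"
    and law_X: "law_on C01 M X = density (law_on C01 M B) (\<lambda>w. ennreal (g w))"
    and g: "g \<in> borel_measurable (borel_of (mtopology_of C01))" "\<And>w. 0 \<le> g w"
    and F: "sk_lip k F"
  shows "(\<integral>\<omega>. F (trajectory (\<lambda>x \<omega>. B x \<omega> + X x \<omega>) \<omega>) \<partial>M)
    = (\<integral>z. g (trajectory (pair_snd_process B) z) * F (trajectory (pair_sum_process B) z) \<partial>(M \<Otimes>\<^sub>M M))"
proof -
  let ?MM = "M \<Otimes>\<^sub>M M"
  let ?BB = "\<lambda>(x, y). (trajectory B x, trajectory B y)"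
  interpret prob_space M by (rule M)
  let ?S = "borel_of (mtopology_of C01)"
  let ?P = "law_on C01 M B"
  have tB: "trajectory B \<in> measurable M ?S" and tX: "trajectory X \<in> measurable M ?S"
    using indep by (auto dest: indep_var_rv1 indep_var_rv2)
  interpret P: prob_space ?P unfolding law_on_def by (rule prob_space_distr[OF tB])
  interpret PX: prob_space "law_on C01 M X" unfolding law_on_def by (rule prob_space_distr[OF tX])
  have sP: "sets ?P = sets ?S" by (simp add: law_on_def)
  \<comment> \<open>As a functional of the coordinate sum, a continuous process on the product of
    two path spaces, \<open>h\<close> is measurable by the general lemma on functionals.\<close>
  define h where "h = (\<lambda>ww. F (trajectory (\<lambda>x ww. fst ww x + snd ww x) ww))"
  have cp: "continuous_process (?S \<Otimes>\<^sub>M ?S) (\<lambda>x ww. fst ww x + snd ww x)"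
    unfolding continuous_process_def
  proof (intro conjI ballI)
    fix x :: real assume x: "x \<in> {0..1}"
    show "(\<lambda>ww. fst ww x + snd ww x) \<in> borel_measurable (?S \<Otimes>\<^sub>M ?S)"
      using measurable_compose[OF measurable_fst C01_eval_measurable[OF x]]
        measurable_compose[OF measurable_snd C01_eval_measurable[OF x]] by (rule borel_measurable_add)
  next
    fix ww assume "ww \<in> space (?S \<Otimes>\<^sub>M ?S)"
    then have "fst ww \<in> mspace C01" "snd ww \<in> mspace C01" by (auto simp: space_pair_measure)
    then show "continuous_on {0..1} (\<lambda>x. fst ww x + snd ww x)"
      by (intro continuous_on_add C01_eval_cont)
  qed
  have hm: "h \<in> borel_measurable (?S \<Otimes>\<^sub>M ?S)"
    unfolding h_def by (rule functional_measurable[OF sk_lip_unif_lip2[OF F] cp cp])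
  have pm: "(\<lambda>\<omega>. (trajectory B \<omega>, trajectory X \<omega>)) \<in> measurable M (?S \<Otimes>\<^sub>M ?S)"
    using tB tX by (rule measurable_Pair)
  have tadd: "trajectory (\<lambda>x ww. fst ww x + snd ww x) (trajectory Y \<omega>, trajectory Z \<omega>') = trajectory (\<lambda>x z. Y x (fst z) + Z x (snd z)) (\<omega>, \<omega>')"
    for Y Z :: "real \<Rightarrow> 'a \<Rightarrow> real" and \<omega> \<omega>'
    unfolding trajectory_def by (rule restrict_ext) auto
  have "(\<integral>\<omega>. F (trajectory (\<lambda>x \<omega>. B x \<omega> + X x \<omega>) \<omega>) \<partial>M) = (\<integral>\<omega>. h (trajectory B \<omega>, trajectory X \<omega>) \<partial>M)"
    unfolding h_def tadd by (simp add: trajectory_def)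
  also have "\<dots> = integral\<^sup>L (distr M (?S \<Otimes>\<^sub>M ?S) (\<lambda>\<omega>. (trajectory B \<omega>, trajectory X \<omega>))) h"
    by (rule integral_distr[OF pm hm, symmetric])
  also have "distr M (?S \<Otimes>\<^sub>M ?S) (\<lambda>\<omega>. (trajectory B \<omega>, trajectory X \<omega>)) = ?P \<Otimes>\<^sub>M law_on C01 M X"
    using indep unfolding indep_var_distribution_eq law_on_def by simp
  also have "\<dots> = density ?P (\<lambda>_. 1) \<Otimes>\<^sub>M density ?P (\<lambda>w. ennreal (g w))"
    unfolding law_X density_1 ..
  also have "\<dots> = density (?P \<Otimes>\<^sub>M ?P) (\<lambda>(x, y). 1 * ennreal (g y))"
  proof (rule pair_measure_density)
    show "(\<lambda>w. ennreal (g w)) \<in> borel_measurable ?P"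
      using g(1) sP by (simp add: measurable_cong_sets[OF sP refl])
    show "sigma_finite_measure (density ?P (\<lambda>w. ennreal (g w)))"
      unfolding law_X[symmetric] by (rule PX.sigma_finite_measure_axioms)
    show "sigma_finite_measure ?P" by (rule P.sigma_finite_measure_axioms)
  qed auto
  also have "integral\<^sup>L \<dots> h = (\<integral>ww. g (snd ww) * h ww \<partial>(?P \<Otimes>\<^sub>M ?P))"
  proof -
    have sPP: "sets (?P \<Otimes>\<^sub>M ?P) = sets (?S \<Otimes>\<^sub>M ?S)" by (intro sets_pair_measure_cong sP)
    have m1: "h \<in> borel_measurable (?P \<Otimes>\<^sub>M ?P)" using hm by (simp add: measurable_cong_sets[OF sPP refl])
    have "(\<lambda>ww. g (snd ww)) \<in> borel_measurable (?S \<Otimes>\<^sub>M ?S)" by (rule measurable_compose[OF measurable_snd g(1)])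
    then have m2: "(\<lambda>ww. g (snd ww)) \<in> borel_measurable (?P \<Otimes>\<^sub>M ?P)" by (simp add: measurable_cong_sets[OF sPP refl])
    have e: "(\<lambda>(x, y). 1 * ennreal (g y)) = (\<lambda>ww. ennreal (g (snd ww)))" by auto
    show ?thesis unfolding e
      by (subst integral_density[OF m1 m2]) (auto simp: g(2))
  qed
  also have "?P \<Otimes>\<^sub>M ?P = distr ?MM (?S \<Otimes>\<^sub>M ?S) ?BB"
    using pair_measure_distr[OF tB tB] P.sigma_finite_measure_axioms unfolding law_on_def by simp
  also have "(\<integral>ww. g (snd ww) * h ww \<partial>\<dots>) = (\<integral>z. g (snd (?BB z)) * h (?BB z) \<partial>?MM)"
  proof (rule integral_distr)
    have "(\<lambda>z. (trajectory B (fst z), trajectory B (snd z))) \<in> measurable ?MM (?S \<Otimes>\<^sub>M ?S)"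
      by (intro measurable_Pair measurable_compose[OF measurable_fst tB] measurable_compose[OF measurable_snd tB])
    then show "?BB \<in> measurable ?MM (?S \<Otimes>\<^sub>M ?S)"
      by (simp add: case_prod_beta')
    show "(\<lambda>ww. g (snd ww) * h ww) \<in> borel_measurable (?S \<Otimes>\<^sub>M ?S)"
      using measurable_compose[OF measurable_snd g(1)] hm by (rule borel_measurable_times)
  qed
  also have "\<dots> = (\<integral>z. g (trajectory (pair_snd_process B) z) * F (trajectory (pair_sum_process B) z) \<partial>?MM)"
  proof (rule Bochner_Integration.integral_cong[OF refl])
    fix z :: "'a \<times> 'a"
    obtain x y where z: "z = (x, y)" by fastforce
    have "trajectory (pair_snd_process B) (x, y) = trajectory B y"
      by (simp add: trajectory_def pair_snd_process_def)
    moreover have "trajectory (pair_sum_process B) (x, y) = trajectory (\<lambda>x ww. fst ww x + snd ww x) (trajectory B x, trajectory B y)"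
      unfolding tadd by (simp add: trajectory_def pair_sum_process_def)
    ultimately show "g (snd (?BB z)) * h (?BB z)
        = g (trajectory (pair_snd_process B) z) * F (trajectory (pair_sum_process B) z)"
      unfolding z h_def by simp
  qed
  finally show ?thesis .
qed

lemma tilt_measurable_C01: "tilt u v \<in> borel_measurable (borel_of (mtopology_of C01))"
proof -
  let ?S = "borel_of (mtopology_of C01)"
  have cp: "continuous_process ?S (\<lambda>x w. w x)"
    unfolding continuous_process_def using C01_eval_measurable C01_eval_cont by auto
  \<comment> \<open>Evaluation is the canonical process on C01: the trajectory at the sample point
    \<open>w\<close> is \<open>w\<close>.\<close>
  have "trajectory (\<lambda>x w. w x) w = w" if "w \<in> space ?S" for w
    using that unfolding trajectory_def by (auto simp: mspace_C01 extensional_restrict)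
  then have "log_tilt u v \<in> borel_measurable ?S"
    using functional_measurable[OF log_tilt_unif_lip2 cp cp, of u v] by (subst measurable_cong) auto
  then show ?thesis
    unfolding tilt_log_tilt[abs_def] by (rule borel_measurable_exp[THEN measurable_compose[rotated]]) 
qed

theorem theorem3p1:
  fixes u v :: real
    and a b :: "nat \<Rightarrow> real"
    and p :: "nat \<Rightarrow> (nat \<Rightarrow> nat) pmf"
    and M :: "'a measure"
    and B X :: "real \<Rightarrow> 'a \<Rightarrow> real"
    and K :: real
  assumes a: "\<And>N. a N = exp (- u / sqrt (real N))"
    and b: "\<And>N. b N = exp (- v / sqrt (real N))"
    and stationary: "\<And>N. N \<ge> 1 \<Longrightarrow> tasep_stationary N (1 / (1 + a N)) (1 / (1 + b N)) (p N)"
    and M: "prob_space M"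
    and B: "brownian_motion M (1 / 2) B"
    and X: "continuous_process M X"
    and indep: "prob_space.indep_var M (borel_of (mtopology_of C01)) (trajectory B)
                  (borel_of (mtopology_of C01)) (trajectory X)"
    and K: "K = (\<integral>w. tilt u v w \<partial>law_on C01 M B)"
    and law_X: "law_on C01 M X = density (law_on C01 M B) (\<lambda>w. ennreal (1 / K * tilt u v w))"
  shows "converges_weakly (mtopology_of D01)
    (\<lambda>N. law_on D01 (measure_pmf (p N))
       (\<lambda>x \<tau>. 1 / sqrt (real N) *
          (2 * real (tasep_height \<tau> (nat \<lfloor>x * real N\<rfloor>)) - real_of_int \<lfloor>real N * x\<rfloor>)))
    (law_on D01 M (\<lambda>x \<omega>. B x \<omega> + X x \<omega>))"
    (is "converges_weakly _ (\<lambda>N. law_on D01 _ (?H N)) (law_on D01 M ?Y)")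
proof -
  let ?MM = "M \<Otimes>\<^sub>M M"
  interpret prob_space M by (rule M)
  let ?D = "borel_of (mtopology_of D01)"
  have cB: "continuous_process M B" using B unfolding brownian_motion_def by blast
  have cY: "continuous_process M ?Y"
    using cB X unfolding continuous_process_def by (auto intro!: continuous_intros borel_measurable_add)
  have K0: "0 \<le> K" unfolding K by (rule integral_nonneg_AE) (simp add: tilt_def)
  let ?t = "\<lambda>z. tilt u v (trajectory (pair_snd_process B) z)"
  have gm: "(\<lambda>w. 1 / K * tilt u v w) \<in> borel_measurable (borel_of (mtopology_of C01))"
    using tilt_measurable_C01[of u v] by simp
  have g0: "0 \<le> 1 / K * tilt u v w" for w using K0 by (simp add: tilt_def)
  have rep: "(\<integral>\<omega>. F (trajectory ?Y \<omega>) \<partial>M) = (\<integral>z. (1 / K * ?t z) * F (trajectory (pair_sum_process B) z) \<partial>?MM)"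
    if "sk_lip k F" for k F
    by (rule trajectory_add_integral[OF M cB X indep law_X gm g0 that])
  have one_lip: "sk_lip 0 (\<lambda>_. 1)" by (simp add: sk_lip_def)
  \<comment> \<open>The constant test function expresses that the law of \<open>X\<close> has mass 1
    as a nonzero Bochner integral. Non-integrable functions integrate to 0, and
    \<open>1 / 0 = 0\<close>; hence the tilt is integrable and \<open>K\<close> is nonzero.\<close>
  have one: "(\<integral>z. 1 / K * ?t z \<partial>?MM) = 1" using rep[OF one_lip] by (simp add: prob_space)
  then have "integrable ?MM (\<lambda>z. 1 / K * ?t z)"
    using not_integrable_integral_eq by fastforce
  then have "integrable ?MM (\<lambda>z. K * (1 / K * ?t z))"
    by (rule integrable_mult_right)
  moreover have Kne: "K \<noteq> 0" using one by auto
  ultimately have int: "integrable ?MM ?t" by simp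
  have tK: "(\<integral>z. ?t z \<partial>?MM) = K" using one Kne by (simp add: field_simps)
  have tH: "trajectory (?H N) = height_path N" for N
    by (rule ext) (rule trajectory_height_path)
  \<comment> \<open>All sets are measurable for a \<open>pmf\<close>, so only the cadlag property
    has to be checked.\<close>
  have mH: "trajectory (?H N) \<in> measurable (measure_pmf (p N)) ?D" for N
    unfolding tH height_path_def by (simp add: step_path_cadlag)
  have mY: "trajectory ?Y \<in> measurable M ?D" by (rule trajectory_measurable_D01[OF cY])
  show ?thesis
  proof (rule converges_weakly_lipschitz)
    show "prob_space (law_on D01 (measure_pmf (p N)) (?H N))" for N
      unfolding law_on_def by (rule prob_space.prob_space_distr[OF measure_pmf.prob_space_axioms mH])
    show "prob_space (law_on D01 M ?Y)" unfolding law_on_def by (rule prob_space_distr[OF mY])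
    show "sets (law_on D01 (measure_pmf (p N)) (?H N)) = sets ?D" "sets (law_on D01 M ?Y) = sets ?D" for N
      by (simp_all add: law_on_def)
    fix k F C assume F: "sk_lip k F" and C: "\<And>f. f \<in> cadlag01 \<Longrightarrow> \<bar>F f\<bar> \<le> C"
    have Fm: "F \<in> borel_measurable ?D" by (rule continuous_map_borel_of[OF sk_lip_continuous[OF F]])
    let ?E = "\<lambda>F N. coin_expectation N (\<lambda>c. F (walk_path N True c) * tilt u v (walk_half N c))"
    have "(\<lambda>N. ?E F N / ?E (\<lambda>_. 1) N) \<longlonglongrightarrow>
        (\<integral>z. F (trajectory (pair_sum_process B) z) * ?t z \<partial>?MM) / (\<integral>z. 1 * ?t z \<partial>?MM)"
      using tilted_limit[OF M B int F C] tilted_limit[OF M B int one_lip, of 1] tK Kne by (intro tendsto_divide) auto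
    \<comment> \<open>The law \<open>p 0\<close> is arbitrary, so the ratio formula is claimed from
      \<open>N = 1\<close> on.\<close>
    moreover have "eventually (\<lambda>N. ?E F N / ?E (\<lambda>_. 1) N = integral\<^sup>L (law_on D01 (measure_pmf (p N)) (?H N)) F) sequentially"
      using eventually_ge_at_top[of 1]
    proof eventually_elim
      case (elim N)
      have "integral\<^sup>L (law_on D01 (measure_pmf (p N)) (?H N)) F = measure_pmf.expectation (p N) (\<lambda>\<tau>. F (height_path N \<tau>))"
        unfolding law_on_def by (subst integral_distr[OF mH Fm]) (simp only: tH)
      then show ?case
        using stationary_expectation[OF elim, of u v "p N" F] stationary[OF elim] unfolding a b by simp
    qed
    ultimately have lim: "(\<lambda>N. integral\<^sup>L (law_on D01 (measure_pmf (p N)) (?H N)) F) \<longlonglongrightarrow>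
        (\<integral>z. F (trajectory (pair_sum_process B) z) * ?t z \<partial>?MM) / (\<integral>z. 1 * ?t z \<partial>?MM)"
      by (rule Lim_transform_eventually)
    have "integral\<^sup>L (law_on D01 M ?Y) F = (\<integral>\<omega>. F (trajectory ?Y \<omega>) \<partial>M)"
      unfolding law_on_def by (rule integral_distr[OF mY Fm])
    also have "\<dots> = (\<integral>z. F (trajectory (pair_sum_process B) z) * ?t z / K \<partial>?MM)"
      unfolding rep[OF F] by (simp add: mult.commute)
    also have "\<dots> = (\<integral>z. F (trajectory (pair_sum_process B) z) * ?t z \<partial>?MM) / (\<integral>z. 1 * ?t z \<partial>?MM)"
      by (simp add: tK)
    finally show "(\<lambda>N. integral\<^sup>L (law_on D01 (measure_pmf (p N)) (?H N)) F) \<longlonglongrightarrow> integral\<^sup>L (law_on D01 M ?Y) F"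
      using lim by simp
  qed
qed

end
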